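(* Let $N\ge2$, let $w:\mathbb R^{N-1}\to\mathbb R$ be an affine function, and consider the pair $(u,K)$ given by $u(x)=w(x')$ for $x_N\ge0$, $u(x)=-w(x')$ for $x_N<0$, where $x=(x',x_N)\in\mathbb R^N$, and $K=\{x\in\mathbb R^N:x_N=0\}$. Then there exists $R_0>0$ such that the second variation $\delta^2F((u,K\cap B_R(x));B_R(x))$ is nonpositive for every $x\in K$ and every $R>R_0$.
   Context: $B_R(x)$ is the open ball of radius $R$ and centre $x$. Let $U=B_R(x)$ with $x\in K$, and $\Gamma=K\cap U$, with normal $\nu=e_N$. $L^{1,2}_0(U\setminus K;\partial U)$ is the space of functions $v\in H^1(U\setminus K)$ with zero trace $\mathcal H^{N-1}$-a.e. on $\partial U$. $v^\pm$ denotes the trace of $v$ on $\Gamma$ from $\{\pm x_N>0\}$. $\nabla_\Gamma$, $\operatorname{div}_\Gamma$ are the tangential gradient and divergence on $\Gamma$ (gradient and divergence in the variables $x'$), so $\nabla_\Gamma u^\pm=\pm\nabla w$; the second fundamental form of $\Gamma$ vanishes. $H^1_0(\Gamma)$ is the usual Sobolev space on the $(N-1)$-dimensional disc $\Gamma$. For $\varphi\in H^1_0(\Gamma)$ let $v_\varphi\in L^{1,2}_0(U\setminus K;\partial U)$ be the solution of $$\int_U\nabla v_\varphi\cdot\nabla z\,dx+\int_{\Gamma}\big(\operatorname{div}_\Gamma(\varphi\nabla_\Gamma u^+)z^+-\operatorname{div}_\Gamma(\varphi\nabla_\Gamma u^-)z^-\big)\,d\mathcal H^{N-1}=0\quad\forall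 z\in L^{1,2}_0(U\setminus K;\partial U),$$ so that $\partial_\nu v_\varphi^\pm=\operatorname{div}_\Gamma(\varphi\nabla_\Gamma u^\pm)$ on $\Gamma$. The second variation of the Mumford–Shah functional $F(u,K)=\int|\nabla u|^2\,dx+\mathcal H^{N-1}(K)$ at $(u,K)$ in $U$ is the quadratic form on $H^1_0(\Gamma)$ $$\delta^2F((u,\Gamma);U)[\varphi]=2\int_\Gamma(v_\varphi^+\partial_\nu v_\varphi^+-v_\varphi^-\partial_\nu v_\varphi^-)\,d\mathcal H^{N-1}+\int_\Gamma|\nabla_\Gamma\varphi|^2\,d\mathcal H^{N-1}$$ (the curvature terms of the general second variation vanish here). "The second variation is nonpositive" is used in the sense that the form fails to be positive semidefinite, i.e. $\delta^2F((u,\Gamma);U)[\varphi]<0$ for some $\varphi\in H^1_0(\Gamma)$; it does not mean that the form is $\le0$ for all $\varphi$.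
   Formalization: The affine function w is assumed non-constant; for constant w the tangential gradients vanish, v_φ = 0, and the second variation equals ∫|∇φ|² ≥ 0 for every φ, so the claim fails. *)

theory Defs
  imports "HOL-Analysis.Analysis"
begin

text \<open>
  The space \<open>\<real>\<^sup>N\<close>, \<open>N \<ge> 2\<close>, is rendered as \<open>'a \<times> real\<close> with \<open>'a\<close> an arbitrary Euclidean space of
  dimension \<open>N - 1 \<ge> 1\<close>; a point is \<open>(x', x\<^sub>N)\<close>. Functions on \<open>\<Gamma>\<close> are functions of \<open>x'\<close>, and
  \<open>(N-1)\<close>-dimensional Hausdorff measure on the flat set \<open>\<Gamma>\<close> is Lebesgue measure in \<open>x'\<close>.

  Sobolev gradients, weak divergences and traces are unique only up to null sets. They are turned
  into functions by choosing a representative; all integrals below are independent of the choice.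
\<close>

section \<open>Sobolev spaces on open sets\<close>

definition L2_on :: "'b measure \<Rightarrow> 'b set \<Rightarrow> ('b \<Rightarrow> 'c::euclidean_space) set" where
  "L2_on M A = {f. set_borel_measurable M A f \<and> set_integrable M A (\<lambda>x. (norm (f x))\<^sup>2)}"

text \<open>\<open>C\<^sup>1\<close> maps on the whole space with compact support contained in \<open>\<Omega>\<close>.\<close>

definition C1c :: "'e::euclidean_space set \<Rightarrow> ('e \<Rightarrow> 'f::euclidean_space) set" where
  "C1c \<Omega> = {X. (\<forall>y. X differentiable at y) \<and>
     (\<forall>h. continuous_on UNIV (\<lambda>y. frechet_derivative X (at y) h)) \<and>
     compact (closure {y. X y \<noteq> 0}) \<and> closure {y. X y \<noteq> 0} \<subseteq> \<Omega>}"

definition divergence :: "('e::euclidean_space \<Rightarrow> 'e) \<Rightarrow> 'e \<Rightarrow> real" where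
  "divergence X y = (\<Sum>b\<in>Basis. frechet_derivative X (at y) b \<bullet> b)"

definition grad :: "('e::euclidean_space \<Rightarrow> real) \<Rightarrow> 'e \<Rightarrow> 'e" where
  "grad \<psi> y = (\<Sum>b\<in>Basis. frechet_derivative \<psi> (at y) b *\<^sub>R b)"

definition has_weak_gradient ::
    "'e::euclidean_space set \<Rightarrow> ('e \<Rightarrow> real) \<Rightarrow> ('e \<Rightarrow> 'e) \<Rightarrow> bool" where
  "has_weak_gradient \<Omega> v G \<longleftrightarrow> G \<in> L2_on lborel \<Omega> \<and>
     (\<forall>X\<in>C1c \<Omega>. (LINT y:\<Omega>|lborel. v y * divergence X y) = - (LINT y:\<Omega>|lborel. G y \<bullet> X y))"

definition H1 :: "'e::euclidean_space set \<Rightarrow> ('e \<Rightarrow> real) set" where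
  "H1 \<Omega> = {v \<in> L2_on lborel \<Omega>. \<exists>G. has_weak_gradient \<Omega> v G}"

definition weak_gradient :: "'e::euclidean_space set \<Rightarrow> ('e \<Rightarrow> real) \<Rightarrow> 'e \<Rightarrow> 'e" where
  "weak_gradient \<Omega> v = (SOME G. has_weak_gradient \<Omega> v G)"

text \<open>The closure of \<open>C\<^sup>1\<^sub>c(\<Omega>)\<close> in \<open>H\<^sup>1(\<Omega>)\<close>.\<close>

definition H10 :: "'e::euclidean_space set \<Rightarrow> ('e \<Rightarrow> real) set" where
  "H10 \<Omega> = {\<phi> \<in> H1 \<Omega>. \<exists>\<psi>::nat \<Rightarrow> 'e \<Rightarrow> real. (\<forall>k. \<psi> k \<in> C1c \<Omega>) \<and>
     (\<lambda>k. LINT y:\<Omega>|lborel. (\<psi> k y - \<phi> y)\<^sup>2 + (norm (grad (\<psi> k) y - weak_gradient \<Omega> \<phi> y))\<^sup>2)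
       \<longlonglongrightarrow> 0}"

definition has_weak_divergence ::
    "'e::euclidean_space set \<Rightarrow> ('e \<Rightarrow> 'e) \<Rightarrow> ('e \<Rightarrow> real) \<Rightarrow> bool" where
  "has_weak_divergence \<Omega> Y g \<longleftrightarrow> g \<in> L2_on lborel \<Omega> \<and>
     (\<forall>\<psi>\<in>C1c \<Omega>. (LINT y:\<Omega>|lborel. Y y \<bullet> grad \<psi> y) = - (LINT y:\<Omega>|lborel. g y * \<psi> y))"

definition weak_divergence :: "'e::euclidean_space set \<Rightarrow> ('e \<Rightarrow> 'e) \<Rightarrow> 'e \<Rightarrow> real" where
  "weak_divergence \<Omega> Y = (SOME g. has_weak_divergence \<Omega> Y g)"


section \<open>The cracked ball and traces\<close>

text \<open>Throughout, \<open>U = ball c R\<close> with \<open>c \<in> crack\<close>, and \<open>s = 1\<close> or \<open>s = -1\<close> selects the side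
  \<open>{s x\<^sub>N > 0}\<close> of the crack.\<close>

definition crack :: "('a::euclidean_space \<times> real) set" where
  "crack = {y. snd y = 0}"

definition \<Gamma> :: "'a::euclidean_space \<times> real \<Rightarrow> real \<Rightarrow> 'a set" where
  "\<Gamma> c R = {x'. (x', 0) \<in> crack \<inter> ball c R}"

definition half_ball :: "'a::euclidean_space \<times> real \<Rightarrow> real \<Rightarrow> real \<Rightarrow> ('a \<times> real) set" where
  "half_ball c R s = {y \<in> ball c R. 0 < s * snd y}"

text \<open>The surface measure \<open>\<H>\<^sup>N\<^sup>-\<^sup>1\<close> on \<open>sphere c R\<close>: by polar coordinates it is \<open>N/R\<close> times the image
  of Lebesgue measure on the ball under the radial projection onto the sphere.\<close>

definition sphere_measure :: "'e::euclidean_space \<Rightarrow> real \<Rightarrow> 'e measure" where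
  "sphere_measure c R = scale_measure (ennreal (real DIM('e) / R))
     (distr (restrict_space lborel (ball c R)) borel
        (\<lambda>y. c + (R / norm (y - c)) *\<^sub>R (y - c)))"

text \<open>Traces are defined by the Gauss--Green formula
  \<open>\<integral>\<^sub>\<Omega> (v div X + \<nabla>v \<sqdot> X) = \<integral>\<^sub>\<partial>\<^sub>\<Omega> (trace v) X \<sqdot> n\<close> on the half ball \<open>\<Omega>\<close>, whose boundary consists of
  \<open>\<Gamma>\<close>, with outer normal \<open>- s e\<^sub>N\<close>, and a hemisphere. Fields with compact support in \<open>U\<close> see only the
  trace on \<open>\<Gamma>\<close>, fields vanishing on the crack see only the trace on the hemisphere.\<close>

definition gauss_green_integral ::
    "'a::euclidean_space \<times> real \<Rightarrow> real \<Rightarrow> real \<Rightarrow> ('a \<times> real \<Rightarrow> real) \<Rightarrow>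
     ('a \<times> real \<Rightarrow> 'a \<times> real) \<Rightarrow> real" where
  "gauss_green_integral c R s v X =
     (LINT y:half_ball c R s|lborel.
        v y * divergence X y + weak_gradient (ball c R - crack) v y \<bullet> X y)"

definition has_crack_trace ::
    "'a::euclidean_space \<times> real \<Rightarrow> real \<Rightarrow> real \<Rightarrow> ('a \<times> real \<Rightarrow> real) \<Rightarrow> ('a \<Rightarrow> real) \<Rightarrow> bool" where
  "has_crack_trace c R s v \<tau> \<longleftrightarrow> \<tau> \<in> L2_on lborel (\<Gamma> c R) \<and>
     (\<forall>X\<in>C1c (ball c R).
        gauss_green_integral c R s v X = - s * (LINT x':\<Gamma> c R|lborel. \<tau> x' * snd (X (x', 0))))"

definition crack_trace ::
    "'a::euclidean_space \<times> real \<Rightarrow> real \<Rightarrow> real \<Rightarrow> ('a \<times> real \<Rightarrow> real) \<Rightarrow> 'a \<Rightarrow> real" where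
  "crack_trace c R s v = (SOME \<tau>. has_crack_trace c R s v \<tau>)"

definition has_sphere_trace ::
    "'a::euclidean_space \<times> real \<Rightarrow> real \<Rightarrow> real \<Rightarrow> ('a \<times> real \<Rightarrow> real) \<Rightarrow>
     ('a \<times> real \<Rightarrow> real) \<Rightarrow> bool" where
  "has_sphere_trace c R s v \<theta> \<longleftrightarrow> \<theta> \<in> L2_on (sphere_measure c R) {y. 0 < s * snd y} \<and>
     (\<forall>X\<in>C1c UNIV. (\<forall>y\<in>crack. X y = 0) \<longrightarrow>
        gauss_green_integral c R s v X =
          (LINT y:{y. 0 < s * snd y}|sphere_measure c R. \<theta> y * (X y \<bullet> ((y - c) /\<^sub>R R))))"

text \<open>The space \<open>L\<^sup>1\<^sup>,\<^sup>2\<^sub>0(U - K; \<partial>U)\<close>. The equator \<open>\<partial>U \<inter> K\<close> is \<open>\<H>\<^sup>N\<^sup>-\<^sup>1\<close>-null.\<close>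

definition L120 :: "'a::euclidean_space \<times> real \<Rightarrow> real \<Rightarrow> ('a \<times> real \<Rightarrow> real) set" where
  "L120 c R = {v \<in> H1 (ball c R - crack). \<forall>s\<in>{1, -1}. \<exists>\<theta>. has_sphere_trace c R s v \<theta> \<and>
     (AE y in sphere_measure c R. 0 < s * snd y \<longrightarrow> \<theta> y = 0)}"

text \<open>The derivative in direction \<open>\<nu> = e\<^sub>N\<close> on the side \<open>s\<close> of \<open>\<Gamma>\<close> of a function that is harmonic on
  that side, in the usual weak sense; \<open>- s e\<^sub>N\<close> is the outer normal.\<close>

definition has_normal_derivative ::
    "'a::euclidean_space \<times> real \<Rightarrow> real \<Rightarrow> real \<Rightarrow> ('a \<times> real \<Rightarrow> real) \<Rightarrow> ('a \<Rightarrow> real) \<Rightarrow> bool" where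
  "has_normal_derivative c R s v h \<longleftrightarrow> h \<in> L2_on lborel (\<Gamma> c R) \<and>
     (\<forall>z\<in>L120 c R.
        (LINT y:half_ball c R s|lborel.
           weak_gradient (ball c R - crack) v y \<bullet> weak_gradient (ball c R - crack) z y) =
        - s * (LINT x':\<Gamma> c R|lborel. h x' * crack_trace c R s z x'))"

definition normal_derivative ::
    "'a::euclidean_space \<times> real \<Rightarrow> real \<Rightarrow> real \<Rightarrow> ('a \<times> real \<Rightarrow> real) \<Rightarrow> 'a \<Rightarrow> real" where
  "normal_derivative c R s v = (SOME h. has_normal_derivative c R s v h)"


section \<open>The second variation\<close>

text \<open>\<open>div\<^sub>\<Gamma> (\<phi> \<nabla>\<^sub>\<Gamma> u\<^sup>\<plusminus>)\<close>\<close>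

definition neumann_datum ::
    "('a::euclidean_space \<times> real \<Rightarrow> real) \<Rightarrow> 'a \<times> real \<Rightarrow> real \<Rightarrow> real \<Rightarrow> ('a \<Rightarrow> real) \<Rightarrow> 'a \<Rightarrow> real" where
  "neumann_datum u c R s \<phi> =
     weak_divergence (\<Gamma> c R) (\<lambda>x'. \<phi> x' *\<^sub>R weak_gradient (\<Gamma> c R) (crack_trace c R s u) x')"

definition is_v_phi ::
    "('a::euclidean_space \<times> real \<Rightarrow> real) \<Rightarrow> 'a \<times> real \<Rightarrow> real \<Rightarrow> ('a \<Rightarrow> real) \<Rightarrow>
     ('a \<times> real \<Rightarrow> real) \<Rightarrow> bool" where
  "is_v_phi u c R \<phi> v \<longleftrightarrow> v \<in> L120 c R \<and>
     (\<forall>z\<in>L120 c R.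
        (LINT y:ball c R - crack|lborel.
           weak_gradient (ball c R - crack) v y \<bullet> weak_gradient (ball c R - crack) z y) +
        (LINT x':\<Gamma> c R|lborel.
           neumann_datum u c R 1 \<phi> x' * crack_trace c R 1 z x' -
           neumann_datum u c R (-1) \<phi> x' * crack_trace c R (-1) z x') = 0)"

definition v_phi ::
    "('a::euclidean_space \<times> real \<Rightarrow> real) \<Rightarrow> 'a \<times> real \<Rightarrow> real \<Rightarrow> ('a \<Rightarrow> real) \<Rightarrow> 'a \<times> real \<Rightarrow> real" where
  "v_phi u c R \<phi> = (SOME v. is_v_phi u c R \<phi> v)"

text \<open>\<open>\<delta>\<^sup>2F((u, \<Gamma>); U)[\<phi>]\<close> for \<open>U = ball c R\<close>; the flat crack contributes no curvature terms.\<close>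

definition second_variation ::
    "('a::euclidean_space \<times> real \<Rightarrow> real) \<Rightarrow> 'a \<times> real \<Rightarrow> real \<Rightarrow> ('a \<Rightarrow> real) \<Rightarrow> real" where
  "second_variation u c R \<phi> = (let v = v_phi u c R \<phi> in
     2 * (LINT x':\<Gamma> c R|lborel.
            crack_trace c R 1 v x' * normal_derivative c R 1 v x' -
            crack_trace c R (-1) v x' * normal_derivative c R (-1) v x') +
     (LINT x':\<Gamma> c R|lborel. (norm (weak_gradient (\<Gamma> c R) \<phi> x'))\<^sup>2))"

end

theory Submission
  imports Defs
begin

text \<open>
  Testing the equation for \<open>v\<^sub>\<phi>\<close> with \<open>v\<^sub>\<phi>\<close> itself gives
  \<open>\<delta>\<^sup>2F[\<phi>] = \<integral>|\<nabla>\<phi>|\<^sup>2 - 2 \<integral>|\<nabla>v\<^sub>\<phi>|\<^sup>2\<close>, and by duality \<open>\<integral>|\<nabla>v\<^sub>\<phi>|\<^sup>2 \<ge> P\<^sup>2 / \<integral>|\<nabla>z|\<^sup>2\<close> for every test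
  function \<open>z\<close>, where \<open>P = \<integral>\<^sub>\<Gamma> (a \<sqdot> \<nabla>\<phi>) (z\<^sup>+ + z\<^sup>-)\<close> and \<open>a = \<nabla>w\<close>. Rescaling fixed \<open>\<phi>\<close> and \<open>z\<close> to the ball of
  radius \<open>R\<close>, the first integral grows like \<open>R\<^sup>N\<^sup>-\<^sup>3\<close> and the lower bound like \<open>R\<^sup>N\<^sup>-\<^sup>2\<close>, so the form becomes
  negative for large \<open>R\<close>.

  Existence of \<open>v\<^sub>\<phi>\<close> is needed because it is defined by choice. A function in \<open>L120\<close> and its traces on the crack
  are recovered from its gradient by integrating the normal derivative along normal lines. Hence the gradients form
  a closed subspace of \<open>L\<^sup>2\<close>, the pairing with the traces is an \<open>L\<^sup>2\<close> inner product with a fixed field, and the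
  gradient of \<open>v\<^sub>\<phi>\<close> is the orthogonal projection of that field.
\<close>

text \<open>Gradients, traces and normal derivatives are all values of \<open>SOME\<close>: each
  needs a witness and uniqueness almost everywhere before anything can be computed with it. Since
  traces are given by Gauss-Green formulas, the space \<open>L120\<close> is traded for pairs of a
  function and a gradient subject to a linear condition that survives L2 limits. Zero trace on the
  sphere is what makes such a function computable from its gradient: integration starts at the
  sphere, where the function vanishes.

  One-sided normal derivatives of \<open>v_phi\<close> exist because cutting an admissible function
  to one side of the crack keeps it admissible, so the equation splits into two independent ones.

  On the unit ball the competitors are (1 - |x'|^2)_+^2 for \<phi> and (a . x') (1 - |x|^2)_+^2 for
  z. Then a . grad \<phi> = -4 (1 - |x'|^2)_+ (a . x'), hence the integrand of P has one sign and P
  is nonzero as soon as a is. For constant \<open>w\<close> the Neumann data vanish and the form is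
  the Dirichlet integral of \<phi>, so nonconstancy of \<open>w\<close> is decisive.\<close>

section \<open>Calculus of continuously differentiable maps and compactly supported test
  fields\<close>

definition C1 :: "('e::euclidean_space \<Rightarrow> 'f::euclidean_space) \<Rightarrow> bool" where
  "C1 X \<longleftrightarrow> (\<forall>y. X differentiable at y) \<and>
     (\<forall>h. continuous_on UNIV (\<lambda>y. frechet_derivative X (at y) h))"

lemma C1_has_derivative:
  "C1 X \<Longrightarrow> (X has_derivative frechet_derivative X (at y)) (at y)"
  by (simp add: C1_def frechet_derivative_works)

lemma C1_continuous_derivative: "C1 X \<Longrightarrow> continuous_on UNIV (\<lambda>y. frechet_derivative X (at y) h)"
  by (simp add: C1_def)

lemma C1I:
  assumes "\<And>y. (X has_derivative X' y) (at y)" "\<And>h. continuous_on UNIV (\<lambda>y. X' y h)"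
  shows "C1 X"
proof -
  have "frechet_derivative X (at y) = X' y" for y
    using frechet_derivative_at[OF assms(1)[of y]] by simp
  then show ?thesis
    using assms by (auto simp: C1_def differentiable_def)
qed

lemma C1_continuous: "C1 X \<Longrightarrow> continuous_on UNIV X"
  by (meson C1_def continuous_at_imp_continuous_on differentiable_imp_continuous_within)

lemma C1_measurable [measurable_dest]: "C1 X \<Longrightarrow> X \<in> borel_measurable borel"
  by (simp add: C1_continuous borel_measurable_continuous_onI)

lemma C1_const: "C1 (\<lambda>_. k)"
  by (rule C1I[where X' = "\<lambda>_ _. 0"]) auto

lemma C1_bounded_linear: "bounded_linear L \<Longrightarrow> C1 L"
  by (rule C1I[where X' = "\<lambda>_. L"]) (auto simp: bounded_linear_imp_has_derivative)

lemma C1_compose_left: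
  assumes L: "bounded_linear L" and X: "C1 X"
  shows "C1 (\<lambda>y. L (X y))"
  by (rule C1I[where X' = "\<lambda>y h. L (frechet_derivative X (at y) h)"])
    (auto intro!: bounded_linear.has_derivative[OF L] C1_has_derivative[OF X]
      bounded_linear.continuous_on[OF L] C1_continuous_derivative[OF X])

lemma C1_compose_right:
  assumes L: "bounded_linear L" and X: "C1 X"
  shows "C1 (\<lambda>y. X (L y))"
proof (rule C1I[where X' = "\<lambda>y h. frechet_derivative X (at (L y)) (L h)"])
  fix y show "((\<lambda>y. X (L y)) has_derivative (\<lambda>h. frechet_derivative X (at (L y)) (L h))) (at y)"
    using diff_chain_at[OF bounded_linear_imp_has_derivative[OF L] C1_has_derivative[OF X], of y]
    by (simp add: o_def)
next
  fix h show "continuous_on UNIV (\<lambda>y. frechet_derivative X (at (L y)) (L h))"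
    using continuous_on_compose2[OF C1_continuous_derivative[OF X] bounded_linear.continuous_on[OF L continuous_on_id]]
    by auto
qed

lemma C1_diff: "C1 X \<Longrightarrow> C1 Y \<Longrightarrow> C1 (\<lambda>y. X y - Y y)"
  by (rule C1I[where X' = "\<lambda>y h. frechet_derivative X (at y) h - frechet_derivative Y (at y) h"])
    (auto intro!: has_derivative_diff C1_has_derivative continuous_intros C1_continuous_derivative)

lemma C1_scaleR_derivative:
  assumes "C1 f" "C1 X"
  shows "((\<lambda>y. f y *\<^sub>R X y) has_derivative
    (\<lambda>h. f y *\<^sub>R frechet_derivative X (at y) h + frechet_derivative f (at y) h *\<^sub>R X y)) (at y)"
  by (intro has_derivative_scaleR C1_has_derivative assms)

lemma C1_scaleR:
  assumes "C1 f" "C1 X"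
  shows "C1 (\<lambda>y. f y *\<^sub>R X y)"
  by (rule C1I[OF C1_scaleR_derivative[OF assms]])
    (intro continuous_intros C1_continuous_derivative C1_continuous assms)

lemma C1_mult:
  fixes f g :: "'e::euclidean_space \<Rightarrow> real"
  shows "C1 f \<Longrightarrow> C1 g \<Longrightarrow> C1 (\<lambda>y. f y * g y)"
  using C1_scaleR[of f g] by simp

lemma C1_compose_real:
  assumes "C1 f" "\<And>t. (h has_real_derivative h' t) (at t)" "continuous_on UNIV h'"
  shows "C1 (\<lambda>y. h (f y))"
proof (rule C1I[where X' = "\<lambda>y k. h' (f y) * frechet_derivative f (at y) k"])
  fix y show "((\<lambda>y. h (f y)) has_derivative (\<lambda>k. h' (f y) * frechet_derivative f (at y) k)) (at y)"
    using diff_chain_at[OF C1_has_derivative[OF assms(1)] assms(2)[of "f y", unfolded has_field_derivative_def]]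
    by (simp add: o_def)
next
  fix k show "continuous_on UNIV (\<lambda>y. h' (f y) * frechet_derivative f (at y) k)"
    using continuous_on_compose2[OF assms(3) C1_continuous[OF assms(1)]]
    by (auto intro!: continuous_intros C1_continuous_derivative assms)
qed

lemma C1_prod:
  fixes f :: "'i \<Rightarrow> 'e::euclidean_space \<Rightarrow> real"
  assumes "finite I" "\<And>i. i \<in> I \<Longrightarrow> C1 (f i)"
  shows "C1 (\<lambda>y. \<Prod>i\<in>I. f i y)"
  using assms by (induction I rule: finite_induct) (auto intro!: C1_mult C1_const)

lemma grad_eqI: "(f has_derivative (\<lambda>h. g \<bullet> h)) (at y) \<Longrightarrow> grad f y = g"
  by (simp add: grad_def frechet_derivative_at[symmetric] euclidean_representation)

lemma grad_inner:
  assumes "C1 f" shows "grad f y \<bullet> h = frechet_derivative f (at y) h"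
proof -
  interpret linear "frechet_derivative f (at y)"
    using C1_has_derivative[OF assms] has_derivative_linear by blast
  have "frechet_derivative f (at y) (\<Sum>b\<in>Basis. (h \<bullet> b) *\<^sub>R b) = (\<Sum>b\<in>Basis. (h \<bullet> b) * frechet_derivative f (at y) b)"
    by (simp add: sum scale)
  then show ?thesis
    by (simp add: grad_def euclidean_representation inner_sum_left)
      (simp add: inner_commute mult.commute)
qed

lemma grad_continuous: "C1 f \<Longrightarrow> continuous_on UNIV (grad f)"
  unfolding grad_def[abs_def] by (intro continuous_intros C1_continuous_derivative)

lemma divergence_continuous: "C1 X \<Longrightarrow> continuous_on UNIV (divergence X)"
  unfolding divergence_def[abs_def] by (intro continuous_intros C1_continuous_derivative)

lemma divergence_eq: "(X has_derivative X') (at y) \<Longrightarrow> divergence X y = (\<Sum>b\<in>Basis. X' b \<bullet> b)"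
  by (simp add: divergence_def frechet_derivative_at[symmetric])

lemma divergence_scaleR:
  assumes "C1 f" "C1 X"
  shows "divergence (\<lambda>y. f y *\<^sub>R X y) y = f y * divergence X y + grad f y \<bullet> X y"
  by (simp add: divergence_eq[OF C1_scaleR_derivative[OF assms]] divergence_def grad_def
      inner_add_left sum.distrib sum_distrib_left inner_sum_left inner_sum_right inner_commute[of _ "X y"])

lemma divergence_diff:
  assumes "C1 X" "C1 Y"
  shows "divergence (\<lambda>y. X y - Y y) y = divergence X y - divergence Y y"
  by (subst divergence_eq[OF has_derivative_diff[OF C1_has_derivative[OF assms(1)] C1_has_derivative[OF assms(2)]]])
    (simp add: divergence_def inner_diff_left sum_subtractf)

lemma C1cI:
  assumes "C1 X" "compact K" "K \<subseteq> \<Omega>" "\<And>y. y \<notin> K \<Longrightarrow> X y = 0"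
  shows "X \<in> C1c \<Omega>"
proof -
  have *: "closure {y. X y \<noteq> 0} \<subseteq> K"
    by (rule closure_minimal) (use assms in \<open>auto intro: compact_imp_closed\<close>)
  with assms(2) have "compact (closure {y. X y \<noteq> 0})"
    using compact_Int_closed[OF assms(2) closed_closure, of "{y. X y \<noteq> 0}"] by (metis Int_absorb1)
  with * show ?thesis using assms by (auto simp: C1c_def C1_def)
qed

lemma C1c_C1: "X \<in> C1c \<Omega> \<Longrightarrow> C1 X"
  by (simp add: C1c_def C1_def)

text \<open>The complement of the closed support is open, so the derivative vanishes there as well.
  One compact set thus serves the field, its divergence and its gradient.\<close>

lemma C1cE:
  assumes "X \<in> C1c \<Omega>"
  obtains K where "compact K" "K \<subseteq> \<Omega>" "\<And>y. y \<notin> K \<Longrightarrow> X y = 0"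
    "\<And>y. y \<notin> K \<Longrightarrow> frechet_derivative X (at y) = (\<lambda>_. 0)"
proof (rule that[of "closure {y. X y \<noteq> 0}"])
  let ?K = "closure {y. X y \<noteq> 0}"
  show "compact ?K" "?K \<subseteq> \<Omega>" using assms by (auto simp: C1c_def)
  show X0: "X y = 0" if "y \<notin> ?K" for y
    using that closure_subset[of "{y. X y \<noteq> 0}"] by auto
  fix y assume y: "y \<notin> ?K"
  have "(X has_derivative (\<lambda>_. 0)) (at y)"
  proof (rule has_derivative_transform_within_open[OF has_derivative_const])
    show "open (- ?K)" by (rule open_Compl[OF closed_closure])
    show "y \<in> - ?K" using y by blast
    show "0 = X x" if "x \<in> - ?K" for x using X0[of x] that by simp
  qed
  then show "frechet_derivative X (at y) = (\<lambda>_. 0)"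
    by (simp add: frechet_derivative_at[symmetric])
qed

lemma C1c_support:
  assumes "X \<in> C1c \<Omega>"
  shows "\<exists>K. compact K \<and> K \<subseteq> \<Omega> \<and> (\<forall>y. y \<notin> K \<longrightarrow> X y = 0)"
  by (rule C1cE[OF assms]) blast

lemma C1c_mono: "X \<in> C1c \<Omega> \<Longrightarrow> \<Omega> \<subseteq> \<Omega>' \<Longrightarrow> X \<in> C1c \<Omega>'"
  by (auto simp: C1c_def)

lemma C1c_zero: "X \<in> C1c \<Omega> \<Longrightarrow> y \<notin> \<Omega> \<Longrightarrow> X y = 0"
  by (metis C1cE in_mono)

lemma C1c_divergence_zero: "X \<in> C1c \<Omega> \<Longrightarrow> y \<notin> \<Omega> \<Longrightarrow> divergence X y = 0"
  by (erule C1cE, subgoal_tac "frechet_derivative X (at y) = (\<lambda>_. 0)") (auto simp: divergence_def)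

lemma C1c_grad_zero: "f \<in> C1c \<Omega> \<Longrightarrow> y \<notin> \<Omega> \<Longrightarrow> grad f y = 0"
  by (erule C1cE, subgoal_tac "frechet_derivative f (at y) = (\<lambda>_. 0)") (auto simp: grad_def)

lemma C1c_diff:
  assumes "X \<in> C1c \<Omega>" "Y \<in> C1c \<Omega>" shows "(\<lambda>y. X y - Y y) \<in> C1c \<Omega>"
proof -
  obtain K L where "compact K" "K \<subseteq> \<Omega>" "\<And>y. y \<notin> K \<Longrightarrow> X y = 0" "compact L" "L \<subseteq> \<Omega>" "\<And>y. y \<notin> L \<Longrightarrow> Y y = 0"
    using C1c_support[OF assms(1)] C1c_support[OF assms(2)] by auto
  then show ?thesis
    by (intro C1cI[where K = "K \<union> L"]) (auto intro!: C1_diff C1c_C1[OF assms(1)] C1c_C1[OF assms(2)])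
qed

lemma C1c_scaleR_right:
  assumes "C1 f" "X \<in> C1c \<Omega>" shows "(\<lambda>y. f y *\<^sub>R X y) \<in> C1c \<Omega>"
proof -
  obtain K where "compact K" "K \<subseteq> \<Omega>" "\<And>y. y \<notin> K \<Longrightarrow> X y = 0"
    using C1c_support[OF assms(2)] by auto
  then show ?thesis
    by (intro C1cI[where K = K] C1_scaleR assms(1) C1c_C1[OF assms(2)]) simp_all
qed

lemma C1c_scaleR_left:
  assumes "f \<in> C1c \<Omega>" "C1 X" shows "(\<lambda>y. f y *\<^sub>R X y) \<in> C1c \<Omega>"
proof -
  obtain K where "compact K" "K \<subseteq> \<Omega>" "\<And>y. y \<notin> K \<Longrightarrow> f y = 0"
    using C1c_support[OF assms(1)] by auto
  then show ?thesis
    by (intro C1cI[where K = K] C1_scaleR assms(2) C1c_C1[OF assms(1)]) simp_all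
qed

lemma C1c_mult_right:
  fixes f g :: "'e::euclidean_space \<Rightarrow> real"
  shows "C1 f \<Longrightarrow> g \<in> C1c \<Omega> \<Longrightarrow> (\<lambda>y. f y * g y) \<in> C1c \<Omega>"
  using C1c_scaleR_right[of f g] by simp

lemma integrable_compact_support:
  fixes f :: "'e::euclidean_space \<Rightarrow> 'f::euclidean_space"
  assumes "continuous_on UNIV f" "compact K" "\<And>y. y \<notin> K \<Longrightarrow> f y = 0"
  shows "integrable lborel f"
proof -
  have "integrable lborel (\<lambda>x. indicator K x *\<^sub>R f x)"
    using assms by (intro borel_integrable_compact) (auto intro: continuous_on_subset)
  also have "(\<lambda>x. indicator K x *\<^sub>R f x) = f"
    using assms(3) by (auto simp: indicator_def)
  finally show ?thesis .
qed

lemma bounded_compact_support: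
  fixes f :: "'e::euclidean_space \<Rightarrow> 'f::euclidean_space"
  assumes "continuous_on UNIV f" "compact K" "\<And>y. y \<notin> K \<Longrightarrow> f y = 0"
  shows "\<exists>B. \<forall>y. norm (f y) \<le> B"
proof -
  have "bounded (f ` K)"
    using assms(1,2) by (meson compact_continuous_image compact_imp_bounded continuous_on_subset subset_UNIV)
  then obtain B where "\<And>y. y \<in> K \<Longrightarrow> norm (f y) \<le> B" by (auto simp: bounded_iff)
  then have "norm (f y) \<le> max B 0" for y
    using assms(3)[of y] by (cases "y \<in> K") (auto simp: le_max_iff_disj)
  then show ?thesis by blast
qed

lemma C1c_bounded:
  assumes "X \<in> C1c \<Omega>"
  shows "\<exists>B. \<forall>y. norm (X y) \<le> B"
  by (rule C1cE[OF assms], rule bounded_compact_support) (auto intro: C1_continuous C1c_C1[OF assms])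

section \<open>Bump functions\<close>

text \<open>Test functions are only required to be \<open>C1\<close>, so products of squared
  positive parts can replace the usual smooth exponential bump.\<close>

definition bump :: "'e::euclidean_space \<Rightarrow> 'e \<Rightarrow> 'e \<Rightarrow> real" where
  "bump a b x = (\<Prod>i\<in>Basis. (max 0 ((x - a) \<bullet> i))\<^sup>2 * (max 0 ((b - x) \<bullet> i))\<^sup>2)"

lemma pos_square_derivative:
  "((\<lambda>t::real. (max 0 t)\<^sup>2) has_real_derivative 2 * max 0 t) (at t)"
proof -
  consider "t > 0" | "t < 0" | "t = 0" by linarith
  then show ?thesis
  proof cases
    case 1
    have "((\<lambda>t::real. t\<^sup>2) has_real_derivative 2 * t) (at t)"
      by (auto intro!: derivative_eq_intros)
    then have "((\<lambda>t::real. (max 0 t)\<^sup>2) has_real_derivative 2 * t) (at t)"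
      by (rule has_field_derivative_transform_within_open[where S = "{0<..}"]) (use 1 in auto)
    with 1 show ?thesis by simp
  next
    case 2
    have "((\<lambda>t::real. (max 0 t)\<^sup>2) has_real_derivative 0) (at t)"
      by (rule has_field_derivative_transform_within_open[where S = "{..<0}" and f = "\<lambda>_. 0"]) (use 2 in auto)
    with 2 show ?thesis by simp
  next
    case 3
    have "((\<lambda>h::real. (max 0 h)\<^sup>2 / h) \<longlongrightarrow> 0) (at 0)"
    proof (rule Lim_null_comparison)
      show "\<forall>\<^sub>F h in at (0::real). norm ((max 0 h)\<^sup>2 / h) \<le> \<bar>h\<bar>"
        by (rule always_eventually) (auto simp: max_def power2_eq_square)
      show "((\<lambda>h. \<bar>h\<bar>) \<longlongrightarrow> 0) (at (0::real))"
        using tendsto_rabs_zero[OF tendsto_ident_at] .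
    qed
    with 3 show ?thesis by (simp add: DERIV_def)
  qed
qed

lemma C1_pos_square:
  fixes f :: "'e::euclidean_space \<Rightarrow> real"
  shows "C1 f \<Longrightarrow> C1 (\<lambda>x. (max 0 (f x))\<^sup>2)"
  by (erule C1_compose_real[where h = "\<lambda>t. (max 0 t)\<^sup>2", OF _ pos_square_derivative])
    (auto intro!: continuous_intros)

lemma C1_bump: "C1 (bump a b)"
proof -
  have 1: "C1 (\<lambda>x. (x - a) \<bullet> i)" "C1 (\<lambda>x. (b - x) \<bullet> i)" for i
    by (rule C1_compose_left[OF bounded_linear_inner_left], 
        intro C1_diff C1_const C1_bounded_linear bounded_linear_ident)+
  show ?thesis unfolding bump_def[abs_def]
    by (intro C1_prod C1_mult C1_pos_square 1 finite_Basis)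
qed

lemma bump_nonneg: "0 \<le> bump a b x"
  by (auto simp: bump_def intro!: prod_nonneg)

lemma bump_pos_iff: "0 < bump a b x \<longleftrightarrow> x \<in> box a b"
proof
  assume "0 < bump a b x"
  then have "bump a b x \<noteq> 0" by simp
  then show "x \<in> box a b"
    by (auto simp: bump_def mem_box inner_diff_left max_def not_le split: if_splits)
next
  assume "x \<in> box a b"
  then show "0 < bump a b x"
    by (auto simp: bump_def mem_box inner_diff_left max_def not_le intro!: prod_pos)
qed

lemma bump_zero: "x \<notin> box a b \<Longrightarrow> bump a b x = 0"
  using bump_nonneg[of a b x] bump_pos_iff[of a b x] by force

lemma bump_C1c: "cbox a b \<subseteq> \<Omega> \<Longrightarrow> bump a b \<in> C1c \<Omega>"
  by (rule C1cI[where K = "cbox a b"]) (auto intro!: C1_bump bump_zero dest: subsetD[OF box_subset_cbox])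

text \<open>This is n b / (1 + n b) for b = \<open>bump a b x\<close>: a \<open>C1\<close> sequence
  with values between 0 and 1 that tends pointwise to the indicator of the open box. Integrals over
  boxes become limits of integrals against test functions.\<close>

definition box_approx :: "'e::euclidean_space \<Rightarrow> 'e \<Rightarrow> nat \<Rightarrow> 'e \<Rightarrow> real" where
  "box_approx a b n x = 1 - 1 / (1 + real n * bump a b x)"

lemma C1_box_approx: "C1 (box_approx a b n)"
proof -
  let ?X' = "\<lambda>y h. real n * frechet_derivative (bump a b) (at y) h / (1 + real n * bump a b y)\<^sup>2"
  have p: "1 + real n * bump a b y > 0" for y
    by (simp add: add_pos_nonneg bump_nonneg)
  show ?thesis
  proof (rule C1I[where X' = ?X'])
    fix y
    note [derivative_intros] = C1_has_derivative[OF C1_bump[of a b]]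
    show "(box_approx a b n has_derivative ?X' y) (at y)"
      unfolding box_approx_def[abs_def]
      by (rule derivative_eq_intros refl | use p[of y] in force)+
        (auto simp: fun_eq_iff power2_eq_square divide_simps)
  next
    fix h
    have "(1 + real n * bump a b y)\<^sup>2 \<noteq> 0" for y using p[of y] by simp
    then show "continuous_on UNIV (\<lambda>y. ?X' y h)"
      by (auto intro!: continuous_intros C1_continuous_derivative[OF C1_bump] C1_continuous[OF C1_bump])
  qed
qed

lemma box_approx_bounds: "0 \<le> box_approx a b n x" "box_approx a b n x \<le> 1"
  using mult_nonneg_nonneg[OF of_nat_0_le_iff[of n] bump_nonneg[of a b x]]
  by (simp_all add: box_approx_def)

lemma box_approx_tendsto: "(\<lambda>n. box_approx a b n x) \<longlonglongrightarrow> indicator (box a b) x"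
proof (cases "x \<in> box a b")
  case True
  then have "bump a b x > 0" by (simp add: bump_pos_iff)
  then have "(\<lambda>n. 1 - 1 / (1 + real n * bump a b x)) \<longlonglongrightarrow> 1 - 0"
    by (intro tendsto_intros tendsto_divide_0[OF tendsto_const] filterlim_at_top_imp_at_infinity
        filterlim_tendsto_add_at_top[OF tendsto_const] filterlim_at_top_mult_tendsto_pos[OF tendsto_const]
        filterlim_real_sequentially)
  with True show ?thesis by (simp add: box_approx_def)
qed (simp add: box_approx_def bump_zero)

section \<open>The fundamental lemma of the calculus of variations\<close>

text \<open>Boxes are stable under intersection and generate the Borel sets, so by Dynkin's argument
  the integral of \<open>f\<close> vanishes over every Borel set, and \<open>f\<close> has the same
  density as 0.\<close>

lemma AE_zero_if_integral_box_zero: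
  fixes f :: "'e::euclidean_space \<Rightarrow> real"
  assumes f: "integrable lborel f"
    and box: "\<And>a b. (LINT x|lborel. indicator (box a b) x * f x) = 0"
  shows "AE x in lborel. f x = 0"
proof -
  have f_set: "set_integrable lborel A f" if "A \<in> sets borel" for A
    unfolding set_integrable_def by (rule integrable_mult_indicator) (use that f in auto)
  \<comment> \<open>Needed for complements in the induction; the whole space is exhausted by growing
    boxes.\<close>
  have UNIV_zero: "(LINT x|lborel. f x) = 0"
  proof -
    have "(\<lambda>n. LINT x|lborel. indicator (box (- real n *\<^sub>R One) (real n *\<^sub>R One)) x * f x) \<longlonglongrightarrow> (LINT x|lborel. f x)"
    proof (rule integral_dominated_convergence[where w = "\<lambda>x. norm (f x)"])
      show "AE x in lborel. (\<lambda>n. indicator (box (- real n *\<^sub>R One) (real n *\<^sub>R One)) x * f x) \<longlonglongrightarrow> f x"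
      proof (rule AE_I2)
        fix x :: 'e
        obtain m :: nat where m: "norm x < real m"
          using reals_Archimedean2 by blast
        have "x \<in> box (- real n *\<^sub>R One) (real n *\<^sub>R One)" if "n \<ge> m" for n
        proof -
          have "\<bar>x \<bullet> i\<bar> < real n" if "i \<in> Basis" for i
            using Basis_le_norm[OF that, of x] m \<open>n \<ge> m\<close> by linarith
          then show ?thesis by (auto simp: mem_box abs_less_iff minus_less_iff)
        qed
        then have "\<forall>\<^sub>F n in sequentially. indicator (box (- real n *\<^sub>R One) (real n *\<^sub>R One)) x * f x = f x"
          unfolding eventually_sequentially by (intro exI[of _ m]) auto
        then show "(\<lambda>n. indicator (box (- real n *\<^sub>R One) (real n *\<^sub>R One)) x * f x) \<longlonglongrightarrow> f x"
          by (rule tendsto_eventually)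
      qed
    qed (use f in \<open>auto simp: indicator_def\<close>)
    then show ?thesis
      using box by (simp add: LIMSEQ_const_iff)
  qed
  have "(LINT x:A|lborel. f x) = 0" if "A \<in> sets borel" for A
  proof -
    let ?G = "range (\<lambda>(a, b). box a b :: 'e set)"
    have "Int_stable ?G"
      by (auto simp: Int_stable_def box_Int_box)
    moreover have "?G \<subseteq> Pow UNIV" by simp
    moreover have "A \<in> sigma_sets UNIV ?G"
      using that by (subst (asm) borel_eq_box) (simp add: sets_measure_of)
    ultimately show ?thesis
    proof (induction A rule: sigma_sets_induct_disjoint)
      case (basic A)
      then show ?case using box by (auto simp: set_lebesgue_integral_def)
    next
      case (compl A)
      then have A: "A \<in> sets borel"
        by (subst borel_eq_box) (simp add: sets_measure_of)
      have "(LINT x:UNIV - A|lborel. f x) = (LINT x|lborel. f x) - (LINT x:A|lborel. f x)"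
      proof -
        have "(LINT x:UNIV - A|lborel. f x) = (LINT x|lborel. f x - indicator A x *\<^sub>R f x)"
          unfolding set_lebesgue_integral_def
          by (rule Bochner_Integration.integral_cong) (auto simp: indicator_def)
        also have "\<dots> = (LINT x|lborel. f x) - (LINT x:A|lborel. f x)"
          unfolding set_lebesgue_integral_def
          by (rule Bochner_Integration.integral_diff[OF f f_set[OF A, unfolded set_integrable_def]])
        finally show ?thesis .
      qed
      with compl show ?case by (simp add: UNIV_zero)
    next
      case (union A)
      then have A: "A i \<in> sets borel" for i
        by (subst borel_eq_box) (auto simp: sets_measure_of)
      have "(LINT x:(\<Union>i. A i)|lborel. f x) = (\<Sum>i. LINT x:A i|lborel. f x)"
        by (rule lebesgue_integral_countable_add)
          (use A union f_set[of "\<Union>i. A i"] in \<open>auto simp: disjoint_family_on_def\<close>)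
      with union show ?case by simp
    qed (auto simp: set_lebesgue_integral_def)
  qed
  then show ?thesis
    using density_unique_real[OF f, of "\<lambda>_. 0"] by (simp add: set_lebesgue_integral_def)
qed

lemma fst_borel_measurable [measurable]:
  "(\<lambda>x :: 'e::euclidean_space \<times> 'f::euclidean_space. fst x) \<in> borel_measurable borel"
  by (intro borel_measurable_continuous_onI continuous_intros)

lemma snd_borel_measurable [measurable]:
  "(\<lambda>x :: 'e::euclidean_space \<times> 'f::euclidean_space. snd x) \<in> borel_measurable borel"
  by (intro borel_measurable_continuous_onI continuous_intros)

lemma box_approx_measurable [measurable]: "box_approx a b n \<in> borel_measurable borel"
  by (rule C1_measurable[OF C1_box_approx])

lemma AE_zero_if_box_approx:
  fixes f :: "'e::euclidean_space \<Rightarrow> real"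
  assumes f: "integrable lborel f"
    and *: "\<And>a b n. (LINT x|lborel. box_approx a b n x * f x) = 0"
  shows "AE x in lborel. f x = 0"
proof (rule AE_zero_if_integral_box_zero[OF f])
  fix a b :: 'e
  have "(\<lambda>n. LINT x|lborel. box_approx a b n x * f x) \<longlonglongrightarrow> (LINT x|lborel. indicator (box a b) x * f x)"
    by (rule integral_dominated_convergence[where w = "\<lambda>x. norm (f x)"])
      (use f in \<open>auto intro!: AE_I2 tendsto_intros box_approx_tendsto mult_left_le_one_le
        simp: abs_mult box_approx_bounds abs_of_nonneg\<close>)
  then show "(LINT x|lborel. indicator (box a b) x * f x) = 0"
    by (simp add: * LIMSEQ_const_iff)
qed

text \<open>A box in the product is a product of boxes, so test functions that separate x' and x_N
  already determine \<open>f\<close>. Only such functions allow an explicit antiderivative in the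
  normal variable.\<close>

lemma AE_zero_if_product_box_approx:
  fixes f :: "'e::euclidean_space \<times> 'f::euclidean_space \<Rightarrow> real"
  assumes f: "integrable lborel f"
    and *: "\<And>a b p q n. (LINT x|lborel. box_approx a b n (fst x) * box_approx p q n (snd x) * f x) = 0"
  shows "AE x in lborel. f x = 0"
proof (rule AE_zero_if_integral_box_zero[OF f])
  fix a b :: "'e \<times> 'f"
  have [measurable]: "f \<in> borel_measurable borel"
    using borel_measurable_integrable[OF f] by simp
  have "(\<lambda>n. LINT x|lborel. box_approx (fst a) (fst b) n (fst x) * box_approx (snd a) (snd b) n (snd x) * f x)
      \<longlonglongrightarrow> (LINT x|lborel. indicator (box a b) x * f x)"
  proof (rule integral_dominated_convergence[where w = "\<lambda>x. norm (f x)"])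
    show "AE x in lborel. (\<lambda>n. box_approx (fst a) (fst b) n (fst x) * box_approx (snd a) (snd b) n (snd x) * f x)
        \<longlonglongrightarrow> indicator (box a b) x * f x"
    proof (rule AE_I2)
      fix x :: "'e \<times> 'f"
      have "indicator (box a b) x = (indicator (box (fst a) (fst b)) (fst x) * indicator (box (snd a) (snd b)) (snd x) :: real)"
        by (auto simp: box_prod indicator_def mem_Times_iff)
      then show "(\<lambda>n. box_approx (fst a) (fst b) n (fst x) * box_approx (snd a) (snd b) n (snd x) * f x)
        \<longlonglongrightarrow> indicator (box a b) x * f x"
        by (simp only:) (intro tendsto_intros box_approx_tendsto)
    qed
    show "AE x in lborel. norm (box_approx (fst a) (fst b) n (fst x) * box_approx (snd a) (snd b) n (snd x) * f x) \<le> norm (f x)" for n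
      by (intro AE_I2) (auto simp: abs_mult box_approx_bounds abs_of_nonneg intro!: mult_left_le_one_le mult_le_one)
    show "(\<lambda>x. box_approx (fst a) (fst b) n (fst x) * box_approx (snd a) (snd b) n (snd x) * f x) \<in> borel_measurable lborel" for n
      by measurable
  qed (use f in auto)
  then show "(LINT x|lborel. indicator (box a b) x * f x) = 0"
    by (simp add: * LIMSEQ_const_iff)
qed

text \<open>Lindelof's theorem reduces the uncountable union of exceptional null sets to a countable
  one. Demanding that the closed box lies in \<Omega> makes the bump on the box an admissible test
  function.\<close>

lemma AE_open_if_AE_boxes:
  fixes \<Omega> :: "'e::euclidean_space set"
  assumes "open \<Omega>" and box: "\<And>a b. cbox a b \<subseteq> \<Omega> \<Longrightarrow> AE x in lborel. x \<in> box a b \<longrightarrow> P x"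
  shows "AE x in lborel. x \<in> \<Omega> \<longrightarrow> P x"
proof -
  let ?F = "{box a b | a b. cbox a b \<subseteq> \<Omega>}"
  obtain F where F: "F \<subseteq> ?F" "countable F" "\<Union>F = \<Union>?F"
    by (rule Lindelof[of ?F]) (auto simp: open_box)
  have "\<Omega> \<subseteq> \<Union>?F"
  proof
    fix x assume "x \<in> \<Omega>"
    then obtain e where e: "e > 0" "cball x e \<subseteq> \<Omega>"
      using \<open>open \<Omega>\<close> open_contains_cball by blast
    obtain a b where ab: "x \<in> box a b" "box a b \<subseteq> ball x e"
      using rational_boxes[OF e(1)] by blast
    have "box a b \<noteq> {}" using ab(1) by auto
    then have "cbox a b \<subseteq> cball x e"
      using closure_mono[OF ab(2)] e(1) by (simp add: closure_box)
    then show "x \<in> \<Union>?F" using ab(1) e(2) by blast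
  qed
  moreover have "AE x in lborel. \<forall>B\<in>F. x \<in> B \<longrightarrow> P x"
    using F(1,2) box by (subst AE_ball_countable) auto
  ultimately show ?thesis
    using F(3) by (auto elim!: eventually_mono)
qed

text \<open>Multiplying by a fixed bump localizes: \<open>bump a b\<close> times \<open>f\<close> is
  integrable on the whole space, and any \<open>C1\<close> factor times the bump is still a test
  function on \<Omega>. The product therefore vanishes almost everywhere, and the bump is positive
  on its box.\<close>

lemma fundamental_lemma:
  fixes f :: "'e::euclidean_space \<Rightarrow> real"
  assumes "open \<Omega>" and f: "set_integrable lborel \<Omega> f"
    and test: "\<And>\<psi>. \<psi> \<in> C1c \<Omega> \<Longrightarrow> (LINT x:\<Omega>|lborel. f x * \<psi> x) = 0"
  shows "AE x in lborel. x \<in> \<Omega> \<longrightarrow> f x = 0"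
proof (rule AE_open_if_AE_boxes[OF \<open>open \<Omega>\<close>])
  fix a b :: 'e assume ab: "cbox a b \<subseteq> \<Omega>"
  let ?g = "\<lambda>x. bump a b x * (indicator \<Omega> x * f x)"
  obtain B where B: "\<And>x. \<bar>bump a b x\<bar> \<le> B"
    using C1c_bounded[OF bump_C1c[OF ab]] by auto
  have [measurable]: "bump a b \<in> borel_measurable borel"
    by (rule C1_measurable[OF C1_bump])
  have "integrable lborel ?g"
  proof (rule Bochner_Integration.integrable_bound)
    show "integrable lborel (\<lambda>x. B * (indicator \<Omega> x * f x))"
      using f by (simp add: set_integrable_def)
    then show "AE x in lborel. norm (?g x) \<le> norm (B * (indicator \<Omega> x * f x))"
      using order_trans[OF B abs_ge_self] by (auto simp: abs_mult intro!: AE_I2 mult_right_mono)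
    show "?g \<in> borel_measurable lborel"
    proof (rule borel_measurable_times)
      show "(\<lambda>x. indicator \<Omega> x * f x) \<in> borel_measurable lborel"
        using borel_measurable_integrable[OF f[unfolded set_integrable_def]] by simp
    qed measurable
  qed
  then have "AE x in lborel. ?g x = 0"
  proof (rule AE_zero_if_box_approx)
    fix p q :: 'e and n
    have "(\<lambda>x. box_approx p q n x * bump a b x) \<in> C1c \<Omega>"
      by (intro C1c_mult_right C1_box_approx bump_C1c ab)
    from test[OF this] show "(LINT x|lborel. box_approx p q n x * ?g x) = 0"
      by (simp add: set_lebesgue_integral_def mult_ac)
  qed
  then show "AE x in lborel. x \<in> box a b \<longrightarrow> f x = 0"
  proof eventually_elim
    case (elim x)
    then show ?case
      using ab bump_pos_iff[of a b x] box_subset_cbox[of a b] by (auto simp: indicator_def split: if_splits)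
  qed
qed

lemma fundamental_lemma_vector:
  fixes F :: "'e::euclidean_space \<Rightarrow> 'f::euclidean_space"
  assumes "open \<Omega>" and F: "set_integrable lborel \<Omega> F"
    and test: "\<And>X. X \<in> C1c \<Omega> \<Longrightarrow> (LINT x:\<Omega>|lborel. F x \<bullet> X x) = 0"
  shows "AE x in lborel. x \<in> \<Omega> \<longrightarrow> F x = 0"
proof -
  have "AE x in lborel. x \<in> \<Omega> \<longrightarrow> F x \<bullet> b = 0" for b
  proof (rule fundamental_lemma[OF \<open>open \<Omega>\<close>])
    show "set_integrable lborel \<Omega> (\<lambda>x. F x \<bullet> b)"
      using integrable_inner_left[of b lborel "\<lambda>x. indicator \<Omega> x *\<^sub>R F x"] F
      by (simp add: set_integrable_def)
    fix \<psi> :: "'e \<Rightarrow> real" assume "\<psi> \<in> C1c \<Omega>"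
    then have "(\<lambda>x. \<psi> x *\<^sub>R b) \<in> C1c \<Omega>"
      by (rule C1c_scaleR_left) (rule C1_const)
    from test[OF this] show "(LINT x:\<Omega>|lborel. (F x \<bullet> b) * \<psi> x) = 0"
      by (simp add: mult.commute)
  qed
  then have "AE x in lborel. \<forall>b\<in>Basis. x \<in> \<Omega> \<longrightarrow> F x \<bullet> b = 0"
    by (subst AE_ball_countable) (auto intro: countable_finite)
  then show ?thesis
    by eventually_elim (auto intro: euclidean_eqI)
qed

section \<open>The divergence theorem on the half space\<close>

text \<open>Translation invariance makes the integral of every difference quotient in direction \<open>b\<close> vanish.\<close>

lemma integral_directional_derivative_zero:
  fixes X :: "'e::euclidean_space \<Rightarrow> real"
  assumes X: "X \<in> C1c UNIV" and A: "A \<in> sets borel"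
    and inv: "\<And>x t. x + t *\<^sub>R b \<in> A \<longleftrightarrow> x \<in> A"
  shows "(LINT x|lborel. indicator A x * frechet_derivative X (at x) b) = 0"
proof -
  let ?X' = "\<lambda>x. frechet_derivative X (at x) b"
  note X1 = C1c_C1[OF X]
  obtain K where K: "compact K" "\<And>y. y \<notin> K \<Longrightarrow> X y = 0" "\<And>y. y \<notin> K \<Longrightarrow> ?X' y = 0"
    by (rule C1cE[OF X]) (auto simp: fun_eq_iff)
  obtain B where B: "\<And>y. \<bar>?X' y\<bar> \<le> B"
    using bounded_compact_support[OF C1_continuous_derivative[OF X1] K(1) K(3)] by auto
  \<comment> \<open>All steps 1 / (n + 1) are at most 1, so every difference quotient is supported
    in this compact set, the support swept backwards along \<open>b\<close>. It carries the
    dominating function.\<close>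
  let ?L = "(\<lambda>p. fst p - snd p *\<^sub>R b) ` (K \<times> {0..1::real})"
  have L: "compact ?L"
    by (intro compact_continuous_image compact_Times K continuous_intros) auto
  define D where "D n x = real (Suc n) * (X (x + (1 / real (Suc n)) *\<^sub>R b) - X x)" for n :: nat and x
  have line: "((\<lambda>t. X (x + t *\<^sub>R b)) has_real_derivative ?X' (x + t *\<^sub>R b)) (at t)" for x t
  proof -
    have "((\<lambda>t. x + t *\<^sub>R b) has_derivative (\<lambda>h. h *\<^sub>R b)) (at t)"
      by (auto intro!: derivative_eq_intros)
    from diff_chain_at[OF this C1_has_derivative[OF X1]]
    have "((\<lambda>t. X (x + t *\<^sub>R b)) has_derivative (\<lambda>h. frechet_derivative X (at (x + t *\<^sub>R b)) (h *\<^sub>R b))) (at t)"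
      by (simp add: o_def)
    moreover have "frechet_derivative X (at y) (h *\<^sub>R b) = ?X' y * h" for y h
      using linear_scale[OF has_derivative_linear[OF C1_has_derivative[OF X1]]] by simp
    ultimately show ?thesis by (simp add: has_field_derivative_def)
  qed
  have D_zero: "(LINT x|lborel. indicator A x * D n x) = 0" for n
  proof -
    let ?h = "(1 / real (Suc n)) *\<^sub>R b"
    have int: "integrable lborel (\<lambda>x. indicator A x * X x)"
      using integrable_mult_indicator[of A lborel X] A
        integrable_compact_support[OF C1_continuous[OF X1] K(1,2)] by simp
    have meas: "(\<lambda>x. indicator A x * X x) \<in> borel_measurable borel"
      using borel_measurable_integrable[OF int] by simp
    have "integrable (distr lborel borel ((+) ?h)) (\<lambda>x. indicator A x * X x)"
      using int by (simp add: lborel_distr_plus)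
    then have int2: "integrable lborel (\<lambda>x. indicator A x * X (x + ?h))"
      by (subst (asm) integrable_distr_eq) (use meas inv[of _ "1 / real (Suc n)"] in \<open>auto simp: add.commute indicator_def\<close>)
    have "(LINT x|lborel. indicator A x * X x) = (LINT x|distr lborel borel ((+) ?h). indicator A x * X x)"
      by (simp add: lborel_distr_plus)
    also have "\<dots> = (LINT x|lborel. indicator A x * X (x + ?h))"
      by (subst integral_distr) (use meas inv[of _ "1 / real (Suc n)"] in \<open>auto simp: add.commute indicator_def\<close>)
    finally have eq: "(LINT x|lborel. indicator A x * X (x + ?h)) - (LINT x|lborel. indicator A x * X x) = 0"
      by simp
    have "(LINT x|lborel. indicator A x * D n x) =
        (LINT x|lborel. real (Suc n) * (indicator A x * X (x + ?h) - indicator A x * X x))"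
      by (simp add: D_def algebra_simps)
    also have "\<dots> = 0"
      using int int2 eq by (subst integral_mult_right_zero) (simp add: Bochner_Integration.integral_diff)
    finally show ?thesis .
  qed
  have "(\<lambda>n. LINT x|lborel. indicator A x * D n x) \<longlonglongrightarrow> (LINT x|lborel. indicator A x * ?X' x)"
  proof (rule integral_dominated_convergence[where w = "\<lambda>x. B * indicator ?L x"])
    have [measurable]: "X \<in> borel_measurable borel" by (rule C1_measurable[OF X1])
    have [measurable]: "?X' \<in> borel_measurable borel"
      by (rule borel_measurable_continuous_onI[OF C1_continuous_derivative[OF X1]])
    have [measurable]: "A \<in> sets borel" by fact
    show "(\<lambda>x. indicator A x * ?X' x) \<in> borel_measurable lborel" by measurable
    show "(\<lambda>x. indicator A x * D n x) \<in> borel_measurable lborel" for n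
      unfolding D_def by measurable
    show "integrable lborel (\<lambda>x. B * indicator ?L x)"
      using L emeasure_bounded_finite[OF compact_imp_bounded[OF L]]
      by (intro integrable_mult_right integrable_real_indicator) (auto simp: compact_imp_closed borel_closed)
    show "AE x in lborel. (\<lambda>n. indicator A x * D n x) \<longlonglongrightarrow> indicator A x * ?X' x"
    proof (intro AE_I2 tendsto_intros)
      fix x
      have 1: "((\<lambda>h. (X (x + h *\<^sub>R b) - X x) / h) \<longlongrightarrow> ?X' x) (at 0)"
        using line[of x 0] by (simp add: DERIV_def)
      have 2: "filterlim (\<lambda>n. inverse (real (Suc n))) (at 0) sequentially"
        by (rule filterlim_atI[OF LIMSEQ_inverse_real_of_nat]) auto
      show "(\<lambda>n. D n x) \<longlonglongrightarrow> ?X' x"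
        using filterlim_compose[OF 1 2] by (simp add: D_def field_simps)
    qed
    show "AE x in lborel. norm (indicator A x * D n x) \<le> B * indicator ?L x" for n
    proof (rule AE_I2)
      fix x
      \<comment> \<open>By the mean value theorem the difference quotient is a value of the
        directional derivative, hence bounded by \<open>B\<close> uniformly in
        \<open>n\<close>.\<close>
      obtain t where t: "0 < t" "t < 1 / real (Suc n)"
        "X (x + (1 / real (Suc n)) *\<^sub>R b) - X x = 1 / real (Suc n) * ?X' (x + t *\<^sub>R b)"
        using MVT2[of 0 "1 / real (Suc n)" "\<lambda>t. X (x + t *\<^sub>R b)" "\<lambda>t. ?X' (x + t *\<^sub>R b)"] line by auto
      then have D: "D n x = ?X' (x + t *\<^sub>R b)" by (simp add: D_def)
      show "norm (indicator A x * D n x) \<le> B * indicator ?L x"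
      proof (cases "x \<in> ?L")
        case True
        then show ?thesis using B[of "x + t *\<^sub>R b"] order_trans[OF abs_ge_zero B]
          by (simp add: D indicator_def)
      next
        case False
        have "t \<le> 1" using t(2) by (smt (verit) divide_le_eq_1_pos of_nat_0_less_iff of_nat_Suc zero_less_Suc of_nat_0_le_iff)
        then have "x + t *\<^sub>R b \<notin> K"
          using False t(1) by (force simp: image_iff)
        with False show ?thesis by (simp add: D K(3))
      qed
    qed
  qed
  then show ?thesis by (simp add: D_zero LIMSEQ_const_iff)
qed

interpretation lborel_pair: pair_sigma_finite
  "lborel :: 'a::euclidean_space measure" "lborel :: 'b::euclidean_space measure" ..

lemma fubini_lborel:
  fixes f :: "'a::euclidean_space \<times> 'b::euclidean_space \<Rightarrow> 'c::{banach, second_countable_topology}"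
  assumes "integrable lborel f"
  shows "(LINT x|lborel. f x) = (LINT x'|lborel. LINT t|lborel. f (x', t))"
  using lborel_pair.integral_fst'[of f] assms by (simp add: lborel_prod)

definition half_space :: "real \<Rightarrow> ('a::euclidean_space \<times> real) set" where
  "half_space s = {y. 0 < s * snd y}"

lemma half_space_borel [measurable]: "half_space s \<in> sets borel"
  unfolding half_space_def
  by (intro borel_open open_Collect_less continuous_intros)

lemma integral_half_line_derivative:
  fixes h h' :: "real \<Rightarrow> real"
  assumes s: "s \<in> {1, -1}" and h: "\<And>t. (h has_real_derivative h' t) (at t)" and h': "continuous_on UNIV h'"
    and M: "M > 0" "\<And>t. M \<le> \<bar>t\<bar> \<Longrightarrow> h t = 0 \<and> h' t = 0"
  shows "(LINT t|lborel. indicator {t. 0 < s * t} t * h' t) = - s * h 0"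
proof -
  have c: "isCont h' t" for t
    using h' by (simp add: continuous_on_eq_continuous_at)
  have hm: "h' \<in> borel_measurable borel"
    using h' by (rule borel_measurable_continuous_onI)
  consider "s = 1" | "s = -1" using s by auto
  then show ?thesis
  proof cases
    case 1
    have "(LINT t|lborel. indicator {t. 0 < s * t} t * h' t) = (LINT t|lborel. h' t * indicator {0..M} t)"
      by (rule integral_cong_AE)
        (use hm AE_lborel_singleton[of "0::real"] M 1 in \<open>auto simp: indicator_def not_le elim!: eventually_mono\<close>)
    then show ?thesis
      using integral_FTC_Icc_real[of 0 M h h'] h c M 1 by simp
  next
    case 2
    have "(LINT t|lborel. indicator {t. 0 < s * t} t * h' t) = (LINT t|lborel. h' t * indicator {-M..0} t)"
      by (rule integral_cong_AE)
        (use hm AE_lborel_singleton[of "0::real"] M 2 in \<open>auto simp: indicator_def not_le elim!: eventually_mono\<close>)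
    then show ?thesis
      using integral_FTC_Icc_real[of "-M" 0 h h'] h c M 2 by simp
  qed
qed

lemma integral_normal_derivative:
  fixes X :: "'a::euclidean_space \<times> real \<Rightarrow> real"
  assumes X: "X \<in> C1c UNIV" and s: "s \<in> {1, -1}"
  shows "(LINT x|lborel. indicator (half_space s) x * frechet_derivative X (at x) (0, 1)) = - s * (LINT x'|lborel. X (x', 0))"
proof -
  let ?X' = "\<lambda>x. frechet_derivative X (at x) (0, 1)"
  note X1 = C1c_C1[OF X]
  obtain K where K: "compact K" "\<And>y. y \<notin> K \<Longrightarrow> X y = 0" "\<And>y. y \<notin> K \<Longrightarrow> ?X' y = 0"
    by (rule C1cE[OF X]) (auto simp: fun_eq_iff)
  obtain M where M: "M > 0" "\<And>y. y \<in> K \<Longrightarrow> norm y < M"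
    using compact_imp_bounded[OF K(1)] by (auto simp: bounded_pos_less)
  have far: "X (x', t) = 0 \<and> ?X' (x', t) = 0" if "M \<le> \<bar>t\<bar>" for x' t
  proof -
    have "\<bar>t\<bar> \<le> norm (x', t)" using norm_snd_le[of t x'] by simp
    then have "(x', t) \<notin> K" using M(2)[of "(x', t)"] that by linarith
    then show ?thesis using K by blast
  qed
  have line: "((\<lambda>t. X (x', t)) has_real_derivative ?X' (x', t)) (at t)" for x' t
  proof -
    have "((\<lambda>t. (x', t)) has_derivative (\<lambda>h. (0, h))) (at t)"
      by (auto intro!: derivative_eq_intros)
    from diff_chain_at[OF this C1_has_derivative[OF X1]]
    have "((\<lambda>t. X (x', t)) has_derivative (\<lambda>h. frechet_derivative X (at (x', t)) (0, h))) (at t)"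
      by (simp add: o_def)
    moreover have "(\<lambda>h. frechet_derivative X (at (x', t)) (0, h)) = (*) (?X' (x', t))"
    proof
      fix h
      have "frechet_derivative X (at (x', t)) (h *\<^sub>R (0, 1)) = h *\<^sub>R ?X' (x', t)"
        by (rule linear_scale[OF has_derivative_linear[OF C1_has_derivative[OF X1]]])
      moreover have "h *\<^sub>R (0, 1) = (0 :: 'a, h)" by simp
      ultimately show "frechet_derivative X (at (x', t)) (0, h) = ?X' (x', t) * h"
        by (simp only: real_scaleR_def mult.commute)
    qed
    ultimately show ?thesis by (simp only: has_field_derivative_def)
  qed
  have "integrable lborel (\<lambda>x. indicator (half_space s) x * ?X' x)"
    using integrable_mult_indicator[of "half_space s" lborel ?X']
      integrable_compact_support[OF C1_continuous_derivative[OF X1] K(1,3)] by simp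
  then have "(LINT x|lborel. indicator (half_space s) x * ?X' x) =
      (LINT x'|lborel. LINT t|lborel. indicator (half_space s) (x', t) * ?X' (x', t))"
    by (rule fubini_lborel)
  also have "\<dots> = (LINT x'|lborel. - s * X (x', 0))"
  proof (rule Bochner_Integration.integral_cong[OF refl])
    fix x' :: 'a
    have "continuous_on UNIV (\<lambda>t. ?X' (x', t))"
      by (rule continuous_on_compose2[OF C1_continuous_derivative[OF X1]]) (auto intro!: continuous_intros)
    from integral_half_line_derivative[OF s line this M(1) far]
    show "(LINT t|lborel. indicator (half_space s) (x', t) * ?X' (x', t)) = - s * X (x', 0)"
      by (simp add: half_space_def indicator_def)
  qed
  finally show ?thesis by simp
qed

lemma C1c_inner:
  assumes "X \<in> C1c \<Omega>" shows "(\<lambda>y. X y \<bullet> b) \<in> C1c \<Omega>"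
proof -
  obtain K where "compact K" "K \<subseteq> \<Omega>" "\<And>y. y \<notin> K \<Longrightarrow> X y = 0"
    using C1c_support[OF assms] by auto
  then show ?thesis
    by (intro C1cI[where K = K] C1_compose_left[OF bounded_linear_inner_left] C1c_C1[OF assms]) simp_all
qed

lemma frechet_derivative_inner:
  assumes "C1 X"
  shows "frechet_derivative (\<lambda>y. X y \<bullet> b) (at y) h = frechet_derivative X (at y) h \<bullet> b"
  using frechet_derivative_at[OF bounded_linear.has_derivative[OF bounded_linear_inner_left C1_has_derivative[OF assms]]]
  by (metis (no_types))

lemma integrable_indicator_derivative:
  fixes X :: "'e::euclidean_space \<Rightarrow> 'f::euclidean_space"
  assumes X: "X \<in> C1c UNIV" and A: "A \<in> sets borel"
  shows "integrable lborel (\<lambda>x. indicator A x * (frechet_derivative X (at x) h \<bullet> b))"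
proof -
  obtain K where K: "compact K" "\<And>y. y \<notin> K \<Longrightarrow> frechet_derivative X (at y) h \<bullet> b = 0"
    by (rule C1cE[OF X]) auto
  have "integrable lborel (\<lambda>x. frechet_derivative X (at x) h \<bullet> b)"
    by (rule integrable_compact_support[OF _ K])
      (intro continuous_intros C1_continuous_derivative C1c_C1[OF X])
  from integrable_mult_indicator[OF _ this, of A] A show ?thesis by simp
qed

lemma divergence_theorem_whole_space:
  fixes X :: "'e::euclidean_space \<Rightarrow> 'e"
  assumes X: "X \<in> C1c UNIV"
  shows "(LINT x|lborel. divergence X x) = 0"
proof -
  have "(LINT x|lborel. divergence X x) = (\<Sum>b\<in>Basis. LINT x|lborel. frechet_derivative X (at x) b \<bullet> b)"
    unfolding divergence_def
    by (rule Bochner_Integration.integral_sum)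
      (use integrable_indicator_derivative[OF X, of UNIV] in simp)
  also have "\<dots> = 0"
    using integral_directional_derivative_zero[OF C1c_inner[OF X], of UNIV]
    by (simp add: frechet_derivative_inner[OF C1c_C1[OF X]])
  finally show ?thesis .
qed

text \<open>The half space is invariant under tangential translations, so the tangential components
  contribute nothing. Only the normal component leaves a boundary term, with outer normal - s
  e_N.\<close>

lemma divergence_theorem_half_space:
  fixes X :: "'a::euclidean_space \<times> real \<Rightarrow> 'a \<times> real"
  assumes X: "X \<in> C1c UNIV" and s: "s \<in> {1, -1}"
  shows "(LINT x|lborel. indicator (half_space s) x * divergence X x) = - s * (LINT x'|lborel. snd (X (x', 0)))"
proof -
  let ?D = "\<lambda>b. LINT x|lborel. indicator (half_space s) x * (frechet_derivative X (at x) b \<bullet> b)"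
  have "(LINT x|lborel. indicator (half_space s) x * divergence X x) = (\<Sum>b\<in>Basis. ?D b)"
    unfolding divergence_def sum_distrib_left
    by (rule Bochner_Integration.integral_sum) (rule integrable_indicator_derivative[OF X half_space_borel])
  also have "\<dots> = (\<Sum>i\<in>Basis. ?D (i, 0)) + ?D (0, 1)"
    unfolding Basis_prod_def
    by (subst sum.union_disjoint) (auto simp: sum.reindex inj_on_def)
  also have "(\<Sum>i\<in>Basis. ?D (i, 0)) = 0"
    using integral_directional_derivative_zero[OF C1c_inner[OF X] half_space_borel, of "(i, 0)" s "(i, 0)" for i]
    by (simp add: frechet_derivative_inner[OF C1c_C1[OF X]] half_space_def)
  also have "?D (0, 1) = - s * (LINT x'|lborel. snd (X (x', 0)))"
    using integral_normal_derivative[OF C1c_inner[OF X] s, of "(0, 1)",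
        unfolded frechet_derivative_inner[OF C1c_C1[OF X]]]
    by (simp add: inner_prod_def)
  finally show ?thesis by simp
qed

lemma integration_by_parts_whole_space:
  fixes X :: "'e::euclidean_space \<Rightarrow> 'e"
  assumes "C1 f" "X \<in> C1c UNIV"
  shows "(LINT x|lborel. f x * divergence X x + grad f x \<bullet> X x) = 0"
  using divergence_theorem_whole_space[OF C1c_scaleR_right[OF assms]]
  by (simp add: divergence_scaleR[OF assms(1) C1c_C1[OF assms(2)]])

lemma integration_by_parts_half_space:
  fixes X :: "'a::euclidean_space \<times> real \<Rightarrow> 'a \<times> real"
  assumes "C1 f" "X \<in> C1c UNIV" "s \<in> {1, -1}"
  shows "(LINT x|lborel. indicator (half_space s) x * (f x * divergence X x + grad f x \<bullet> X x)) =
    - s * (LINT x'|lborel. f (x', 0) * snd (X (x', 0)))"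
  using divergence_theorem_half_space[OF C1c_scaleR_right[OF assms(1,2)] assms(3)]
  by (simp add: divergence_scaleR[OF assms(1) C1c_C1[OF assms(2)]])

section \<open>Square integrable functions\<close>

text \<open>Membership in L2 of the whole measure space. Functions on a subset enter through their
  extension by zero (\<open>L2_on_iff\<close>), so the Hilbert space facts are proved once, without
  domains.\<close>

definition sq_integrable :: "'b measure \<Rightarrow> ('b \<Rightarrow> 'c::euclidean_space) \<Rightarrow> bool" where
  "sq_integrable M f \<longleftrightarrow> f \<in> borel_measurable M \<and> integrable M (\<lambda>x. (norm (f x))\<^sup>2)"

lemma sq_integrable_measurable [measurable_dest]: "sq_integrable M f \<Longrightarrow> f \<in> borel_measurable M"
  by (simp add: sq_integrable_def)

lemma sq_integrableD: "sq_integrable M f \<Longrightarrow> integrable M (\<lambda>x. (norm (f x))\<^sup>2)"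
  by (simp add: sq_integrable_def)

lemma indicator_scaleR_norm_square:
  "(norm (indicator A x *\<^sub>R y))\<^sup>2 = indicator A x *\<^sub>R (norm y)\<^sup>2"
  by (auto simp: indicator_def)

lemma L2_on_iff: "f \<in> L2_on M A \<longleftrightarrow> sq_integrable M (\<lambda>x. indicator A x *\<^sub>R f x)"
  unfolding L2_on_def sq_integrable_def set_borel_measurable_def set_integrable_def
    indicator_scaleR_norm_square by simp

lemma sq_integrable_bound:
  assumes "sq_integrable M g" "f \<in> borel_measurable M" "AE x in M. norm (f x) \<le> norm (g x)"
  shows "sq_integrable M f"
  unfolding sq_integrable_def
proof
  show "integrable M (\<lambda>x. (norm (f x))\<^sup>2)"
    by (rule Bochner_Integration.integrable_bound[OF sq_integrableD[OF assms(1)]])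
      (use assms(2,3) in \<open>auto elim!: eventually_mono simp: power_mono\<close>)
qed fact

lemma sq_integrable_scaleR: "sq_integrable M f \<Longrightarrow> sq_integrable M (\<lambda>x. t *\<^sub>R f x)"
  by (auto simp: sq_integrable_def power_mult_distrib)

lemma norm_add_square_le:
  fixes a b :: "'c::real_inner"
  shows "(norm (a + b))\<^sup>2 \<le> 2 * (norm a)\<^sup>2 + 2 * (norm b)\<^sup>2"
proof -
  have "0 \<le> (norm (a - b))\<^sup>2" by simp
  then show ?thesis
    by (simp add: power2_norm_eq_inner inner_add_left inner_add_right inner_diff_left inner_diff_right inner_commute)
qed

lemma sq_integrable_add:
  assumes "sq_integrable M f" "sq_integrable M g"
  shows "sq_integrable M (\<lambda>x. f x + g x)"
  unfolding sq_integrable_def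
proof
  show m: "(\<lambda>x. f x + g x) \<in> borel_measurable M"
    using assms by measurable
  show "integrable M (\<lambda>x. (norm (f x + g x))\<^sup>2)"
  proof (rule Bochner_Integration.integrable_bound)
    show "integrable M (\<lambda>x. 2 * (norm (f x))\<^sup>2 + 2 * (norm (g x))\<^sup>2)"
      using assms by (auto simp: sq_integrable_def)
    show "AE x in M. norm ((norm (f x + g x))\<^sup>2) \<le> norm (2 * (norm (f x))\<^sup>2 + 2 * (norm (g x))\<^sup>2)"
      by (intro AE_I2) (use norm_add_square_le in auto)
  qed (use m in measurable)
qed

lemma sq_integrable_diff:
  assumes "sq_integrable M f" "sq_integrable M g"
  shows "sq_integrable M (\<lambda>x. f x - g x)"
  using sq_integrable_add[OF assms(1) sq_integrable_scaleR[OF assms(2), of "-1"]] by simp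

lemma sq_integrable_inner:
  assumes "sq_integrable M f" "sq_integrable M g"
  shows "integrable M (\<lambda>x. f x \<bullet> g x)"
proof (rule Bochner_Integration.integrable_bound)
  show "integrable M (\<lambda>x. (norm (f x))\<^sup>2 + (norm (g x))\<^sup>2)"
    using assms by (auto simp: sq_integrable_def)
  show "AE x in M. norm (f x \<bullet> g x) \<le> norm ((norm (f x))\<^sup>2 + (norm (g x))\<^sup>2)"
  proof (rule AE_I2)
    fix x
    have "\<bar>f x \<bullet> g x\<bar> \<le> norm (f x) * norm (g x)" by (rule Cauchy_Schwarz_ineq2)
    also have "\<dots> \<le> (norm (f x))\<^sup>2 + (norm (g x))\<^sup>2"
    proof -
      have "0 \<le> norm (f x) * norm (g x)" by simp
      then show ?thesis using sum_squares_bound[of "norm (f x)" "norm (g x)"] by linarith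
    qed
    finally show "norm (f x \<bullet> g x) \<le> norm ((norm (f x))\<^sup>2 + (norm (g x))\<^sup>2)" by simp
  qed
  show "(\<lambda>x. f x \<bullet> g x) \<in> borel_measurable M" using assms by measurable
qed

lemma integral_norm_add_square:
  assumes "sq_integrable M f" "sq_integrable M g"
  shows "(LINT x|M. (norm (f x + t *\<^sub>R g x))\<^sup>2) =
    (LINT x|M. (norm (f x))\<^sup>2) + 2 * t * (LINT x|M. f x \<bullet> g x) + t\<^sup>2 * (LINT x|M. (norm (g x))\<^sup>2)"
proof -
  have "(norm (f x + t *\<^sub>R g x))\<^sup>2 = (norm (f x))\<^sup>2 + 2 * t * (f x \<bullet> g x) + t\<^sup>2 * (norm (g x))\<^sup>2" for x
    unfolding power2_norm_eq_inner
    by (simp add: inner_add_left inner_add_right inner_commute power2_eq_square algebra_simps)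
  then show ?thesis
    using sq_integrableD[OF assms(1)] sq_integrableD[OF assms(2)] sq_integrable_inner[OF assms]
    by (simp add: Bochner_Integration.integral_add)
qed

lemma Cauchy_Schwarz_sq_integrable:
  assumes "sq_integrable M f" "sq_integrable M g"
  shows "(LINT x|M. f x \<bullet> g x)\<^sup>2 \<le> (LINT x|M. (norm (f x))\<^sup>2) * (LINT x|M. (norm (g x))\<^sup>2)"
proof -
  let ?a = "LINT x|M. (norm (f x))\<^sup>2" and ?b = "LINT x|M. f x \<bullet> g x" and ?c = "LINT x|M. (norm (g x))\<^sup>2"
  have q: "0 \<le> ?a + 2 * t * ?b + t\<^sup>2 * ?c" for t
    using integral_norm_add_square[OF assms, of t, symmetric] by simp
  have a: "0 \<le> ?a" and c: "0 \<le> ?c" by auto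
  show ?thesis
  proof (cases "?c = 0")
    case True
    have "?b = 0"
    proof (rule ccontr)
      assume "?b \<noteq> 0"
      \<comment> \<open>With this value of t the affine function ?a + 2 t ?b equals -1,
        contradicting nonnegativity.\<close>
      then show False using q[of "- (?a + 1) / (2 * ?b)"] True by (simp add: field_simps)
    qed
    then show ?thesis using True by simp
  next
    case False
    then have "0 \<le> (?a + 2 * (- ?b / ?c) * ?b + (- ?b / ?c)\<^sup>2 * ?c) * ?c"
      using q[of "- ?b / ?c"] c by (intro mult_nonneg_nonneg) auto
    then show ?thesis using False by (simp add: field_simps power2_eq_square)
  qed
qed

lemma tendsto_integral_inner:
  assumes F: "\<And>n. sq_integrable M (F n)" and G: "sq_integrable M G" and H: "sq_integrable M H"
    and lim: "(\<lambda>n. LINT x|M. (norm (F n x - G x))\<^sup>2) \<longlonglongrightarrow> 0"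
  shows "(\<lambda>n. LINT x|M. F n x \<bullet> H x) \<longlonglongrightarrow> (LINT x|M. G x \<bullet> H x)"
proof -
  have d: "sq_integrable M (\<lambda>x. F n x - G x)" for n
    by (intro sq_integrable_diff F G)
  have "(\<lambda>n. LINT x|M. (F n x - G x) \<bullet> H x) \<longlonglongrightarrow> 0"
  proof (rule Lim_null_comparison)
    show "\<forall>\<^sub>F n in sequentially. norm (LINT x|M. (F n x - G x) \<bullet> H x) \<le>
        sqrt ((LINT x|M. (norm (F n x - G x))\<^sup>2) * (LINT x|M. (norm (H x))\<^sup>2))"
      using Cauchy_Schwarz_sq_integrable[OF d H] by (auto intro!: always_eventually real_le_rsqrt)
    show "(\<lambda>n. sqrt ((LINT x|M. (norm (F n x - G x))\<^sup>2) * (LINT x|M. (norm (H x))\<^sup>2))) \<longlonglongrightarrow> 0"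
      using tendsto_real_sqrt[OF tendsto_mult_left_zero[OF lim]] by simp
  qed
  then have "(\<lambda>n. (LINT x|M. F n x \<bullet> H x) - (LINT x|M. G x \<bullet> H x)) \<longlonglongrightarrow> 0"
    using sq_integrable_inner[OF F H] sq_integrable_inner[OF G H]
    by (simp add: inner_diff_left)
  then show ?thesis by (simp add: LIM_zero_iff)
qed

lemma integral_le_if_nn_integral_le:
  fixes h :: "'b \<Rightarrow> real"
  assumes "h \<in> borel_measurable M" "\<And>x. 0 \<le> h x" "0 \<le> e" "(\<integral>\<^sup>+ x. ennreal (h x) \<partial>M) \<le> ennreal e"
  shows "integrable M h" "(LINT x|M. h x) \<le> e"
proof -
  show "integrable M h"
    using assms by (intro integrableI_bounded) (auto intro: le_less_trans)
  then show "(LINT x|M. h x) \<le> e"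
    using assms(2-4) by (subst (asm) nn_integral_eq_integral) auto
qed

text \<open>The weight 4^k on the squared increments bounds the increments themselves by a constant
  times 2^-k, so the telescoping series converges absolutely.\<close>

lemma convergent_if_geometric_differences:
  fixes a :: "nat \<Rightarrow> 'c::euclidean_space"
  assumes "\<And>k. 4 ^ k * (norm (a (Suc k) - a k))\<^sup>2 \<le> C"
  shows "convergent a"
proof -
  have C: "0 \<le> C" using order_trans[OF _ assms[of 0]] by simp
  have "norm (a (Suc k) - a k) \<le> sqrt C * (1/2) ^ k" for k
  proof -
    have "(2 ^ k * norm (a (Suc k) - a k))\<^sup>2 \<le> C"
    proof -
      have "(4::real) ^ k = (2 ^ k)\<^sup>2" by (simp add: power2_eq_square flip: power_mult_distrib)
      then show ?thesis using assms[of k] by (simp add: power_mult_distrib)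
    qed
    then have "2 ^ k * norm (a (Suc k) - a k) \<le> sqrt C"
      by (rule real_le_rsqrt)
    then show ?thesis by (simp add: field_simps power_one_over)
  qed
  then have "summable (\<lambda>k. a (Suc k) - a k)"
    by (rule summable_comparison_test'[OF summable_mult[OF summable_geometric], rotated]) simp
  then have "convergent (\<lambda>n. \<Sum>k<n. a (Suc k) - a k)"
    by (simp add: summable_iff_convergent)
  then have "convergent (\<lambda>n. a n - a 0)"
    by (simp add: sum_lessThan_telescope)
  then show ?thesis by (simp add: convergent_diff_const_right_iff)
qed

text \<open>The Riesz-Fischer argument: a rapidly convergent subsequence converges pointwise almost
  everywhere, and Fatou's lemma turns its pointwise limit into an L2 limit of the full
  sequence.\<close>

lemma L2_complete:
  fixes f :: "nat \<Rightarrow> 'b \<Rightarrow> 'c::euclidean_space"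
  assumes f: "\<And>n. sq_integrable M (f n)"
    and cauchy: "\<And>e. e > 0 \<Longrightarrow> \<exists>N. \<forall>m\<ge>N. \<forall>n\<ge>N. (LINT x|M. (norm (f m x - f n x))\<^sup>2) < e"
  obtains g where "sq_integrable M g" "(\<lambda>n. LINT x|M. (norm (f n x - g x))\<^sup>2) \<longlonglongrightarrow> 0"
proof -
  note [measurable] = sq_integrable_measurable[OF f]
  \<comment> \<open>Squared distances below 16^-k remain summable, as 4^-k, after multiplication by
    the weight 4^k.\<close>
  have "\<forall>k. \<exists>N. \<forall>m\<ge>N. \<forall>n\<ge>N. (LINT x|M. (norm (f m x - f n x))\<^sup>2) < (1/16) ^ k"
    using cauchy by simp
  then obtain N0 where N0: "\<And>k m n. m \<ge> N0 k \<Longrightarrow> n \<ge> N0 k \<Longrightarrow> (LINT x|M. (norm (f m x - f n x))\<^sup>2) < (1/16) ^ k"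
    by metis
  \<comment> \<open>The partial sum makes both N k and N (k + 1) at least N0 k, so consecutive
    members are 16^-k close; the added k sends the indices to infinity.\<close>
  define N where "N k = (\<Sum>i\<le>k. N0 i) + k" for k
  have N_ge: "N k \<ge> N0 k" "N k \<ge> k" "N (Suc k) \<ge> N0 k" for k
  proof -
    have "N0 k \<le> (\<Sum>i\<le>k. N0 i)" by (rule member_le_sum) auto
    then show "N k \<ge> N0 k" "N k \<ge> k" "N (Suc k) \<ge> N0 k" by (auto simp: N_def)
  qed
  have int: "integrable M (\<lambda>x. (norm (f m x - f n x))\<^sup>2)" for m n
    by (rule sq_integrableD[OF sq_integrable_diff[OF f f]])
  let ?d = "\<lambda>k x. 4 ^ k * (norm (f (N (Suc k)) x - f (N k) x))\<^sup>2"
  have "(\<integral>\<^sup>+ x. (\<Sum>k. ennreal (?d k x)) \<partial>M) = (\<Sum>k. \<integral>\<^sup>+ x. ennreal (?d k x) \<partial>M)"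
    by (rule nn_integral_suminf) measurable
  also have "\<dots> \<le> (\<Sum>k. ennreal ((1/4) ^ k))"
  proof (intro suminf_le)
    fix k
    have "(\<integral>\<^sup>+ x. ennreal (?d k x) \<partial>M) = ennreal (4 ^ k * (LINT x|M. (norm (f (N (Suc k)) x - f (N k) x))\<^sup>2))"
      using int by (subst nn_integral_eq_integral) auto
    also have "\<dots> \<le> ennreal (4 ^ k * (1/16) ^ k)"
      using N0[OF N_ge(3) N_ge(1)] by (intro ennreal_leI mult_left_mono) (auto intro: less_imp_le)
    also have "(4::real) ^ k * (1/16) ^ k = (1/4) ^ k"
      by (simp flip: power_mult_distrib)
    finally show "(\<integral>\<^sup>+ x. ennreal (?d k x) \<partial>M) \<le> ennreal ((1/4) ^ k)" .
  qed auto
  also have "\<dots> = ennreal (\<Sum>k. (1/4) ^ k)"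
    by (rule suminf_ennreal2) (auto intro: summable_geometric)
  finally have "(\<integral>\<^sup>+ x. (\<Sum>k. ennreal (?d k x)) \<partial>M) \<noteq> \<infinity>"
    by (auto simp: top_unique)
  then have "AE x in M. (\<Sum>k. ennreal (?d k x)) \<noteq> \<infinity>"
    by (intro nn_integral_PInf_AE) measurable
  then have conv: "AE x in M. convergent (\<lambda>k. f (N k) x)"
  proof eventually_elim
    case (elim x)
    show ?case
    proof (rule convergent_if_geometric_differences)
      fix k
      have "ennreal (?d k x) \<le> (\<Sum>k. ennreal (?d k x))"
      proof -
        have "D k \<le> (\<Sum>k. D k)" for D :: "nat \<Rightarrow> ennreal"
          using sum_le_suminf[OF summableI, of "{k}" D] by simp
        then show ?thesis .
      qed
      note d_le = this
      show "?d k x \<le> enn2real (\<Sum>k. ennreal (?d k x))"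
        using elim enn2real_mono[OF d_le] by (simp only: infinity_ennreal_def less_top enn2real_ennreal) simp
    qed
  qed
  define g where "g x = lim (\<lambda>k. f (N k) x)" for x
  have [measurable]: "g \<in> borel_measurable M"
    unfolding g_def[abs_def] by (rule borel_measurable_lim_metric) measurable
  have fatou: "(\<integral>\<^sup>+ x. ennreal ((norm (f n x - g x))\<^sup>2) \<partial>M) \<le> ennreal e"
    if e: "0 < e" and n: "\<And>m. m \<ge> n \<Longrightarrow> (LINT x|M. (norm (f n x - f m x))\<^sup>2) < e" for n e
  proof -
    have "(\<integral>\<^sup>+ x. ennreal ((norm (f n x - g x))\<^sup>2) \<partial>M) =
        (\<integral>\<^sup>+ x. liminf (\<lambda>k. ennreal ((norm (f n x - f (N k) x))\<^sup>2)) \<partial>M)"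
    proof (rule nn_integral_cong_AE)
      show "AE x in M. ennreal ((norm (f n x - g x))\<^sup>2) = liminf (\<lambda>k. ennreal ((norm (f n x - f (N k) x))\<^sup>2))"
        using conv
      proof eventually_elim
        case (elim x)
        then have "(\<lambda>k. f (N k) x) \<longlonglongrightarrow> g x"
          by (simp add: g_def convergent_LIMSEQ_iff)
        then have "(\<lambda>k. ennreal ((norm (f n x - f (N k) x))\<^sup>2)) \<longlonglongrightarrow> ennreal ((norm (f n x - g x))\<^sup>2)"
          by (intro tendsto_intros)
        then show ?case
          by (rule lim_imp_Liminf[symmetric, OF sequentially_bot])
      qed
    qed
    also have "\<dots> \<le> liminf (\<lambda>k. \<integral>\<^sup>+ x. ennreal ((norm (f n x - f (N k) x))\<^sup>2) \<partial>M)"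
      by (rule nn_integral_liminf) measurable
    also have "\<dots> \<le> ennreal e"
    proof (rule Liminf_le)
      show "\<forall>\<^sub>F k in sequentially. (\<integral>\<^sup>+ x. ennreal ((norm (f n x - f (N k) x))\<^sup>2) \<partial>M) \<le> ennreal e"
        unfolding eventually_sequentially
      proof (intro exI allI impI)
        fix k assume "n \<le> k"
        then have "n \<le> N k" using N_ge(2)[of k] by simp
        then show "(\<integral>\<^sup>+ x. ennreal ((norm (f n x - f (N k) x))\<^sup>2) \<partial>M) \<le> ennreal e"
          using n[of "N k"] by (subst nn_integral_eq_integral) (auto intro!: ennreal_leI int)
      qed
    qed simp
    finally show ?thesis .
  qed
  have *: "integrable M (\<lambda>x. (norm (f n x - g x))\<^sup>2) \<and> (LINT x|M. (norm (f n x - g x))\<^sup>2) \<le> e"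
    if e: "0 < e" and n: "\<And>m. m \<ge> n \<Longrightarrow> (LINT x|M. (norm (f n x - f m x))\<^sup>2) < e" for n e
    using integral_le_if_nn_integral_le[OF _ _ _ fatou[OF e n]] e by auto
  show ?thesis
  proof (rule that[of g])
    obtain n where "\<And>m. m \<ge> n \<Longrightarrow> (LINT x|M. (norm (f n x - f m x))\<^sup>2) < 1"
      using cauchy[of 1] by auto
    from *[OF _ this] have "sq_integrable M (\<lambda>x. f n x - g x)"
      by (simp add: sq_integrable_def)
    from sq_integrable_diff[OF f[of n] this] show "sq_integrable M g" by simp
    show "(\<lambda>n. LINT x|M. (norm (f n x - g x))\<^sup>2) \<longlonglongrightarrow> 0"
    proof (rule LIMSEQ_I)
      fix r :: real assume "0 < r"
      then obtain N where N: "\<And>m n. m \<ge> N \<Longrightarrow> n \<ge> N \<Longrightarrow> (LINT x|M. (norm (f m x - f n x))\<^sup>2) < r / 2"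
        using cauchy[of "r/2"] by auto
      have "(LINT x|M. (norm (f n x - g x))\<^sup>2) < r" if "n \<ge> N" for n
        using *[of "r/2" n] N that \<open>0 < r\<close> by fastforce
      then show "\<exists>no. \<forall>n\<ge>no. norm ((LINT x|M. (norm (f n x - g x))\<^sup>2) - 0) < r"
        by (intro exI[of _ N]) auto
    qed
  qed
qed

lemma linear_coefficient_zero:
  fixes c h :: real
  assumes quad: "\<And>t. 0 \<le> 2 * t * c + t\<^sup>2 * h" and h: "0 \<le> h"
  shows "c = 0"
proof -
  \<comment> \<open>The denominator h + 1 rather than h keeps the choice meaningful for h = 0;
    inserting t = - x gives - x^2 (h + 2) \<ge> 0.\<close>
  define x where "x = c / (h + 1)"
  have c: "c = x * (h + 1)" using h by (simp add: x_def)
  have "0 \<le> - (x\<^sup>2 * (h + 2))"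
    using quad[of "- x"] by (simp add: c power2_eq_square algebra_simps)
  then have "x\<^sup>2 * (h + 2) \<le> 0" by simp
  then have "x = 0" using h by (simp add: mult_le_0_iff)
  then show ?thesis by (simp add: c)
qed

text \<open>Orthogonal projection onto a closed subspace, for functions instead of classes.
  Closedness therefore asks only that some member of \<open>S\<close> be an L2 limit of the
  sequence, not that a prescribed representative lie in \<open>S\<close>.\<close>

lemma L2_projection:
  fixes B :: "'b \<Rightarrow> 'c::euclidean_space"
  assumes sq: "\<And>G. G \<in> S \<Longrightarrow> sq_integrable M G" and B: "sq_integrable M B"
    and ne: "S \<noteq> {}" and add: "\<And>G H t. G \<in> S \<Longrightarrow> H \<in> S \<Longrightarrow> (\<lambda>x. G x + H x) \<in> S"
    and scale: "\<And>G t. G \<in> S \<Longrightarrow> (\<lambda>x. t *\<^sub>R G x) \<in> S"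
    and closed: "\<And>F G. (\<And>n::nat. F n \<in> S) \<Longrightarrow> sq_integrable M G \<Longrightarrow>
      (\<lambda>n. LINT x|M. (norm (F n x - G x))\<^sup>2) \<longlonglongrightarrow> 0 \<Longrightarrow> \<exists>G'\<in>S. (\<lambda>n. LINT x|M. (norm (F n x - G' x))\<^sup>2) \<longlonglongrightarrow> 0"
  obtains G where "G \<in> S" "\<And>H. H \<in> S \<Longrightarrow> (LINT x|M. (G x - B x) \<bullet> H x) = 0"
proof -
  let ?E = "\<lambda>G. LINT x|M. (norm (B x - G x))\<^sup>2"
  define d where "d = Inf (?E ` S)"
  have bdd: "bdd_below (?E ` S)" by (rule bdd_belowI[of _ 0]) auto
  have d: "d \<le> ?E G" if "G \<in> S" for G
    unfolding d_def by (rule cInf_lower[OF _ bdd]) (use that in auto)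
  have "\<exists>G\<in>S. ?E G < d + 1 / real (Suc n)" for n
    using cInf_lessD[of "?E ` S" "d + 1 / real (Suc n)"] ne by (auto simp: d_def)
  then obtain F where F: "\<And>n. F n \<in> S" and FE: "\<And>n. ?E (F n) < d + 1 / real (Suc n)"
    by metis
  note sqF = sq[OF F]
  have diff: "(LINT x|M. (norm (F m x - F n x))\<^sup>2) \<le> 2 / real (Suc m) + 2 / real (Suc n)" for m n
  proof -
    \<comment> \<open>Parallelogram law: the midpoint lies in \<open>S\<close>, so its squared
      distance to \<open>B\<close> is at least \<open>d\<close>, and the multiples of
      \<open>d\<close> cancel.\<close>
    let ?H = "\<lambda>x. (1/2) *\<^sub>R (F m x + F n x)"
    have H: "?H \<in> S" by (intro scale add F)
    have "(norm (F m x - F n x))\<^sup>2 = 2 * (norm (B x - F m x))\<^sup>2 + 2 * (norm (B x - F n x))\<^sup>2 - 4 * (norm (B x - ?H x))\<^sup>2" for x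
      by (simp add: power2_norm_eq_inner inner_add_left inner_add_right inner_diff_left inner_diff_right inner_commute algebra_simps)
    then have "(LINT x|M. (norm (F m x - F n x))\<^sup>2) = 2 * ?E (F m) + 2 * ?E (F n) - 4 * ?E ?H"
      using sq_integrableD[OF sq_integrable_diff[OF B sqF]] sq_integrableD[OF sq_integrable_diff[OF B sq[OF H]]]
      by (simp add: Bochner_Integration.integral_diff Bochner_Integration.integral_add)
    then show ?thesis using d[OF H] FE[of m] FE[of n] by simp
  qed
  obtain G' where G': "sq_integrable M G'" "(\<lambda>n. LINT x|M. (norm (F n x - G' x))\<^sup>2) \<longlonglongrightarrow> 0"
  proof (rule L2_complete[OF sqF])
    fix e :: real assume "0 < e"
    then obtain N where N: "1 / real (Suc N) < e / 4"
      using reals_Archimedean[of "e/4"] by (auto simp: inverse_eq_divide)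
    have "(LINT x|M. (norm (F m x - F n x))\<^sup>2) < e" if "m \<ge> N" "n \<ge> N" for m n
    proof -
      have "1 / real (Suc m) \<le> 1 / real (Suc N)" "1 / real (Suc n) \<le> 1 / real (Suc N)"
        using that by (auto intro!: divide_left_mono)
      then show ?thesis using diff[of m n] N by simp
    qed
    then show "\<exists>N. \<forall>m\<ge>N. \<forall>n\<ge>N. (LINT x|M. (norm (F m x - F n x))\<^sup>2) < e" by blast
  qed blast
  obtain G where G: "G \<in> S" "(\<lambda>n. LINT x|M. (norm (F n x - G x))\<^sup>2) \<longlonglongrightarrow> 0"
    using closed[OF F G'] by blast
  show ?thesis
  proof (rule that[OF G(1)])
    fix H assume H: "H \<in> S"
    let ?c = "LINT x|M. (G x - B x) \<bullet> H x" and ?h = "LINT x|M. (norm (H x))\<^sup>2"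
    have lim: "(\<lambda>n. LINT x|M. (F n x - B x) \<bullet> H x) \<longlonglongrightarrow> ?c"
      by (rule tendsto_integral_inner) (use sqF G B H sq in \<open>auto intro: sq_integrable_diff\<close>)
    \<comment> \<open>The minimizing property is used along the sequence: F n + t H is no closer to
      \<open>B\<close> than \<open>d\<close> allows, while F n is within 1 / (n + 1) of
      \<open>d\<close>. The limit yields the quadratic inequality for G.\<close>
    have quad: "0 \<le> 2 * t * ?c + t\<^sup>2 * ?h" for t
    proof (rule LIMSEQ_le_const)
      show "(\<lambda>n. 1 / real (Suc n) + 2 * t * (LINT x|M. (F n x - B x) \<bullet> H x) + t\<^sup>2 * ?h)
          \<longlonglongrightarrow> 2 * t * ?c + t\<^sup>2 * ?h"
        using tendsto_add[OF tendsto_add[OF LIMSEQ_inverse_real_of_nat tendsto_mult[OF tendsto_const lim]] tendsto_const]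
        by (simp add: inverse_eq_divide)
      have "0 \<le> 1 / real (Suc n) + 2 * t * (LINT x|M. (F n x - B x) \<bullet> H x) + t\<^sup>2 * ?h" for n
      proof -
        have "d \<le> ?E (\<lambda>x. F n x + t *\<^sub>R H x)"
          by (intro d add scale F H)
        also have "\<dots> = (LINT x|M. (norm ((F n x - B x) + t *\<^sub>R H x))\<^sup>2)"
          by (rule Bochner_Integration.integral_cong) (auto simp: norm_minus_commute algebra_simps)
        also have "\<dots> = ?E (F n) + 2 * t * (LINT x|M. (F n x - B x) \<bullet> H x) + t\<^sup>2 * ?h"
          using integral_norm_add_square[OF sq_integrable_diff[OF sqF B] sq[OF H], of n t]
          by (simp add: norm_minus_commute)
        finally show ?thesis using FE[of n] by simp
      qed
      then show "\<exists>N. \<forall>n\<ge>N. 0 \<le> 1 / real (Suc n) + 2 * t * (LINT x|M. (F n x - B x) \<bullet> H x) + t\<^sup>2 * ?h"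
        by blast
    qed
    show "?c = 0"
      by (rule linear_coefficient_zero[OF quad]) simp
  qed
qed

section \<open>Uniqueness of weak gradients and divergences\<close>

lemma L2_on_set_integrable:
  fixes f :: "'e::euclidean_space \<Rightarrow> 'f::euclidean_space"
  assumes f: "f \<in> L2_on lborel \<Omega>" and \<Omega>: "bounded \<Omega>" "open \<Omega>"
  shows "set_integrable lborel \<Omega> f"
  unfolding set_integrable_def
proof (rule Bochner_Integration.integrable_bound)
  note sq = f[unfolded L2_on_iff]
  have "integrable lborel (\<lambda>x. indicator \<Omega> x :: real)"
    using \<Omega> emeasure_bounded_finite[OF \<Omega>(1)] by (intro integrable_real_indicator) auto
  with sq_integrableD[OF sq]
  show "integrable lborel (\<lambda>x. indicator \<Omega> x + (norm (indicator \<Omega> x *\<^sub>R f x))\<^sup>2 :: real)"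
    by auto
  have "y \<le> 1 + y\<^sup>2" for y :: real
    using sum_squares_bound[of y 1] by (cases "y \<ge> 0") (auto intro: order_trans[of y 0])
  then show "AE x in lborel. norm (indicator \<Omega> x *\<^sub>R f x) \<le>
      norm (indicator \<Omega> x + (norm (indicator \<Omega> x *\<^sub>R f x))\<^sup>2 :: real)"
    by (auto simp: indicator_def intro!: AE_I2)
qed (use f in \<open>simp add: L2_on_iff sq_integrable_def\<close>)

lemma continuous_bounded_L2_on:
  fixes f :: "'e::euclidean_space \<Rightarrow> 'f::euclidean_space"
  assumes f: "continuous_on UNIV f" and \<Omega>: "bounded \<Omega>" "open \<Omega>"
  shows "f \<in> L2_on lborel \<Omega>"
proof -
  have m: "(\<lambda>x. indicator \<Omega> x *\<^sub>R f x) \<in> borel_measurable lborel"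
    using borel_measurable_continuous_onI[OF f] borel_open[OF \<Omega>(2)] by measurable
  have "compact (closure \<Omega>)" using \<Omega> by (simp add: compact_closure)
  then have "bounded (f ` closure \<Omega>)"
    using f by (meson compact_continuous_image compact_imp_bounded continuous_on_subset subset_UNIV)
  then obtain B where B: "\<And>x. x \<in> closure \<Omega> \<Longrightarrow> norm (f x) \<le> B" by (auto simp: bounded_iff)
  show ?thesis
    unfolding L2_on_iff
  proof (rule sq_integrable_bound[OF _ m])
    show "sq_integrable lborel (\<lambda>x. indicator \<Omega> x * B :: real)"
      using \<Omega> emeasure_bounded_finite[OF \<Omega>(1)]
      by (auto simp: sq_integrable_def power_mult_distrib power2_eq_square[of "indicator _ _"]
          indicator_inter_arith[symmetric] intro!: integrable_real_indicator)
    show "AE x in lborel. norm (indicator \<Omega> x *\<^sub>R f x) \<le> norm (indicator \<Omega> x * B)"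
    proof (rule AE_I2)
      fix x show "norm (indicator \<Omega> x *\<^sub>R f x) \<le> norm (indicator \<Omega> x * B)"
        using B[of x] closure_subset[of \<Omega>] by (cases "x \<in> \<Omega>") auto
    qed
  qed
qed

lemma sq_integrable_compact_support:
  fixes f :: "'e::euclidean_space \<Rightarrow> 'f::euclidean_space"
  assumes f: "continuous_on UNIV f" and K: "compact K" "\<And>y. y \<notin> K \<Longrightarrow> f y = 0"
  shows "sq_integrable lborel f"
  unfolding sq_integrable_def
proof
  show "f \<in> borel_measurable lborel"
    using borel_measurable_continuous_onI[OF f] by simp
  show "integrable lborel (\<lambda>x. (norm (f x))\<^sup>2)"
    by (rule integrable_compact_support[OF _ K(1)]) (auto intro!: continuous_intros f simp: K(2))
qed

lemma C1c_sq_integrable: "X \<in> C1c \<Omega> \<Longrightarrow> sq_integrable lborel X"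
  by (frule C1c_C1, erule C1cE, rule sq_integrable_compact_support) (auto simp: C1_continuous)

lemma C1c_divergence_sq_integrable: "X \<in> C1c \<Omega> \<Longrightarrow> sq_integrable lborel (divergence X)"
  by (frule C1c_C1, erule C1cE, rule sq_integrable_compact_support[OF divergence_continuous])
    (auto simp: divergence_def)

lemma C1c_grad_sq_integrable: "f \<in> C1c \<Omega> \<Longrightarrow> sq_integrable lborel (grad f)"
  by (frule C1c_C1, erule C1cE, rule sq_integrable_compact_support[OF grad_continuous])
    (auto simp: grad_def)

lemma L2_on_inner_set_integrable:
  assumes "f \<in> L2_on lborel \<Omega>" "sq_integrable lborel X"
  shows "set_integrable lborel \<Omega> (\<lambda>x. f x \<bullet> X x)"
  using sq_integrable_inner[OF assms(1)[unfolded L2_on_iff] assms(2)] by (simp add: set_integrable_def)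

lemma L2_on_mult_integrable:
  fixes f g :: "'e::euclidean_space \<Rightarrow> real"
  assumes "f \<in> L2_on lborel \<Omega>" "g \<in> L2_on lborel \<Omega>"
  shows "set_integrable lborel \<Omega> (\<lambda>x. f x * g x)"
proof -
  have "(\<lambda>x. indicator \<Omega> x *\<^sub>R (f x * g x)) = (\<lambda>x. (indicator \<Omega> x *\<^sub>R f x) \<bullet> (indicator \<Omega> x *\<^sub>R g x))"
    by (auto simp: indicator_def)
  then show ?thesis
    using sq_integrable_inner[OF assms[unfolded L2_on_iff]] by (simp add: set_integrable_def)
qed

lemma has_weak_gradient_unique:
  fixes \<Omega> :: "'e::euclidean_space set"
  assumes \<Omega>: "open \<Omega>" "bounded \<Omega>" and "has_weak_gradient \<Omega> v G" "has_weak_gradient \<Omega> v G'"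
  shows "AE y in lborel. y \<in> \<Omega> \<longrightarrow> G y = G' y"
proof -
  have G: "G \<in> L2_on lborel \<Omega>" "G' \<in> L2_on lborel \<Omega>"
    using assms by (auto simp: has_weak_gradient_def)
  have "AE y in lborel. y \<in> \<Omega> \<longrightarrow> G y - G' y = 0"
  proof (rule fundamental_lemma_vector[OF \<Omega>(1)])
    show "set_integrable lborel \<Omega> (\<lambda>y. G y - G' y)"
      by (intro set_integral_diff L2_on_set_integrable G \<Omega>)
    fix X :: "'e \<Rightarrow> 'e" assume X: "X \<in> C1c \<Omega>"
    have "(LINT y:\<Omega>|lborel. G y \<bullet> X y) = (LINT y:\<Omega>|lborel. G' y \<bullet> X y)"
      using assms(3,4) X by (auto simp: has_weak_gradient_def)
    then show "(LINT y:\<Omega>|lborel. (G y - G' y) \<bullet> X y) = 0"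
      using set_integral_diff(2)[OF L2_on_inner_set_integrable[OF G(1) C1c_sq_integrable[OF X]]
          L2_on_inner_set_integrable[OF G(2) C1c_sq_integrable[OF X]]]
      by (simp add: inner_diff_left)
  qed
  then show ?thesis by simp
qed

text \<open>Elimination of the choice operator: any known gradient makes the chosen one a gradient
  too, and uniqueness identifies the two almost everywhere.\<close>

lemma weak_gradient_AE:
  assumes "open \<Omega>" "bounded \<Omega>" "has_weak_gradient \<Omega> v G"
  shows "has_weak_gradient \<Omega> v (weak_gradient \<Omega> v)"
    and "AE y in lborel. y \<in> \<Omega> \<longrightarrow> weak_gradient \<Omega> v y = G y"
proof -
  show *: "has_weak_gradient \<Omega> v (weak_gradient \<Omega> v)"
    unfolding weak_gradient_def by (rule someI[of "has_weak_gradient \<Omega> v", OF assms(3)])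
  show "AE y in lborel. y \<in> \<Omega> \<longrightarrow> weak_gradient \<Omega> v y = G y"
    by (rule has_weak_gradient_unique[OF assms(1,2) * assms(3)])
qed

lemma has_weak_divergence_unique:
  assumes \<Omega>: "open \<Omega>" "bounded \<Omega>" and "has_weak_divergence \<Omega> Y g" "has_weak_divergence \<Omega> Y g'"
  shows "AE y in lborel. y \<in> \<Omega> \<longrightarrow> g y = g' y"
proof -
  have G: "g \<in> L2_on lborel \<Omega>" "g' \<in> L2_on lborel \<Omega>"
    using assms by (auto simp: has_weak_divergence_def)
  have "AE y in lborel. y \<in> \<Omega> \<longrightarrow> g y - g' y = 0"
  proof (rule fundamental_lemma[OF \<Omega>(1)])
    show "set_integrable lborel \<Omega> (\<lambda>y. g y - g' y)"
      by (intro set_integral_diff L2_on_set_integrable G \<Omega>)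
    fix X :: "'a \<Rightarrow> real" assume X: "X \<in> C1c \<Omega>"
    have "(LINT y:\<Omega>|lborel. g y * X y) = (LINT y:\<Omega>|lborel. g' y * X y)"
      using assms(3,4) X by (auto simp: has_weak_divergence_def)
    then show "(LINT y:\<Omega>|lborel. (g y - g' y) * X y) = 0"
      using set_integral_diff(2)[OF L2_on_inner_set_integrable[OF G(1) C1c_sq_integrable[OF X]]
          L2_on_inner_set_integrable[OF G(2) C1c_sq_integrable[OF X]]]
      by (simp add: left_diff_distrib)
  qed
  then show ?thesis by simp
qed

lemma weak_divergence_AE:
  assumes "open \<Omega>" "bounded \<Omega>" "has_weak_divergence \<Omega> Y g"
  shows "has_weak_divergence \<Omega> Y (weak_divergence \<Omega> Y)"
    and "AE y in lborel. y \<in> \<Omega> \<longrightarrow> weak_divergence \<Omega> Y y = g y"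
proof -
  show *: "has_weak_divergence \<Omega> Y (weak_divergence \<Omega> Y)"
    unfolding weak_divergence_def by (rule someI[of "has_weak_divergence \<Omega> Y", OF assms(3)])
  show "AE y in lborel. y \<in> \<Omega> \<longrightarrow> weak_divergence \<Omega> Y y = g y"
    by (rule has_weak_divergence_unique[OF assms(1,2) * assms(3)])
qed

lemma C1_has_weak_gradient:
  fixes \<Omega> :: "'e::euclidean_space set"
  assumes \<Omega>: "open \<Omega>" "bounded \<Omega>" and f: "C1 f"
  shows "has_weak_gradient \<Omega> f (grad f)"
  unfolding has_weak_gradient_def
proof (intro conjI ballI)
  show "grad f \<in> L2_on lborel \<Omega>"
    by (rule continuous_bounded_L2_on[OF grad_continuous[OF f] \<Omega>(2,1)])
  have f2: "f \<in> L2_on lborel \<Omega>"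
    by (rule continuous_bounded_L2_on[OF C1_continuous[OF f] \<Omega>(2,1)])
  fix X :: "'e \<Rightarrow> 'e" assume X: "X \<in> C1c \<Omega>"
  have "0 = (LINT y|lborel. f y * divergence X y + grad f y \<bullet> X y)"
    by (rule integration_by_parts_whole_space[OF f C1c_mono[OF X], symmetric]) simp
  also have "\<dots> = (LINT y:\<Omega>|lborel. f y * divergence X y + grad f y \<bullet> X y)"
    unfolding set_lebesgue_integral_def
    by (rule Bochner_Integration.integral_cong)
      (auto simp: indicator_def C1c_zero[OF X] C1c_divergence_zero[OF X])
  also have "\<dots> = (LINT y:\<Omega>|lborel. f y * divergence X y) + (LINT y:\<Omega>|lborel. grad f y \<bullet> X y)"
    using L2_on_inner_set_integrable[OF f2 C1c_divergence_sq_integrable[OF X]]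
      L2_on_inner_set_integrable[OF \<open>grad f \<in> _\<close> C1c_sq_integrable[OF X]]
    by (simp add: set_integral_add)
  finally show "(LINT y:\<Omega>|lborel. f y * divergence X y) = - (LINT y:\<Omega>|lborel. grad f y \<bullet> X y)"
    by simp
qed

section \<open>Cut-off functions\<close>

text \<open>Equal to 1 on the closed ball of radius \<open>R\<close> and 0 where |x - c|^2 \<ge> R^2
  + 1; two nested squared positive parts keep it \<open>C1\<close>. It makes a field compactly
  supported without changing it on the ball.\<close>

definition cutoff :: "'e::euclidean_space \<Rightarrow> real \<Rightarrow> 'e \<Rightarrow> real" where
  "cutoff c R x = (max 0 (1 - (max 0 ((norm (x - c))\<^sup>2 - R\<^sup>2))\<^sup>2))\<^sup>2"

lemma C1_norm_square: "C1 (\<lambda>x. (norm (x - c))\<^sup>2)"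
proof (rule C1I[where X' = "\<lambda>x h. 2 * ((x - c) \<bullet> h)"])
  fix y show "((\<lambda>x. (norm (x - c))\<^sup>2) has_derivative (\<lambda>h. 2 * ((y - c) \<bullet> h))) (at y)"
    unfolding power2_norm_eq_inner
    by (auto intro!: derivative_eq_intros simp: inner_commute)
qed (auto intro!: continuous_intros)

lemma cutoff_C1c: "cutoff c R \<in> C1c UNIV"
proof (rule C1cI[where K = "cball c (sqrt (R\<^sup>2 + 1))"])
  show "C1 (cutoff c R)"
    unfolding cutoff_def[abs_def] by (intro C1_pos_square C1_diff C1_const C1_norm_square)
  fix y assume "y \<notin> cball c (sqrt (R\<^sup>2 + 1))"
  then have "sqrt (R\<^sup>2 + 1) < norm (y - c)"
    by (simp add: dist_norm norm_minus_commute)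
  then have "R\<^sup>2 + 1 \<le> (norm (y - c))\<^sup>2"
    by (metis less_imp_le sqrt_le_D)
  then have "1 \<le> (max 0 ((norm (y - c))\<^sup>2 - R\<^sup>2))\<^sup>2"
    using one_le_power[of "(norm (y - c))\<^sup>2 - R\<^sup>2" 2] by simp
  then show "cutoff c R y = 0" by (simp add: cutoff_def)
qed auto

lemma cutoff_eq_1: "norm (y - c) \<le> R \<Longrightarrow> cutoff c R y = 1"
  using power_mono[of "norm (y - c)" R 2] by (simp add: cutoff_def max_def)

lemma cutoff_derivative_zero:
  assumes "norm (y - c) < R"
  shows "frechet_derivative (cutoff c R) (at y) = (\<lambda>_. 0)"
proof -
  have "(cutoff c R has_derivative (\<lambda>_. 0)) (at y)"
  proof (rule has_derivative_transform_within_open[OF has_derivative_const])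
    show "open (ball c R)" by simp
    show "y \<in> ball c R" using assms by (simp add: dist_norm norm_minus_commute)
    show "1 = cutoff c R x" if "x \<in> ball c R" for x
      using that by (simp add: cutoff_eq_1 dist_norm norm_minus_commute)
  qed
  then show ?thesis by (simp add: frechet_derivative_at[symmetric])
qed

section \<open>The space \<open>L120\<close> and its crack traces\<close>

locale cracked_ball =
  fixes c :: "'a::euclidean_space \<times> real" and R :: real
  assumes centre: "snd c = 0" and radius: "0 < R"
begin

abbreviation D :: "('a \<times> real) set" where "D \<equiv> ball c R - crack"

abbreviation HB :: "real \<Rightarrow> ('a \<times> real) set" where "HB s \<equiv> half_ball c R s"

lemma HB_eq: "HB s = ball c R \<inter> half_space s"
  by (auto simp: half_ball_def half_space_def)

lemma mem_ball_iff: "(x', t) \<in> ball c R \<longleftrightarrow> (norm (x' - fst c))\<^sup>2 + t\<^sup>2 < R\<^sup>2"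
proof -
  have "(x', t) \<in> ball c R \<longleftrightarrow> sqrt ((norm (x' - fst c))\<^sup>2 + t\<^sup>2) < sqrt (R\<^sup>2)"
    using centre radius by (cases c) (simp add: dist_Pair_Pair, simp add: dist_norm norm_minus_commute)
  then show ?thesis by (simp only: real_sqrt_less_iff)
qed

lemma Gamma_eq: "\<Gamma> c R = ball (fst c) R"
proof -
  have "x' \<in> \<Gamma> c R \<longleftrightarrow> (norm (x' - fst c))\<^sup>2 < R\<^sup>2" for x'
    using mem_ball_iff[of x' 0] by (simp add: \<Gamma>_def crack_def)
  moreover have "(norm (x' - fst c))\<^sup>2 < R\<^sup>2 \<longleftrightarrow> norm (x' - fst c) < R" for x'
    using radius power2_less_imp_less[of "norm (x' - fst c)" R] power_strict_mono[of "norm (x' - fst c)" R 2]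
    by auto
  ultimately show ?thesis
    by (auto simp: dist_norm norm_minus_commute)
qed

lemma Gamma_open: "open (\<Gamma> c R)" and Gamma_bounded: "bounded (\<Gamma> c R)"
  by (auto simp: Gamma_eq)

lemma HB_open: "open (HB s)"
  unfolding HB_eq half_space_def
  by (intro open_Int open_ball open_Collect_less continuous_intros)

lemma HB_borel [measurable]: "HB s \<in> sets borel"
  by (rule borel_open[OF HB_open])

lemma HB_bounded: "bounded (HB s)"
  by (rule bounded_subset[OF bounded_ball]) (auto simp: HB_eq)

lemma D_open: "open D" 
proof -
  have "D = ball c R \<inter> {y. snd y \<noteq> 0}" by (auto simp: crack_def)
  then show ?thesis
    by (simp only:) (intro open_Int open_ball open_Collect_neq continuous_intros)
qed

lemma D_borel [measurable]: "D \<in> sets borel"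
  by (rule borel_open[OF D_open])

lemma D_bounded: "bounded D"
  by (rule bounded_subset[OF bounded_ball]) auto

lemma HB_subset_D: "s \<in> {1, -1} \<Longrightarrow> HB s \<subseteq> D"
  by (auto simp: HB_eq half_space_def crack_def)

lemma D_eq: "D = HB 1 \<union> HB (-1)"
  by (auto simp: HB_eq half_space_def crack_def)

lemma HB_disjoint: "HB 1 \<inter> HB (-1) = {}"
  by (auto simp: HB_eq half_space_def)

lemma indicator_D: "indicator D y = (indicator (HB 1) y + indicator (HB (-1)) y :: real)"
  using HB_disjoint by (auto simp: D_eq indicator_def)

lemma HB_nonzero: "y \<in> HB s \<Longrightarrow> snd y \<noteq> 0"
  by (auto simp: HB_eq half_space_def)

lemma L2_on_HB:
  assumes "f \<in> L2_on lborel D" "s \<in> {1, -1}"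
  shows "sq_integrable lborel (\<lambda>y. indicator (HB s) y *\<^sub>R f y)"
proof -
  have m: "(\<lambda>y. indicator D y *\<^sub>R f y) \<in> borel_measurable lborel"
    using assms(1) unfolding L2_on_iff by (rule sq_integrable_measurable)
  have e: "indicator (HB s) y *\<^sub>R f y = indicator (HB s) y *\<^sub>R (indicator D y *\<^sub>R f y)" for y
    using HB_subset_D[OF assms(2)] by (auto simp: indicator_def)
  show ?thesis
    unfolding e by (rule sq_integrable_bound[OF assms(1)[unfolded L2_on_iff]])
      (use m in \<open>measurable, auto simp: indicator_def\<close>)
qed

lemma L2_on_D:
  assumes "\<And>s. s \<in> {1, -1} \<Longrightarrow> sq_integrable lborel (\<lambda>y. indicator (HB s) y *\<^sub>R f y)"
  shows "f \<in> L2_on lborel D"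
  using sq_integrable_add[OF assms[of 1] assms[of "-1"]]
  by (simp add: L2_on_iff indicator_D scaleR_add_left)

section \<open>Gauss-Green integrals and the linear space of admissible pairs\<close>

text \<open>The Gauss-Green integral with function and gradient as independent arguments. Written as
  two L2 inner products of extensions by zero, it is linear in the pair and continuous under L2
  convergence.\<close>

definition GG :: "real \<Rightarrow> ('a \<times> real \<Rightarrow> real) \<Rightarrow> ('a \<times> real \<Rightarrow> 'a \<times> real) \<Rightarrow> ('a \<times> real \<Rightarrow> 'a \<times> real) \<Rightarrow> real"
  where "GG s v G X = (LINT y|lborel. (indicator (HB s) y *\<^sub>R v y) \<bullet> divergence X y) +
    (LINT y|lborel. (indicator (HB s) y *\<^sub>R G y) \<bullet> X y)"

lemma GG_eq:
  assumes "v \<in> L2_on lborel D" "G \<in> L2_on lborel D" "s \<in> {1, -1}" "X \<in> C1c UNIV"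
  shows "(LINT y:HB s|lborel. v y * divergence X y + G y \<bullet> X y) = GG s v G X"
proof -
  have "(LINT y:HB s|lborel. v y * divergence X y + G y \<bullet> X y) =
    (LINT y|lborel. (indicator (HB s) y *\<^sub>R v y) \<bullet> divergence X y + (indicator (HB s) y *\<^sub>R G y) \<bullet> X y)"
    by (simp add: set_lebesgue_integral_def algebra_simps)
  also have "\<dots> = GG s v G X"
    unfolding GG_def
    by (intro Bochner_Integration.integral_add sq_integrable_inner L2_on_HB assms
        C1c_divergence_sq_integrable[OF assms(4)] C1c_sq_integrable[OF assms(4)])
  finally show ?thesis .
qed

lemma GG_cong_AE:
  assumes "AE y in lborel. y \<in> D \<longrightarrow> G y = G' y" "G \<in> L2_on lborel D" "G' \<in> L2_on lborel D" "s \<in> {1, -1}"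
    "X \<in> C1c UNIV"
  shows "GG s v G X = GG s v G' X"
proof -
  note [measurable] = sq_integrable_measurable[OF L2_on_HB[OF assms(2,4)]]
    sq_integrable_measurable[OF L2_on_HB[OF assms(3,4)]] sq_integrable_measurable[OF C1c_sq_integrable[OF assms(5)]]
  have "(LINT y|lborel. (indicator (HB s) y *\<^sub>R G y) \<bullet> X y) = (LINT y|lborel. (indicator (HB s) y *\<^sub>R G' y) \<bullet> X y)"
  proof (rule integral_cong_AE)
    show "AE y in lborel. (indicator (HB s) y *\<^sub>R G y) \<bullet> X y = (indicator (HB s) y *\<^sub>R G' y) \<bullet> X y"
      using assms(1) by eventually_elim (use HB_subset_D[OF assms(4)] in \<open>auto simp: indicator_def\<close>)
  qed measurable
  then show ?thesis by (simp add: GG_def)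
qed

text \<open>By \<open>adm_L120\<close> and \<open>L120_adm\<close> below, \<open>adm v G\<close> says that \<open>v\<close> lies in \<open>L120 c R\<close> with weak gradient \<open>G\<close>: the
  fields compactly supported in \<open>D\<close> determine \<open>G\<close>, the others force the trace on the sphere to vanish.\<close>

definition adm :: "('a \<times> real \<Rightarrow> real) \<Rightarrow> ('a \<times> real \<Rightarrow> 'a \<times> real) \<Rightarrow> bool" where
  "adm v G \<longleftrightarrow> v \<in> L2_on lborel D \<and> G \<in> L2_on lborel D \<and>
    (\<forall>s\<in>{1, -1}. \<forall>X\<in>C1c UNIV. (\<forall>y\<in>crack. X y = 0) \<longrightarrow> GG s v G X = 0)"

lemma admD:
  assumes "adm v G"
  shows "v \<in> L2_on lborel D" "G \<in> L2_on lborel D"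
    "\<And>s X. s \<in> {1, -1} \<Longrightarrow> X \<in> C1c UNIV \<Longrightarrow> (\<And>x'. X (x', 0) = 0) \<Longrightarrow> GG s v G X = 0"
  using assms by (auto simp: adm_def crack_def)

text \<open>A field supported in \<open>D\<close> vanishes on the crack, so the hypothesis applies
  on both half balls and the two identities add up. Only fields supported in the ball are tested,
  because the lemma also serves the pair's function \<open>u\<close>, whose trace on the sphere need
  not vanish.\<close>

lemma has_weak_gradient_D:
  assumes v: "v \<in> L2_on lborel D" and G: "G \<in> L2_on lborel D"
    and 0: "\<And>s X. s \<in> {1, -1} \<Longrightarrow> X \<in> C1c (ball c R) \<Longrightarrow> (\<And>x'. X (x', 0) = 0) \<Longrightarrow> GG s v G X = 0"
  shows "has_weak_gradient D v G"
  unfolding has_weak_gradient_def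
proof (intro conjI ballI G)
  fix X :: "'a \<times> real \<Rightarrow> 'a \<times> real" assume XD: "X \<in> C1c D"
  then have X: "X \<in> C1c UNIV" by (rule C1c_mono) simp
  have Xb: "X \<in> C1c (ball c R)" by (rule C1c_mono[OF XD]) auto
  have "X (x', 0) = 0" for x'
    using C1c_zero[OF XD] by (simp add: crack_def)
  then have GG0: "GG s v G X = 0" if "s \<in> {1, -1}" for s
    using 0 Xb that by blast
  note i1 = sq_integrable_inner[OF L2_on_HB[OF v] C1c_divergence_sq_integrable[OF X]]
  note i2 = sq_integrable_inner[OF L2_on_HB[OF G] C1c_sq_integrable[OF X]]
  have "(LINT y:D|lborel. v y * divergence X y) + (LINT y:D|lborel. G y \<bullet> X y) = GG 1 v G X + GG (-1) v G X"
    using i1[of 1] i1[of "-1"] i2[of 1] i2[of "-1"]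
    by (simp add: GG_def set_lebesgue_integral_def indicator_D algebra_simps)
  then show "(LINT y:D|lborel. v y * divergence X y) = - (LINT y:D|lborel. G y \<bullet> X y)"
    using GG0 by simp
qed

lemma gauss_green_integral_eq:
  assumes "v \<in> L2_on lborel D" "has_weak_gradient D v G" "s \<in> {1, -1}" "X \<in> C1c UNIV"
  shows "gauss_green_integral c R s v X = GG s v G X"
proof -
  note wg = weak_gradient_AE[OF D_open D_bounded assms(2)]
  have "weak_gradient D v \<in> L2_on lborel D" "G \<in> L2_on lborel D"
    using wg(1) assms(2) by (auto simp: has_weak_gradient_def)
  then show ?thesis
    unfolding gauss_green_integral_def
    using GG_eq[OF assms(1) _ assms(3,4)] GG_cong_AE[OF wg(2) _ _ assms(3,4)] by simp
qed

lemma adm_L120: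
  assumes "adm v G"
  shows "v \<in> L120 c R" "has_weak_gradient D v G" "AE y in lborel. y \<in> D \<longrightarrow> weak_gradient D v y = G y"
proof -
  note a = admD[OF assms]
  show w: "has_weak_gradient D v G"
    by (rule has_weak_gradient_D[OF a(1,2) a(3)]) (auto intro: C1c_mono)
  show "AE y in lborel. y \<in> D \<longrightarrow> weak_gradient D v y = G y"
    by (rule weak_gradient_AE[OF D_open D_bounded w])
  have "has_sphere_trace c R s v (\<lambda>_. 0)" if "s \<in> {1, -1}" for s
    using a(3)[OF that]
    by (auto simp: has_sphere_trace_def L2_on_def set_borel_measurable_def crack_def
        gauss_green_integral_eq[OF a(1) w that] set_integrable_def set_lebesgue_integral_def)
  then show "v \<in> L120 c R"
    using a w by (auto simp: L120_def H1_def intro!: exI[of _ "\<lambda>_ :: 'a \<times> real. 0 :: real"])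
qed

lemma L120_adm:
  assumes "v \<in> L120 c R"
  shows "adm v (weak_gradient D v)"
proof -
  have v: "v \<in> L2_on lborel D" and "\<exists>G. has_weak_gradient D v G"
    using assms by (auto simp: L120_def H1_def)
  then have w: "has_weak_gradient D v (weak_gradient D v)"
    using weak_gradient_AE(1)[OF D_open D_bounded] by blast
  have "GG s v (weak_gradient D v) X = 0"
    if s: "s \<in> {1, -1}" and X: "X \<in> C1c UNIV" and X0: "\<forall>y\<in>crack. X y = 0" for s X
  proof -
    obtain \<theta> where \<theta>: "has_sphere_trace c R s v \<theta>"
      "AE y in sphere_measure c R. 0 < s * snd y \<longrightarrow> \<theta> y = 0"
      using assms s by (auto simp: L120_def)
    have "GG s v (weak_gradient D v) X = gauss_green_integral c R s v X"
      by (rule gauss_green_integral_eq[OF v w s X, symmetric])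
    also have "\<dots> = (LINT y:{y. 0 < s * snd y}|sphere_measure c R. \<theta> y * (X y \<bullet> ((y - c) /\<^sub>R R)))"
      using \<theta>(1) X X0 by (simp add: has_sphere_trace_def)
    also have "\<dots> = 0"
      unfolding set_lebesgue_integral_def
      by (rule integral_eq_zero_AE) (use \<theta>(2) in \<open>auto elim!: eventually_mono simp: indicator_def\<close>)
    finally show ?thesis .
  qed
  with v w show ?thesis by (auto simp: adm_def has_weak_gradient_def)
qed

lemma GG_add:
  assumes "v \<in> L2_on lborel D" "G \<in> L2_on lborel D" "v' \<in> L2_on lborel D" "G' \<in> L2_on lborel D"
    "s \<in> {1, -1}" "X \<in> C1c UNIV"
  shows "GG s (\<lambda>y. v y + t * v' y) (\<lambda>y. G y + t *\<^sub>R G' y) X = GG s v G X + t * GG s v' G' X"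
proof -
  note i1 = sq_integrable_inner[OF L2_on_HB[OF assms(1,5)] C1c_divergence_sq_integrable[OF assms(6)]]
    sq_integrable_inner[OF L2_on_HB[OF assms(3,5)] C1c_divergence_sq_integrable[OF assms(6)]]
  note i2 = sq_integrable_inner[OF L2_on_HB[OF assms(2,5)] C1c_sq_integrable[OF assms(6)]]
    sq_integrable_inner[OF L2_on_HB[OF assms(4,5)] C1c_sq_integrable[OF assms(6)]]
  have e1: "(indicator (HB s) y *\<^sub>R (v y + t * v' y)) \<bullet> divergence X y =
      (indicator (HB s) y *\<^sub>R v y) \<bullet> divergence X y + t * ((indicator (HB s) y *\<^sub>R v' y) \<bullet> divergence X y)" for y
    by (simp add: algebra_simps)
  have e2: "(indicator (HB s) y *\<^sub>R (G y + t *\<^sub>R G' y)) \<bullet> X y =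
      (indicator (HB s) y *\<^sub>R G y) \<bullet> X y + t * ((indicator (HB s) y *\<^sub>R G' y) \<bullet> X y)" for y
    by (simp add: algebra_simps)
  show ?thesis
    unfolding GG_def e1 e2
    using i1 i2 by (simp only: Bochner_Integration.integral_add integrable_mult_right integral_mult_right_zero)
      (simp add: algebra_simps)
qed

lemma L2_on_add:
  fixes f :: "'a \<times> real \<Rightarrow> 'b::euclidean_space"
  assumes "f \<in> L2_on lborel D" "g \<in> L2_on lborel D"
  shows "(\<lambda>y. f y + t *\<^sub>R g y) \<in> L2_on lborel D"
  using sq_integrable_add[OF assms(1)[unfolded L2_on_iff] sq_integrable_scaleR[OF assms(2)[unfolded L2_on_iff], of t]]
  by (simp add: L2_on_iff algebra_simps)

lemma adm_add:
  assumes "adm v G" "adm v' G'"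
  shows "adm (\<lambda>y. v y + t * v' y) (\<lambda>y. G y + t *\<^sub>R G' y)"
  using L2_on_add[OF admD(1)[OF assms(1)] admD(1)[OF assms(2)], of t]
    L2_on_add[OF admD(2)[OF assms(1)] admD(2)[OF assms(2)], of t]
    GG_add[OF admD(1,2)[OF assms(1)] admD(1,2)[OF assms(2)]] assms
  by (simp add: adm_def)

lemma adm_zero: "adm (\<lambda>_. 0) (\<lambda>_. 0)"
  by (simp add: adm_def GG_def L2_on_iff sq_integrable_def)

text \<open>The defining condition treats the two half balls separately and its test fields vanish
  on the crack, so a jump across the crack costs nothing. One-sided test functions obtained this way
  decouple the equation of \<open>v_phi\<close>.\<close>

lemma adm_restrict:
  assumes "adm v G" and s: "s \<in> {1, -1}"
  shows "adm (\<lambda>y. indicator (HB s) y * v y) (\<lambda>y. indicator (HB s) y *\<^sub>R G y)"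
proof -
  have e: "indicator (HB s') y *\<^sub>R (indicator (HB s) y *\<^sub>R f y) = (if s' = s then indicator (HB s) y *\<^sub>R f y else 0)"
    if "s' \<in> {1, -1}" for s' y and f :: "'a \<times> real \<Rightarrow> 'b::euclidean_space"
    using HB_disjoint that s by (auto simp: indicator_def)
  have L2: "(\<lambda>y. indicator (HB s) y *\<^sub>R f y) \<in> L2_on lborel D" if "f \<in> L2_on lborel D"
    for f :: "'a \<times> real \<Rightarrow> 'b::euclidean_space"
  proof (rule L2_on_D)
    fix s' :: real assume s': "s' \<in> {1, -1}"
    show "sq_integrable lborel (\<lambda>y. indicator (HB s') y *\<^sub>R (indicator (HB s) y *\<^sub>R f y))"
      unfolding e[OF s'] using L2_on_HB[OF that s] by (cases "s' = s") (auto simp: sq_integrable_def)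
  qed
  have GG: "GG s' (\<lambda>y. indicator (HB s) y *\<^sub>R v y) (\<lambda>y. indicator (HB s) y *\<^sub>R G y) X =
      (if s' = s then GG s v G X else 0)" if "s' \<in> {1, -1}" for s' X
    unfolding GG_def e[OF that] by simp
  show ?thesis
    using L2[OF admD(1)[OF assms(1)]] L2[OF admD(2)[OF assms(1)]] GG assms by (auto simp: adm_def)
qed

end

section \<open>Crack traces by integration along normal lines\<close>

text \<open>The factor 2 R is the length of the interval carrying \<open>k\<close>. The bound lives
  in the extended nonnegative reals because a slice of an L2 function is square integrable only for
  almost every x'; on the other slices it is trivial.\<close>

lemma line_Cauchy_Schwarz:
  fixes k :: "real \<Rightarrow> real"
  assumes k: "k \<in> borel_measurable borel" and A: "A \<in> sets borel"
    and R: "0 < R" "\<And>t. R \<le> \<bar>t\<bar> \<Longrightarrow> k t = 0"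
  shows "ennreal ((LINT t|lborel. indicator A t * k t)\<^sup>2) \<le> ennreal (2 * R) * (\<integral>\<^sup>+ t. ennreal ((k t)\<^sup>2) \<partial>lborel)"
proof (cases "(\<integral>\<^sup>+ t. ennreal ((k t)\<^sup>2) \<partial>lborel) = \<infinity>")
  case True
  then show ?thesis using R by (simp add: ennreal_mult_top)
next
  case False
  have "integrable lborel (\<lambda>t. (k t)\<^sup>2)"
    using k False by (intro integrableI_bounded) (auto simp: less_top)
  then have sk: "sq_integrable lborel k"
    using k by (simp add: sq_integrable_def)
  let ?f = "\<lambda>t. indicator (A \<inter> {-R..R}) t :: real"
  have Am: "A \<inter> {-R..R} \<in> sets borel" using A by simp
  have em: "emeasure lborel (A \<inter> {-R..R}) \<le> ennreal (2 * R)"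
  proof -
    have "emeasure lborel (A \<inter> {-R..R}) \<le> emeasure lborel {-R..R}" by (rule emeasure_mono) auto
    also have "\<dots> = ennreal (2 * R)" using R(1) by (subst emeasure_lborel_Icc) auto
    finally show ?thesis .
  qed
  have f2: "(\<lambda>t. (norm (?f t))\<^sup>2) = ?f" by (auto simp: indicator_def)
  have sf: "sq_integrable lborel ?f"
    unfolding sq_integrable_def f2 using Am em by (auto intro!: integrable_real_indicator intro: le_less_trans)
  have "(LINT t|lborel. indicator A t * k t) = (LINT t|lborel. ?f t \<bullet> k t)"
    by (rule Bochner_Integration.integral_cong) (use R(2) in \<open>auto simp: indicator_def not_le\<close>)
  then have "(LINT t|lborel. indicator A t * k t)\<^sup>2 \<le> (LINT t|lborel. (norm (?f t))\<^sup>2) * (LINT t|lborel. (norm (k t))\<^sup>2)"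
    using Cauchy_Schwarz_sq_integrable[OF sf sk] by simp
  also have "\<dots> \<le> 2 * R * (LINT t|lborel. (k t)\<^sup>2)"
  proof -
    have "(LINT t|lborel. ?f t) = enn2real (emeasure lborel (A \<inter> {-R..R}))"
      using Am by (simp add: measure_def)
    also have "\<dots> \<le> 2 * R" using em R by (simp add: enn2real_leI)
    finally show ?thesis unfolding f2 using R(1) by (intro mult_mono) auto
  qed
  finally have "ennreal ((LINT t|lborel. indicator A t * k t)\<^sup>2) \<le> ennreal (2 * R * (LINT t|lborel. (k t)\<^sup>2))"
    by (rule ennreal_leI)
  also have "\<dots> = ennreal (2 * R) * (\<integral>\<^sup>+ t. ennreal ((k t)\<^sup>2) \<partial>lborel)"
    using R \<open>integrable lborel (\<lambda>t. (k t)\<^sup>2)\<close> by (subst nn_integral_eq_integral) (auto simp: ennreal_mult)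
  finally show ?thesis .
qed

lemma tonelli_lborel:
  fixes f :: "'a::euclidean_space \<times> 'b::euclidean_space \<Rightarrow> ennreal"
  assumes "f \<in> borel_measurable borel"
  shows "(\<integral>\<^sup>+ x'. \<integral>\<^sup>+ t. f (x', t) \<partial>lborel \<partial>lborel) = (\<integral>\<^sup>+ x. f x \<partial>lborel)"
  using lborel.nn_integral_fst[of f lborel] assms by (simp add: lborel_prod)

lemma slice_measurable:
  fixes f :: "'a::euclidean_space \<times> 'b::euclidean_space \<Rightarrow> 'c::topological_space"
  assumes "f \<in> borel_measurable borel"
  shows "(\<lambda>t. f (x', t)) \<in> borel_measurable borel"
  by (rule measurable_compose[OF _ assms]) (intro borel_measurable_continuous_onI continuous_intros)

lemma integral_slice_measurable:
  fixes f :: "'a::euclidean_space \<times> 'b::euclidean_space \<Rightarrow> real"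
  assumes "f \<in> borel_measurable borel"
  shows "(\<lambda>x'. LINT t|lborel. f (x', t)) \<in> borel_measurable borel"
  using lborel.borel_measurable_lebesgue_integral[of "\<lambda>x' t. f (x', t)" lborel] assms
  by (simp add: lborel_prod case_prod_unfold)

lemma sq_integrable_nn:
  fixes f :: "'b \<Rightarrow> real"
  shows "sq_integrable M f \<longleftrightarrow> f \<in> borel_measurable M \<and> (\<integral>\<^sup>+ x. ennreal ((f x)\<^sup>2) \<partial>M) < \<infinity>"
  by (auto simp: sq_integrable_def integrable_iff_bounded)

lemma sq_integrable_snd:
  fixes G :: "'b \<Rightarrow> 'a::euclidean_space \<times> real"
  assumes "sq_integrable M G" shows "sq_integrable M (\<lambda>y. snd (G y))"
proof (rule sq_integrable_bound[OF assms])
  show "(\<lambda>y. snd (G y)) \<in> borel_measurable M"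
    using measurable_compose[OF sq_integrable_measurable[OF assms] snd_borel_measurable] by simp
  show "AE x in M. norm (snd (G x)) \<le> norm (G x)"
    by (metis (no_types, lifting) AE_I2 norm_snd_le prod.collapse)
qed

context cracked_ball begin

definition normal_part :: "real \<Rightarrow> ('a \<times> real \<Rightarrow> 'a \<times> real) \<Rightarrow> 'a \<times> real \<Rightarrow> real" where
  "normal_part s G y = indicator (HB s) y * snd (G y)"

lemma normal_part_sq:
  assumes "G \<in> L2_on lborel D" "s \<in> {1, -1}"
  shows "sq_integrable lborel (normal_part s G)"
  using sq_integrable_snd[OF L2_on_HB[OF assms]] by (simp add: normal_part_def[abs_def])

lemma normal_part_zero: "y \<notin> HB s \<Longrightarrow> normal_part s G y = 0"
  by (simp add: normal_part_def)

lemma HB_snd: "y \<in> HB s \<Longrightarrow> \<bar>snd y\<bar> < R"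
proof -
  assume "y \<in> HB s"
  then have "(norm (fst y - fst c))\<^sup>2 + (snd y)\<^sup>2 < R\<^sup>2"
    using mem_ball_iff[of "fst y" "snd y"] by (simp add: HB_eq)
  then have "\<bar>snd y\<bar>\<^sup>2 < R\<^sup>2"
    using zero_le_power2[of "norm (fst y - fst c)"] unfolding power2_abs by linarith
  then show ?thesis using radius power2_less_imp_less[of "\<bar>snd y\<bar>" R] by simp
qed

lemma normal_part_far: "R \<le> \<bar>t\<bar> \<Longrightarrow> normal_part s G (x', t) = 0"
  using HB_snd[of "(x', t)" s] by (force intro: normal_part_zero)

text \<open>The fundamental theorem of calculus along the normal segment from the crack to the
  sphere, where the function vanishes: the boundary value is minus the integral of the derivative
  taken in direction s. The gradient alone determines it.\<close>

definition tr :: "real \<Rightarrow> ('a \<times> real \<Rightarrow> 'a \<times> real) \<Rightarrow> 'a \<Rightarrow> real" where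
  "tr s G x' = - s * (LINT t|lborel. normal_part s G (x', t))"

lemma tr_zero: "x' \<notin> \<Gamma> c R \<Longrightarrow> tr s G x' = 0"
proof -
  assume "x' \<notin> \<Gamma> c R"
  then have "(x', 0) \<notin> ball c R" by (simp add: \<Gamma>_def crack_def)
  then have "(x', t) \<notin> HB s" for t
    using mem_ball_iff[of x' 0] mem_ball_iff[of x' t] zero_le_power2[of t] unfolding HB_eq Int_iff
    by (simp del: mem_ball)
  then show ?thesis by (simp add: tr_def normal_part_zero)
qed

text \<open>Cauchy-Schwarz on each normal line bounds tr^2 by 2 R times the line integral of the
  squared normal derivative; Tonelli integrates this over x'.\<close>

lemma tr_sq:
  assumes G: "G \<in> L2_on lborel D" and s: "s \<in> {1, -1}"
  shows "sq_integrable lborel (tr s G)"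
  unfolding sq_integrable_nn
proof
  note sq = normal_part_sq[OF G s]
  have m: "normal_part s G \<in> borel_measurable borel"
    using sq_integrable_measurable[OF sq] by simp
  then show "tr s G \<in> borel_measurable lborel"
    using integral_slice_measurable[OF m] unfolding tr_def[abs_def] by measurable
  have "(\<integral>\<^sup>+ x'. ennreal ((tr s G x')\<^sup>2) \<partial>lborel) \<le>
      (\<integral>\<^sup>+ x'. ennreal (2 * R) * (\<integral>\<^sup>+ t. ennreal ((normal_part s G (x', t))\<^sup>2) \<partial>lborel) \<partial>lborel)"
  proof (rule nn_integral_mono)
    fix x'
    have "(tr s G x')\<^sup>2 = (LINT t|lborel. indicator UNIV t * normal_part s G (x', t))\<^sup>2"
      using s by (auto simp: tr_def)
    then show "ennreal ((tr s G x')\<^sup>2) \<le> ennreal (2 * R) * (\<integral>\<^sup>+ t. ennreal ((normal_part s G (x', t))\<^sup>2) \<partial>lborel)"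
      using line_Cauchy_Schwarz[OF slice_measurable[OF m] _ radius normal_part_far, of UNIV] by simp
  qed
  also have "\<dots> = ennreal (2 * R) * (\<integral>\<^sup>+ x'. (\<integral>\<^sup>+ t. ennreal ((normal_part s G (x', t))\<^sup>2) \<partial>lborel) \<partial>lborel)"
    using lborel.borel_measurable_nn_integral_fst[of "\<lambda>y. ennreal ((normal_part s G y)\<^sup>2)" lborel] m
    by (intro nn_integral_cmult) (simp add: lborel_prod)
  also have "\<dots> = ennreal (2 * R) * (\<integral>\<^sup>+ y. ennreal ((normal_part s G y)\<^sup>2) \<partial>lborel)"
    by (subst tonelli_lborel[of "\<lambda>y. ennreal ((normal_part s G y)\<^sup>2)"]) (use m in simp_all)
  also have "\<dots> < \<infinity>"
    using sq by (simp add: sq_integrable_nn ennreal_mult_less_top)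
  finally show "(\<integral>\<^sup>+ x'. ennreal ((tr s G x')\<^sup>2) \<partial>lborel) < \<infinity>" .
qed

lemma normal_part_integrable:
  assumes "G \<in> L2_on lborel D" "s \<in> {1, -1}"
  shows "integrable lborel (normal_part s G)"
proof -
  have idem: "indicator (HB s) y * indicator (HB s) y = (indicator (HB s) y :: real)" for y
    by (auto simp: indicator_def)
  have "normal_part s G \<in> L2_on lborel (HB s)"
    using normal_part_sq[OF assms] by (simp add: L2_on_iff normal_part_def[abs_def] idem flip: mult.assoc)
  from L2_on_set_integrable[OF this HB_bounded HB_open] show ?thesis
    by (simp add: set_integrable_def normal_part_def[abs_def] idem flip: mult.assoc)
qed

text \<open>Fubini turns a pairing on the crack into a volume pairing of the gradient with the fixed
  field h(x') e_N. This is what makes the boundary term of the equation for \<open>v_phi\<close> an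
  L2 inner product.\<close>

lemma integral_tr_mult:
  assumes G: "G \<in> L2_on lborel D" and s: "s \<in> {1, -1}" and h: "continuous_on UNIV h"
  shows "(LINT x'|lborel. tr s G x' * h x') = - s * (LINT y|lborel. normal_part s G y * h (fst y))"
    "integrable lborel (\<lambda>y. normal_part s G y * h (fst y))"
proof -
  have hm: "h \<in> borel_measurable borel" by (rule borel_measurable_continuous_onI[OF h])
  have "bounded (h ` fst ` closure (HB s))"
    using HB_bounded by (intro compact_imp_bounded compact_continuous_image continuous_on_subset[OF h])
      (auto simp: compact_closure intro!: continuous_intros)
  then obtain B where B: "\<And>y. y \<in> HB s \<Longrightarrow> \<bar>h (fst y)\<bar> \<le> B"
    using closure_subset[of "HB s"] by (auto simp: bounded_iff image_iff)
  show int: "integrable lborel (\<lambda>y. normal_part s G y * h (fst y))"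
  proof (rule Bochner_Integration.integrable_bound)
    show "integrable lborel (\<lambda>y. normal_part s G y * B)"
      using normal_part_integrable[OF G s] by simp
    show "AE y in lborel. norm (normal_part s G y * h (fst y)) \<le> norm (normal_part s G y * B)"
    proof (rule AE_I2)
      fix y show "norm (normal_part s G y * h (fst y)) \<le> norm (normal_part s G y * B)"
        using order_trans[OF B abs_ge_self, of y] normal_part_zero[of y s G]
        by (cases "y \<in> HB s") (auto simp: abs_mult intro!: mult_left_mono)
    qed
    show "(\<lambda>y. normal_part s G y * h (fst y)) \<in> borel_measurable lborel"
      using borel_measurable_integrable[OF normal_part_integrable[OF G s]] hm by measurable
  qed
  have "(LINT y|lborel. normal_part s G y * h (fst y)) = (LINT x'|lborel. (LINT t|lborel. normal_part s G (x', t)) * h x')"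
    using fubini_lborel[OF int] by simp
  also have "- s * \<dots> = (LINT x'|lborel. tr s G x' * h x')"
    by (simp add: tr_def mult.assoc)
  finally show "(LINT x'|lborel. tr s G x' * h x') = - s * (LINT y|lborel. normal_part s G y * h (fst y))"
    by simp
qed

text \<open>A field with vanishing normal component is a limit of fields vanishing on the crack: multiply it by
  \<open>n x\<^sub>N\<^sup>2 / (1 + n x\<^sub>N\<^sup>2)\<close>, whose gradient is normal.\<close>

lemma GG_tangential:
  assumes adm: "adm v G" and s: "s \<in> {1, -1}" and T: "T \<in> C1c UNIV" and snd: "\<And>y. snd (T y) = 0"
  shows "GG s v G T = 0"
proof -
  note v = L2_on_HB[OF admD(1)[OF adm] s] and G = L2_on_HB[OF admD(2)[OF adm] s]
  define k where "k n y = 1 - 1 / (1 + real n * (snd y)\<^sup>2)" for n and y :: "'a \<times> real"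
  have p: "1 + real n * t\<^sup>2 > 0" for n and t :: real
    by (simp add: add_pos_nonneg)
  let ?k' = "\<lambda>n y h. 2 * real n * snd y * snd h / (1 + real n * (snd y)\<^sup>2)\<^sup>2"
  have dk: "(k n has_derivative ?k' n y) (at y)" for n and y :: "'a \<times> real"
    unfolding k_def[abs_def]
    by (rule derivative_eq_intros refl | use p[of n "snd y"] in force)+
      (auto simp: fun_eq_iff power2_eq_square divide_simps)
  have C1k: "C1 (k n)" for n
  proof (rule C1I[OF dk])
    fix h
    have "(1 + real n * (snd y)\<^sup>2)\<^sup>2 \<noteq> 0" for y :: "'a \<times> real" using p[of n "snd y"] by simp
    then show "continuous_on UNIV (\<lambda>y. ?k' n y h)"
      by (auto intro!: continuous_intros)
  qed
  have k_bounds: "0 \<le> k n y" "k n y \<le> 1" for n y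
    using p[of n "snd y"] by (auto simp: k_def divide_le_eq_1)
  have k_lim: "(\<lambda>n. k n y) \<longlonglongrightarrow> 1" if "y \<in> HB s" for y
  proof -
    have "0 < (snd y)\<^sup>2" using HB_nonzero[OF that] by simp
    then have "(\<lambda>n. 1 - 1 / (1 + real n * (snd y)\<^sup>2)) \<longlonglongrightarrow> 1 - 0"
      by (intro tendsto_intros tendsto_divide_0[OF tendsto_const] filterlim_at_top_imp_at_infinity
          filterlim_tendsto_add_at_top[OF tendsto_const] filterlim_at_top_mult_tendsto_pos[OF tendsto_const]
          filterlim_real_sequentially)
    then show ?thesis by (simp add: k_def)
  qed
  have div: "divergence (\<lambda>y. k n y *\<^sub>R T y) y = k n y * divergence T y" for n y
  proof -
    have "grad (k n) y \<bullet> T y = ?k' n y (T y)"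
      using grad_inner[OF C1k] frechet_derivative_at[OF dk] by metis
    then show ?thesis
      by (simp add: divergence_scaleR[OF C1k C1c_C1[OF T]] snd)
  qed
  have GG0: "GG s v G (\<lambda>y. k n y *\<^sub>R T y) = 0" for n
    by (rule admD(3)[OF adm s C1c_scaleR_right[OF C1k T]]) (simp add: k_def)
  have km [measurable]: "k n \<in> borel_measurable borel" for n
    by (rule C1_measurable[OF C1k])
  have lim: "(\<lambda>n. LINT y|lborel. k n y * g y) \<longlonglongrightarrow> (LINT y|lborel. g y)"
    if g: "integrable lborel g" and g0: "\<And>y. y \<notin> HB s \<Longrightarrow> g y = 0" for g
  proof (rule integral_dominated_convergence[where w = "\<lambda>y. norm (g y)"])
    have [measurable]: "g \<in> borel_measurable borel" using borel_measurable_integrable[OF g] by simp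
    show "(\<lambda>y. k n y * g y) \<in> borel_measurable lborel" for n by measurable
    show "AE y in lborel. (\<lambda>n. k n y * g y) \<longlonglongrightarrow> g y"
    proof (rule AE_I2)
      fix y show "(\<lambda>n. k n y * g y) \<longlonglongrightarrow> g y"
        using tendsto_mult_right[OF k_lim, of y "g y"] g0[of y] by (cases "y \<in> HB s") auto
    qed
    show "AE y in lborel. norm (k n y * g y) \<le> norm (g y)" for n
      using k_bounds[of n] by (intro AE_I2) (auto simp: abs_mult intro!: mult_left_le_one_le)
  qed (use g in auto)
  have "(\<lambda>n. GG s v G (\<lambda>y. k n y *\<^sub>R T y)) \<longlonglongrightarrow> GG s v G T"
    unfolding GG_def div
    using tendsto_add[OF lim[OF sq_integrable_inner[OF v C1c_divergence_sq_integrable[OF T]]]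
        lim[OF sq_integrable_inner[OF G C1c_sq_integrable[OF T]]]]
    by (simp add: mult_ac)
  then show ?thesis by (simp add: GG0 LIMSEQ_const_iff)
qed

text \<open>The field splits as X = T + V + W: T is its tangential part, V extends its normal
  component on the crack constantly along normals, and W vanishes on the crack. W contributes
  nothing by admissibility and T nothing by \<open>GG_tangential\<close>; V is divergence free in
  the half ball, so only the normal derivative paired with a function of x' remains, which is the
  integral of \<open>tr\<close>.\<close>

lemma GG_crack:
  assumes adm: "adm v G" and s: "s \<in> {1, -1}" and X: "X \<in> C1c UNIV"
  shows "GG s v G X = - s * (LINT x'|lborel. tr s G x' * snd (X (x', 0)))"
proof -
  note v = L2_on_HB[OF admD(1)[OF adm] s] and G = L2_on_HB[OF admD(2)[OF adm] s]
  let ?e = "(0, 1) :: 'a \<times> real"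
  define T where "T y = (fst (X y), 0 :: real)" for y
  have lin: "bounded_linear (\<lambda>p :: 'a \<times> real. (fst p, 0 :: real))"
    by (intro bounded_linear_Pair bounded_linear_fst bounded_linear_zero)
  obtain K where K: "compact K" "\<And>y. y \<notin> K \<Longrightarrow> X y = 0"
    using C1c_support[OF X] by auto
  have T: "T \<in> C1c UNIV"
    unfolding T_def
    by (rule C1cI[OF C1_compose_left[OF lin C1c_C1[OF X]] K(1)]) (auto simp: K(2) zero_prod_def)
  define g where "g y = snd (X (fst y, 0))" for y :: "'a \<times> real"
  have "C1 (\<lambda>y :: 'a \<times> real. X (fst y, 0))"
    by (rule C1_compose_right[OF lin C1c_C1[OF X]])
  then have C1g: "C1 g"
    unfolding g_def by (rule C1_compose_left[OF bounded_linear_snd])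
  \<comment> \<open>A cut-off in x_N alone gives V compact support; it equals 1 for |x_N| \<le> R,
    hence throughout the ball.\<close>
  define \<eta> where "\<eta> = cutoff (0::real) R"
  have C1\<eta>: "C1 (\<lambda>y :: 'a \<times> real. \<eta> (snd y))"
    unfolding \<eta>_def by (rule C1_compose_right[OF bounded_linear_snd C1c_C1[OF cutoff_C1c]])
  define V where "V y = (\<eta> (snd y) * g y) *\<^sub>R ?e" for y :: "'a \<times> real"
  obtain L where L: "compact L" "\<And>t. t \<notin> L \<Longrightarrow> \<eta> t = 0"
    using C1c_support[OF cutoff_C1c[of "0::real" R]] unfolding \<eta>_def by auto
  have V: "V \<in> C1c UNIV"
  proof (rule C1cI[where K = "(fst ` K) \<times> L"])
    show "C1 V" unfolding V_def by (intro C1_scaleR C1_mult C1\<eta> C1g C1_const)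
    show "compact (fst ` K \<times> L)"
      by (intro compact_Times compact_continuous_image K L continuous_intros)
    fix y :: "'a \<times> real" assume "y \<notin> fst ` K \<times> L"
    then have "(fst y, 0) \<notin> K \<or> snd y \<notin> L" by (auto simp: mem_Times_iff image_iff)
    then show "V y = 0" using K(2) L(2) by (auto simp: V_def g_def zero_prod_def)
  qed simp
  \<comment> \<open>V points in direction e_N and does not depend on x_N inside the half
    ball.\<close>
  have divV: "divergence V y = 0" if "y \<in> HB s" for y
  proof -
    have "divergence V y = frechet_derivative (\<lambda>y. \<eta> (snd y) * g y) (at y) ?e"
      unfolding V_def by (subst divergence_scaleR)
       (auto intro!: C1_mult C1\<eta> C1g C1_const simp: grad_inner[OF C1_mult[OF C1\<eta> C1g]] divergence_def)
    also have "\<dots> = 0"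
    proof -
      have "(\<lambda>_. 0) = frechet_derivative \<eta> (at (snd y))"
        unfolding \<eta>_def by (rule cutoff_derivative_zero[symmetric]) (use HB_snd[OF that] in simp)
      then have "(\<eta> has_derivative (\<lambda>_. 0)) (at (snd y))"
        using C1_has_derivative[OF C1c_C1[OF cutoff_C1c]] unfolding \<eta>_def by metis
      from diff_chain_at[OF bounded_linear_imp_has_derivative[OF bounded_linear_snd] this]
      have 1: "((\<lambda>y :: 'a \<times> real. \<eta> (snd y)) has_derivative (\<lambda>_. 0)) (at y)" by (simp add: o_def)
      have "(X has_derivative frechet_derivative X (at (fst y, 0))) (at (fst y, 0))"
        by (rule C1_has_derivative[OF C1c_C1[OF X]])
      from bounded_linear.has_derivative[OF bounded_linear_snd diff_chain_at[OF bounded_linear_imp_has_derivative[OF lin] this]]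
      have 2: "(g has_derivative (\<lambda>h. snd (frechet_derivative X (at (fst y, 0)) (fst h, 0)))) (at y)"
        by (simp add: g_def[abs_def] o_def)
      have "frechet_derivative X (at (fst y, 0)) (0, 0) = 0"
        using linear_0[OF has_derivative_linear[OF C1_has_derivative[OF C1c_C1[OF X]]]] by (simp add: zero_prod_def)
      then show ?thesis
        by (subst frechet_derivative_at[OF has_derivative_mult[OF 1 2], symmetric]) simp
    qed
    finally show ?thesis .
  qed
  have dX: "(\<lambda>y. X y - T y) \<in> C1c UNIV" by (rule C1c_diff[OF X T])
  have W: "(\<lambda>y. X y - T y - V y) \<in> C1c UNIV" by (rule C1c_diff[OF dX V])
  have "GG s v G (\<lambda>y. X y - T y - V y) = 0"
    by (rule admD(3)[OF adm s W])
      (auto simp: T_def V_def g_def \<eta>_def cutoff_eq_1 radius less_imp_le prod_eq_iff)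
  moreover have sub: "GG s v G (\<lambda>y. X y - Y y) = GG s v G X - GG s v G Y" if "X \<in> C1c UNIV" "Y \<in> C1c UNIV" for X Y
    using sq_integrable_inner[OF v C1c_divergence_sq_integrable[OF that(1)]] sq_integrable_inner[OF G C1c_sq_integrable[OF that(1)]]
      sq_integrable_inner[OF v C1c_divergence_sq_integrable[OF that(2)]] sq_integrable_inner[OF G C1c_sq_integrable[OF that(2)]]
    by (simp add: GG_def divergence_diff C1c_C1[OF that(1)] C1c_C1[OF that(2)] inner_diff_right right_diff_distrib del: inner_scaleR_left)
  ultimately have "GG s v G X = GG s v G T + GG s v G V"
    using sub[OF X T] sub[OF dX V] by simp
  also have "GG s v G T = 0"
    by (rule GG_tangential[OF adm s T]) (simp add: T_def)
  also have "GG s v G V = (LINT y|lborel. normal_part s G y * snd (X (fst y, 0)))"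
  proof -
    have "(indicator (HB s) y *\<^sub>R v y) \<bullet> divergence V y = 0" for y
      using divV by (auto simp: indicator_def)
    moreover have "(indicator (HB s) y *\<^sub>R G y) \<bullet> V y = normal_part s G y * snd (X (fst y, 0))" for y
      using HB_snd[of y s]
      by (auto simp: indicator_def normal_part_def V_def g_def \<eta>_def cutoff_eq_1 inner_prod_def)
    ultimately show ?thesis by (simp only: GG_def) simp
  qed
  also have "\<dots> = - s * (LINT x'|lborel. tr s G x' * snd (X (x', 0)))"
  proof -
    have "continuous_on UNIV (\<lambda>x'. snd (X (x', 0)))"
      by (rule continuous_on_snd, rule continuous_on_compose2[OF C1_continuous[OF C1c_C1[OF X]]])
        (auto intro!: continuous_intros)
    from integral_tr_mult(1)[OF admD(2)[OF adm] s this] show ?thesis using s by auto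
  qed
  finally show ?thesis by simp
qed

lemma tr_L2_on: 
  assumes "G \<in> L2_on lborel D" "s \<in> {1, -1}" shows "tr s G \<in> L2_on lborel (\<Gamma> c R)"
proof -
  have "(\<lambda>x'. indicator (\<Gamma> c R) x' *\<^sub>R tr s G x') = tr s G"
    by (auto simp: fun_eq_iff indicator_def tr_zero)
  then show ?thesis using tr_sq[OF assms] by (simp add: L2_on_iff)
qed

lemma adm_has_crack_trace:
  assumes adm: "adm v G" and s: "s \<in> {1, -1}"
  shows "has_crack_trace c R s v (tr s G)"
  unfolding has_crack_trace_def
proof (intro conjI ballI)
  show "tr s G \<in> L2_on lborel (\<Gamma> c R)"
    by (rule tr_L2_on[OF admD(2)[OF adm] s])
  fix X :: "'a \<times> real \<Rightarrow> 'a \<times> real" assume "X \<in> C1c (ball c R)"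
  then have X: "X \<in> C1c UNIV" by (rule C1c_mono) simp
  have "gauss_green_integral c R s v X = GG s v G X"
    by (rule gauss_green_integral_eq[OF admD(1)[OF adm] adm_L120(2)[OF adm] s X])
  also have "\<dots> = - s * (LINT x'|lborel. tr s G x' * snd (X (x', 0)))"
    by (rule GG_crack[OF adm s X])
  also have "(LINT x'|lborel. tr s G x' * snd (X (x', 0))) = (LINT x':\<Gamma> c R|lborel. tr s G x' * snd (X (x', 0)))"
    unfolding set_lebesgue_integral_def
    by (rule Bochner_Integration.integral_cong) (auto simp: indicator_def tr_zero)
  finally show "gauss_green_integral c R s v X = - s * (LINT x':\<Gamma> c R|lborel. tr s G x' * snd (X (x', 0)))" .
qed

text \<open>Crack traces are tested by fields on the ball, whereas their uniqueness is decided by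
  test functions on \<Gamma>; the extension links the two.\<close>

lemma extend_from_crack:
  assumes "\<psi> \<in> C1c (\<Gamma> c R)"
  obtains z :: "'a \<times> real \<Rightarrow> real" where "z \<in> C1c (ball c R)" "\<And>x'. z (x', 0) = \<psi> x'"
proof -
  obtain K where K: "compact K" "K \<subseteq> \<Gamma> c R" "\<And>x'. x' \<notin> K \<Longrightarrow> \<psi> x' = 0"
    using C1c_support[OF assms] by auto
  \<comment> \<open>The largest distance of \<open>K\<close> from the centre lies below
    \<open>R\<close> by compactness. The value R/2 covers an empty \<open>K\<close> and keeps r
    positive.\<close>
  obtain r where r: "0 < r" "r < R" "\<And>x'. x' \<in> K \<Longrightarrow> norm (x' - fst c) \<le> r"
  proof (cases "K = {}")
    case True
    then show ?thesis using that[of "R/2"] radius by auto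
  next
    case False
    obtain k where k: "k \<in> K" "\<And>x'. x' \<in> K \<Longrightarrow> norm (x' - fst c) \<le> norm (k - fst c)"
    proof -
      have "continuous_on K (\<lambda>x'. norm (x' - fst c))" by (intro continuous_intros)
      from continuous_attains_sup[OF K(1) False this] show ?thesis using that by blast
    qed
    have "norm (k - fst c) < R" using k(1) K(2) by (auto simp: Gamma_eq dist_norm norm_minus_commute)
    then show ?thesis
      using k(2) radius by (intro that[of "max (norm (k - fst c)) (R/2)"]) (auto simp: le_max_iff_disj)
  qed
  \<comment> \<open>This height gives r^2 + d^2 < R^2, so the cylinder over \<open>K\<close> of half
    height d stays inside the ball.\<close>
  define d where "d = sqrt ((R\<^sup>2 - r\<^sup>2) / 2)"
  have rR: "r\<^sup>2 < R\<^sup>2" using r(1,2) by (simp add: power_strict_mono)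
  then have d: "0 < d" "r\<^sup>2 + d\<^sup>2 < R\<^sup>2" by (auto simp: d_def field_simps)
  \<comment> \<open>Normalized to be 1 at height 0, so that the product restricts to \<psi> on the
    crack.\<close>
  define \<eta> where "\<eta> t = bump (- d) d t / bump (- d) d 0" for t :: real
  have b0: "bump (-d) d 0 > 0" using d(1) by (simp add: bump_pos_iff)
  have C1\<eta>: "C1 \<eta>"
    using C1_scaleR[OF C1_const[of "inverse (bump (-d) d 0)"] C1_bump[of "-d" d]]
    by (simp add: \<eta>_def[abs_def] divide_inverse mult.commute)
  show ?thesis
  proof (rule that[of "\<lambda>y. \<eta> (snd y) * \<psi> (fst y)"])
    show "(\<lambda>y. \<eta> (snd y) * \<psi> (fst y)) \<in> C1c (ball c R)"
    proof (rule C1cI[where K = "K \<times> {-d..d}"])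
      show "C1 (\<lambda>y :: 'a \<times> real. \<eta> (snd y) * \<psi> (fst y))"
        by (intro C1_mult C1_compose_right[OF bounded_linear_snd C1\<eta>] C1_compose_right[OF bounded_linear_fst C1c_C1[OF assms]])
      show "K \<times> {- d..d} \<subseteq> ball c R"
      proof
        fix y assume "y \<in> K \<times> {-d..d}"
        then have y: "norm (fst y - fst c) \<le> r" "\<bar>snd y\<bar> \<le> d" using r(3) by (auto simp: mem_Times_iff)
        have "(norm (fst y - fst c))\<^sup>2 \<le> r\<^sup>2" "(snd y)\<^sup>2 \<le> d\<^sup>2"
          using power_mono[OF y(1), of 2] power_mono[OF y(2), of 2] by auto
        then show "y \<in> ball c R"
          using mem_ball_iff[of "fst y" "snd y"] d(2) by simp
      qed
      fix y :: "'a \<times> real" assume "y \<notin> K \<times> {-d..d}"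
      then show "\<eta> (snd y) * \<psi> (fst y) = 0"
        using K(3) bump_zero[of "snd y" "-d" d] by (auto simp: \<eta>_def mem_Times_iff)
    qed (use K(1) in \<open>auto intro: compact_Times\<close>)
    show "\<eta> (snd (x', 0)) * \<psi> (fst (x', 0)) = \<psi> x'" for x' using b0 by (simp add: \<eta>_def)
  qed
qed

text \<open>Test fields z e_N with z extending an arbitrary test function on \<Gamma> reduce
  uniqueness of the trace to the fundamental lemma.\<close>

lemma crack_trace_AE:
  assumes tau: "has_crack_trace c R s v \<tau>" and s: "s \<in> {1, -1}"
  shows "has_crack_trace c R s v (crack_trace c R s v)"
    "AE x' in lborel. x' \<in> \<Gamma> c R \<longrightarrow> crack_trace c R s v x' = \<tau> x'"
proof -
  let ?t = "crack_trace c R s v"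
  show t: "has_crack_trace c R s v ?t"
    unfolding crack_trace_def by (rule someI[of "has_crack_trace c R s v", OF tau])
  have L2: "?t \<in> L2_on lborel (\<Gamma> c R)" "\<tau> \<in> L2_on lborel (\<Gamma> c R)"
    using t tau by (auto simp: has_crack_trace_def)
  have "AE x' in lborel. x' \<in> \<Gamma> c R \<longrightarrow> ?t x' - \<tau> x' = 0"
  proof (rule fundamental_lemma[OF Gamma_open])
    show "set_integrable lborel (\<Gamma> c R) (\<lambda>x'. ?t x' - \<tau> x')"
      by (intro set_integral_diff L2_on_set_integrable L2 Gamma_open Gamma_bounded)
    fix \<psi> :: "'a \<Rightarrow> real" assume \<psi>: "\<psi> \<in> C1c (\<Gamma> c R)"
    obtain z where z: "z \<in> C1c (ball c R)" "\<And>x'. z (x', 0) = \<psi> x'"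
      using extend_from_crack[OF \<psi>] by metis
    have "(\<lambda>y. z y *\<^sub>R (0 :: 'a, 1 :: real)) \<in> C1c (ball c R)"
      by (rule C1c_scaleR_left[OF z(1) C1_const])
    then have "- s * (LINT x':\<Gamma> c R|lborel. ?t x' * \<psi> x') = - s * (LINT x':\<Gamma> c R|lborel. \<tau> x' * \<psi> x')"
      using t tau z(2) unfolding has_crack_trace_def by fastforce
    then have "(LINT x':\<Gamma> c R|lborel. ?t x' * \<psi> x') = (LINT x':\<Gamma> c R|lborel. \<tau> x' * \<psi> x')"
      using s by auto
    then show "(LINT x':\<Gamma> c R|lborel. (?t x' - \<tau> x') * \<psi> x') = 0"
      using set_integral_diff(2)[OF L2_on_inner_set_integrable[OF L2(1) C1c_sq_integrable[OF \<psi>]]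
          L2_on_inner_set_integrable[OF L2(2) C1c_sq_integrable[OF \<psi>]]]
      by (simp add: left_diff_distrib)
  qed
  then show "AE x' in lborel. x' \<in> \<Gamma> c R \<longrightarrow> ?t x' = \<tau> x'" by simp
qed

end

section \<open>Recovering a function from its normal derivative\<close>

lemma continuous_antiderivative:
  fixes \<beta> :: "real \<Rightarrow> real"
  assumes "continuous_on UNIV \<beta>"
  obtains B where "\<And>t. (B has_real_derivative \<beta> t) (at t)" "B 0 = 0"
proof (rule that[of "\<lambda>t. LBINT u=0..t. \<beta> u"])
  fix t :: real
  \<comment> \<open>The margin 1 makes t an interior point, so the one-sided restriction in the
    derivative disappears.\<close>
  let ?M = "\<bar>t\<bar> + 1"
  have "((\<lambda>u. LBINT y=ereal 0..ereal u. \<beta> y) has_vector_derivative \<beta> t) (at t within {-?M..?M})"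
    by (rule interval_integral_FTC2) (use assms in \<open>auto intro: continuous_on_subset\<close>)
  moreover have "at t within {-?M..?M} = at t"
    by (rule at_within_interior) (auto simp: interior_atLeastAtMost_real)
  ultimately show "((\<lambda>t. LBINT u=0..t. \<beta> u) has_real_derivative \<beta> t) (at t)"
    by (simp add: has_real_derivative_iff_has_vector_derivative zero_ereal_def)
qed (simp add: zero_ereal_def)

lemma integral_between_zero:
  fixes \<beta> B :: "real \<Rightarrow> real"
  assumes \<beta>: "continuous_on UNIV \<beta>" and B: "\<And>t. (B has_real_derivative \<beta> t) (at t)" "B 0 = 0"
    and s: "s \<in> {1, -1}" and t: "0 < s * t"
  shows "(LINT x|lborel. indicator {x. 0 < s * x \<and> s * x < s * t} x * \<beta> x) = s * B t"
proof -
  have c: "isCont \<beta> x" for x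
    using \<beta> by (simp add: continuous_on_eq_continuous_at)
  have m [measurable]: "\<beta> \<in> borel_measurable borel"
    by (rule borel_measurable_continuous_onI[OF \<beta>])
  have AE: "AE x in lborel. x \<noteq> 0 \<and> x \<noteq> t"
    using AE_lborel_singleton[of "0::real"] AE_lborel_singleton[of t] by eventually_elim simp
  consider "s = 1" | "s = -1" using s by auto
  then show ?thesis
  proof cases
    case 1
    have "(LINT x|lborel. indicator {x. 0 < s * x \<and> s * x < s * t} x * \<beta> x) = (LINT x|lborel. \<beta> x * indicator {0..t} x)"
    proof (rule integral_cong_AE)
      show "AE x in lborel. indicator {x. 0 < s * x \<and> s * x < s * t} x * \<beta> x = \<beta> x * indicator {0..t} x"
        using AE by eventually_elim (auto simp: indicator_def 1)
    qed (use 1 in measurable)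
    then show ?thesis using integral_FTC_Icc_real[of 0 t B \<beta>] B c 1 t by simp
  next
    case 2
    have "(LINT x|lborel. indicator {x. 0 < s * x \<and> s * x < s * t} x * \<beta> x) = (LINT x|lborel. \<beta> x * indicator {t..0} x)"
    proof (rule integral_cong_AE)
      show "AE x in lborel. indicator {x. 0 < s * x \<and> s * x < s * t} x * \<beta> x = \<beta> x * indicator {t..0} x"
        using AE by eventually_elim (auto simp: indicator_def 2)
    qed (use 2 in measurable)
    then show ?thesis using integral_FTC_Icc_real[of t 0 B \<beta>] B c 2 t by simp
  qed
qed

context cracked_ball begin

text \<open>The integral of the normal derivative over the part of the normal line between y and the
  sphere. Up to the factor - s it is the value at y of a function that vanishes on the sphere; for y
  on the crack this is \<open>tr\<close>.\<close>

definition inward_integral :: "real \<Rightarrow> ('a \<times> real \<Rightarrow> 'a \<times> real) \<Rightarrow> 'a \<times> real \<Rightarrow> real" where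
  "inward_integral s G y = (LINT t|lborel. indicator {t. s * snd y < s * t} t * normal_part s G (fst y, t))"

lemma inward_integral_measurable:
  assumes "normal_part s G \<in> borel_measurable borel"
  shows "inward_integral s G \<in> borel_measurable borel"
proof -
  have p: "(\<lambda>p. (fst (fst p), snd p)) \<in> measurable borel (borel :: ('a \<times> real) measure)"
    by (intro borel_measurable_continuous_onI continuous_intros)
  have [measurable]: "(\<lambda>p :: ('a \<times> real) \<times> real. normal_part s G (fst (fst p), snd p)) \<in> borel_measurable borel"
    by (rule measurable_compose[OF p assms])
  have o: "open {p :: ('a \<times> real) \<times> real. s * snd (fst p) < s * snd p}"
    by (intro open_Collect_less continuous_intros)
  have e: "indicator {t. s * snd (fst p) < s * t} (snd p) = (indicator {p. s * snd (fst p) < s * snd p} p :: real)"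
    for p :: "('a \<times> real) \<times> real" by (simp add: indicator_def)
  have "(\<lambda>p :: ('a \<times> real) \<times> real. indicator {t. s * snd (fst p) < s * t} (snd p) *
      normal_part s G (fst (fst p), snd p)) \<in> borel_measurable borel"
    unfolding e using borel_open[OF o] by measurable
  from integral_slice_measurable[OF this] show ?thesis
    by (simp add: inward_integral_def[abs_def])
qed

text \<open>One factor 2 R comes from Cauchy-Schwarz on the normal line, the other from integrating
  a bound independent of x over |x| \<le> R.\<close>

lemma inward_integral_bound:
  assumes G: "G \<in> L2_on lborel D" and s: "s \<in> {1, -1}"
  shows "(\<integral>\<^sup>+ y. ennreal ((indicator (HB s) y * inward_integral s G y)\<^sup>2) \<partial>lborel) \<le>
    ennreal (4 * R\<^sup>2) * (\<integral>\<^sup>+ y. ennreal ((normal_part s G y)\<^sup>2) \<partial>lborel)"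
proof -
  have m [measurable]: "normal_part s G \<in> borel_measurable borel"
    using sq_integrable_measurable[OF normal_part_sq[OF G s]] by simp
  note [measurable] = inward_integral_measurable[OF m]
  define N where "N x' = (\<integral>\<^sup>+ t. ennreal ((normal_part s G (x', t))\<^sup>2) \<partial>lborel)" for x'
  have [measurable]: "N \<in> borel_measurable borel"
    using lborel.borel_measurable_nn_integral_fst[of "\<lambda>y. ennreal ((normal_part s G y)\<^sup>2)" lborel] m
    by (simp add: lborel_prod N_def[abs_def])
  have N: "(\<integral>\<^sup>+ x'. N x' \<partial>lborel) = (\<integral>\<^sup>+ y. ennreal ((normal_part s G y)\<^sup>2) \<partial>lborel)"
    unfolding N_def by (rule tonelli_lborel) measurable
  have "(\<integral>\<^sup>+ y. ennreal ((indicator (HB s) y * inward_integral s G y)\<^sup>2) \<partial>lborel) =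
      (\<integral>\<^sup>+ x'. \<integral>\<^sup>+ x. ennreal ((indicator (HB s) (x', x) * inward_integral s G (x', x))\<^sup>2) \<partial>lborel \<partial>lborel)"
    by (rule tonelli_lborel[symmetric]) measurable
  also have "\<dots> \<le> (\<integral>\<^sup>+ x'. \<integral>\<^sup>+ x. ennreal (2 * R) * N x' * indicator {-R..R} x \<partial>lborel \<partial>lborel)"
  proof (intro nn_integral_mono)
    fix x' x
    show "ennreal ((indicator (HB s) (x', x) * inward_integral s G (x', x))\<^sup>2) \<le> ennreal (2 * R) * N x' * indicator {-R..R} x"
    proof (cases "(x', x) \<in> HB s")
      case True
      have "indicator {-R..R} x = (1 :: ennreal)"
        using HB_snd[OF True] by (auto simp: indicator_def)
      moreover have "open {t. s * x < s * t}" by (intro open_Collect_less continuous_intros)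
      ultimately show ?thesis
        using line_Cauchy_Schwarz[OF slice_measurable[OF m] borel_open radius normal_part_far, of "{t. s * x < s * t}" x']
          True by (simp add: inward_integral_def N_def)
    qed simp
  qed
  also have "\<dots> = (\<integral>\<^sup>+ x'. ennreal (4 * R\<^sup>2) * N x' \<partial>lborel)"
  proof (rule nn_integral_cong)
    fix x'
    have "(\<integral>\<^sup>+ x. ennreal (2 * R) * N x' * indicator {-R..R} x \<partial>lborel) = ennreal (2 * R) * N x' * ennreal (2 * R)"
      using radius by (subst nn_integral_cmult_indicator) (auto simp: emeasure_lborel_Icc)
    also have "\<dots> = ennreal (2 * R) * ennreal (2 * R) * N x'" by (simp only: mult_ac)
    also have "ennreal (2 * R) * ennreal (2 * R) = ennreal (4 * R\<^sup>2)"
      using radius by (simp add: power2_eq_square flip: ennreal_mult)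
    finally show "(\<integral>\<^sup>+ x. ennreal (2 * R) * N x' * indicator {-R..R} x \<partial>lborel) = ennreal (4 * R\<^sup>2) * N x'" .
  qed
  also have "\<dots> = ennreal (4 * R\<^sup>2) * (\<integral>\<^sup>+ x'. N x' \<partial>lborel)"
    by (rule nn_integral_cmult) measurable
  finally show ?thesis by (simp only: N)
qed

lemma inward_integral_sq:
  assumes G: "G \<in> L2_on lborel D" and s: "s \<in> {1, -1}"
  shows "sq_integrable lborel (\<lambda>y. indicator (HB s) y * inward_integral s G y)"
proof -
  have m: "normal_part s G \<in> borel_measurable borel"
    using sq_integrable_measurable[OF normal_part_sq[OF G s]] by simp
  note [measurable] = inward_integral_measurable[OF m]
  have "ennreal (4 * R\<^sup>2) * (\<integral>\<^sup>+ y. ennreal ((normal_part s G y)\<^sup>2) \<partial>lborel) < \<infinity>"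
    using normal_part_sq[OF G s] by (simp add: sq_integrable_nn ennreal_mult_less_top)
  then show ?thesis
    unfolding sq_integrable_nn by (auto intro: le_less_trans[OF inward_integral_bound[OF G s]])
qed

text \<open>Moving towards the crack along a normal line only decreases |x_N|, so the segment does
  not leave the half ball. After the order of integration is exchanged, the inner domain is
  therefore a full interval starting at the crack.\<close>

lemma HB_downward:
  assumes "(x', t) \<in> HB s" "0 < s * x" "s * x < s * t" "s \<in> {1, -1}"
  shows "(x', x) \<in> HB s"
proof -
  have "\<bar>x\<bar> < \<bar>t\<bar>" using assms(2-4) by auto
  then have "x\<^sup>2 < t\<^sup>2"
    using power_strict_mono[of "\<bar>x\<bar>" "\<bar>t\<bar>" 2] by simp
  then show ?thesis
    using assms(1,2) mem_ball_iff[of x' x] mem_ball_iff[of x' t] by (auto simp: HB_eq half_space_def simp del: mem_ball)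
qed

text \<open>Exchanging the order on each normal line shows that the adjoint of integrating from y to
  the sphere is integrating from the crack to y. The latter applied to \<beta> gives s B, as B
  vanishes on the crack.\<close>

lemma integral_inward_integral:
  assumes G: "G \<in> L2_on lborel D" and s: "s \<in> {1, -1}"
    and \<alpha>: "\<alpha> \<in> borel_measurable borel" "\<And>x'. \<bar>\<alpha> x'\<bar> \<le> 1"
    and \<beta>: "continuous_on UNIV \<beta>" "\<And>t. \<bar>\<beta> t\<bar> \<le> 1"
    and B: "\<And>t. (B has_real_derivative \<beta> t) (at t)" "B 0 = 0"
  shows "(LINT y|lborel. \<alpha> (fst y) * \<beta> (snd y) * (indicator (HB s) y * inward_integral s G y)) =
    s * (LINT y|lborel. normal_part s G y * (\<alpha> (fst y) * B (snd y)))"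
proof -
  let ?F = "normal_part s G"
  have F: "integrable lborel ?F" by (rule normal_part_integrable[OF G s])
  have m [measurable]: "?F \<in> borel_measurable borel" using borel_measurable_integrable[OF F] by simp
  have [measurable]: "\<beta> \<in> borel_measurable borel" by (rule borel_measurable_continuous_onI[OF \<beta>(1)])
  have Bc: "continuous_on UNIV B"
    using B(1) by (meson DERIV_isCont continuous_at_imp_continuous_on)
  have [measurable]: "B \<in> borel_measurable borel" by (rule borel_measurable_continuous_onI[OF Bc])
  note [measurable] = \<alpha>(1) inward_integral_measurable[OF m]
  obtain M where M: "\<And>t. \<bar>t\<bar> \<le> R \<Longrightarrow> \<bar>B t\<bar> \<le> M"
  proof -
    have "compact (B ` {-R..R})"
      by (intro compact_continuous_image continuous_on_subset[OF Bc]) auto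
    from compact_imp_bounded[OF this] obtain M where M: "\<forall>t\<in>{-R..R}. \<bar>B t\<bar> \<le> M"
      by (auto simp: bounded_iff)
    show ?thesis by (rule that[of M]) (use M in \<open>auto simp: abs_le_iff\<close>)
  qed
  let ?l = "\<lambda>y. \<alpha> (fst y) * \<beta> (snd y) * (indicator (HB s) y * inward_integral s G y)"
  let ?r = "\<lambda>y. ?F y * (\<alpha> (fst y) * B (snd y))"
  have "integrable lborel (\<lambda>y. indicator (HB s) y * inward_integral s G y)"
  proof -
    have e: "(\<lambda>y. indicator (HB s) y *\<^sub>R inward_integral s G y) = (\<lambda>y. indicator (HB s) y * inward_integral s G y)" by simp
    have "inward_integral s G \<in> L2_on lborel (HB s)"
      unfolding L2_on_iff e by (rule inward_integral_sq[OF G s])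
    from L2_on_set_integrable[OF this HB_bounded HB_open] show ?thesis
      by (simp add: set_integrable_def)
  qed
  then have il: "integrable lborel ?l"
  proof (rule Bochner_Integration.integrable_bound)
    show "AE y in lborel. norm (?l y) \<le> norm (indicator (HB s) y * inward_integral s G y)"
      using \<alpha>(2) \<beta>(2) by (intro AE_I2) (auto simp: abs_mult mult_le_one intro!: mult_left_le_one_le)
  qed measurable
  have "integrable lborel (\<lambda>y. M * ?F y)" using F by simp
  then have ir: "integrable lborel ?r"
  proof (rule Bochner_Integration.integrable_bound)
    show "AE y in lborel. norm (?r y) \<le> norm (M * ?F y)"
    proof (rule AE_I2)
      fix y
      show "norm (?r y) \<le> norm (M * ?F y)"
      proof (cases "y \<in> HB s")
        case True
        then have "\<bar>B (snd y)\<bar> \<le> M" using HB_snd[OF True] M by simp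
        then have "\<bar>\<alpha> (fst y)\<bar> * \<bar>B (snd y)\<bar> \<le> 1 * \<bar>M\<bar>"
          using \<alpha>(2) by (intro mult_mono) auto
        then have "\<bar>?F y\<bar> * (\<bar>\<alpha> (fst y)\<bar> * \<bar>B (snd y)\<bar>) \<le> \<bar>?F y\<bar> * \<bar>M\<bar>"
          by (intro mult_left_mono) auto
        then show ?thesis by (simp add: abs_mult mult.commute)
      qed (simp add: normal_part_zero)
    qed
  qed measurable
  \<comment> \<open>The exchange is justified line by line, and only on lines where the normal
    derivative is integrable.\<close>
  have "AE x' in lborel. integrable lborel (\<lambda>t. ?F (x', t))"
    using lborel_pair.AE_integrable_fst'[of ?F] F by (simp add: lborel_prod)
  then have inner: "AE x' in lborel. (LINT x|lborel. ?l (x', x)) = (LINT t|lborel. s * ?r (x', t))"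
  proof eventually_elim
    case (elim x')
    \<comment> \<open>The double integrand on one line, x being the evaluation point and t the point
      where the derivative is taken; it is dominated by the indicator of [-R, R] in x times |?F (x',
      t)|.\<close>
    let ?I = "\<lambda>x t. \<beta> x * indicator (HB s) (x', x) * (indicator {t. s * x < s * t} t * ?F (x', t))"
    have [measurable]: "(\<lambda>t. ?F (x', t)) \<in> borel_measurable borel" by (rule slice_measurable[OF m])
    have [measurable]: "(\<lambda>x. indicator (HB s) (x', x) :: real) \<in> borel_measurable borel"
      by (rule slice_measurable) measurable
    have o: "open {p :: real \<times> real. s * fst p < s * snd p}"
      by (intro open_Collect_less continuous_intros)
    have e: "indicator {t. s * fst p < s * t} (snd p) = (indicator {p. s * fst p < s * snd p} p :: real)" for p :: "real \<times> real"
      by (simp add: indicator_def)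
    have im: "(\<lambda>p. ?I (fst p) (snd p)) \<in> borel_measurable borel"
      unfolding e using borel_open[OF o] by measurable
    have "integrable lborel (\<lambda>p :: real \<times> real. indicator {-R..R} (fst p) * ?F (x', snd p))"
    proof -
      have pm: "(\<lambda>p :: real \<times> real. indicator {-R..R} (fst p) * ?F (x', snd p)) \<in> borel_measurable borel"
        by measurable
      have "integrable (lborel \<Otimes>\<^sub>M lborel) (\<lambda>p :: real \<times> real. indicator {-R..R} (fst p) * ?F (x', snd p))"
      proof (rule lborel_pair.Fubini_integrable)
        show "(\<lambda>p :: real \<times> real. indicator {-R..R} (fst p) * ?F (x', snd p)) \<in> borel_measurable (lborel \<Otimes>\<^sub>M lborel)"
          using pm by (simp add: lborel_prod)
        have "integrable lborel (\<lambda>x. indicator {-R..R} x * (LINT t|lborel. \<bar>?F (x', t)\<bar>))"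
          using radius
          by (intro integrable_mult_left integrable_real_indicator) (auto simp: emeasure_lborel_Icc)
        then show "integrable lborel (\<lambda>x :: real. LINT t|lborel. norm (indicator {-R..R} (fst (x, t)) * ?F (x', snd (x, t))))"
          by (simp add: abs_mult)
      qed (use elim in simp)
      then show ?thesis by (simp add: lborel_prod)
    qed
    then have "integrable lborel (\<lambda>p. ?I (fst p) (snd p))"
    proof (rule Bochner_Integration.integrable_bound)
      show "AE p in lborel. norm (?I (fst p) (snd p)) \<le> norm (indicator {-R..R} (fst p) * ?F (x', snd p))"
      proof (rule AE_I2)
        fix p :: "real \<times> real"
        show "norm (?I (fst p) (snd p)) \<le> norm (indicator {-R..R} (fst p) * ?F (x', snd p))"
          using HB_snd[of "(x', fst p)" s] \<beta>(2)[of "fst p"]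
          by (auto simp: indicator_def abs_mult intro!: mult_left_le_one_le)
      qed
    qed (use im in simp)
    then have int: "integrable (lborel \<Otimes>\<^sub>M lborel) (case_prod ?I)"
      by (simp add: lborel_prod case_prod_unfold)
    have "(LINT x|lborel. ?l (x', x)) = \<alpha> x' * (LINT x|lborel. LINT t|lborel. ?I x t)"
      by (simp add: inward_integral_def mult.assoc)
    also have "(LINT x|lborel. LINT t|lborel. ?I x t) = (LINT t|lborel. LINT x|lborel. ?I x t)"
      by (rule lborel_pair.Fubini_integral[OF int, symmetric])
    also have "\<dots> = (LINT t|lborel. s * B t * ?F (x', t))"
    proof (rule Bochner_Integration.integral_cong[OF refl])
      fix t
      show "(LINT x|lborel. ?I x t) = s * B t * ?F (x', t)"
      proof (cases "(x', t) \<in> HB s")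
        case True
        then have t: "0 < s * t" by (simp add: half_ball_def)
        have "(LINT x|lborel. ?I x t) = (LINT x|lborel. indicator {x. 0 < s * x \<and> s * x < s * t} x * \<beta> x * ?F (x', t))"
        proof (rule Bochner_Integration.integral_cong[OF refl])
          fix x
          show "?I x t = indicator {x. 0 < s * x \<and> s * x < s * t} x * \<beta> x * ?F (x', t)"
            using HB_downward[OF True _ _ s, of x] by (auto simp: indicator_def half_ball_def)
        qed
        also have "\<dots> = s * B t * ?F (x', t)"
          using integral_between_zero[OF \<beta>(1) B s t] by simp
        finally show ?thesis .
      qed (simp add: normal_part_zero)
    qed
    also have "\<alpha> x' * \<dots> = (LINT t|lborel. \<alpha> x' * (s * B t * ?F (x', t)))" by simp
    also have "\<dots> = (LINT t|lborel. s * ?r (x', t))"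
      by (rule Bochner_Integration.integral_cong) (auto simp: mult_ac)
    finally show ?case .
  qed
  have "(LINT y|lborel. ?l y) = (LINT x'|lborel. LINT x|lborel. ?l (x', x))"
    by (rule fubini_lborel[OF il])
  also have "\<dots> = (LINT x'|lborel. LINT t|lborel. s * ?r (x', t))"
  proof (rule integral_cong_AE[OF _ _ inner])
    show "(\<lambda>x'. LINT x|lborel. ?l (x', x)) \<in> borel_measurable lborel"
      using integral_slice_measurable[of ?l] by measurable
    show "(\<lambda>x'. LINT t|lborel. s * ?r (x', t)) \<in> borel_measurable lborel"
      using integral_slice_measurable[of "\<lambda>y. s * ?r y"] by measurable
  qed
  also have "\<dots> = s * (LINT x'|lborel. LINT t|lborel. ?r (x', t))" by simp
  also have "(LINT x'|lborel. LINT t|lborel. ?r (x', t)) = (LINT y|lborel. ?r y)"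
    by (rule fubini_lborel[OF ir, symmetric])
  finally show ?thesis .
qed


text \<open>The test field \<alpha>(x') B(x_N) e_N, with B an antiderivative of \<beta>, has
  divergence \<alpha>(x') \<beta>(x_N) on the half ball. Admissibility expresses the integral of
  \<alpha> \<beta> v through the normal derivative, \<open>integral_inward_integral\<close> does the
  same for the inward integral, and products \<alpha> \<beta> separate functions.\<close>

lemma adm_eq_inward_integral:
  assumes adm: "adm v G" and s: "s \<in> {1, -1}"
  shows "AE y in lborel. y \<in> HB s \<longrightarrow> v y = - s * inward_integral s G y"
proof -
  let ?e = "(0, 1) :: 'a \<times> real"
  note v = L2_on_HB[OF admD(1)[OF adm] s] and G = L2_on_HB[OF admD(2)[OF adm] s]
  note I = inward_integral_sq[OF admD(2)[OF adm] s]
  let ?v = "\<lambda>y. indicator (HB s) y * v y" and ?I = "\<lambda>y. indicator (HB s) y * inward_integral s G y"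
  have int: "integrable lborel (\<lambda>y. indicator (HB s) y * f y)"
    if "sq_integrable lborel (\<lambda>y. indicator (HB s) y * f y)" for f :: "'a \<times> real \<Rightarrow> real"
  proof -
    have "f \<in> L2_on lborel (HB s)" using that by (simp add: L2_on_iff)
    from L2_on_set_integrable[OF this HB_bounded HB_open] show ?thesis by (simp add: set_integrable_def)
  qed
  have iv: "integrable lborel ?v" using int[of v] v by simp
  have iI: "integrable lborel ?I" by (rule int[OF I])
  have "AE y in lborel. ?v y + s * ?I y = 0"
  proof (rule AE_zero_if_product_box_approx)
    show "integrable lborel (\<lambda>y. ?v y + s * ?I y)" using iv iI by simp
    fix a b :: 'a and p q :: real and n :: nat
    let ?\<alpha> = "box_approx a b n" and ?\<beta> = "box_approx p q n"
    have \<beta>c: "continuous_on UNIV ?\<beta>" by (rule C1_continuous[OF C1_box_approx])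
    \<comment> \<open>The normalization B 0 = 0 makes the field vanish on the crack, as admissible
      test fields must, while \<beta> stays unconstrained there.\<close>
    obtain B where B: "\<And>t. (B has_real_derivative ?\<beta> t) (at t)" "B 0 = 0"
      using continuous_antiderivative[OF \<beta>c] by blast
    have C1B: "C1 (\<lambda>y :: 'a \<times> real. B (snd y))"
      by (rule C1_compose_real[OF C1_bounded_linear[OF bounded_linear_snd] B(1) \<beta>c])
    have C1\<alpha>: "C1 (\<lambda>y :: 'a \<times> real. ?\<alpha> (fst y))"
      by (rule C1_compose_right[OF bounded_linear_fst C1_box_approx])
    have C1h: "C1 (\<lambda>y :: 'a \<times> real. ?\<alpha> (fst y) * B (snd y))" by (rule C1_mult[OF C1\<alpha> C1B])
    define h where "h y = ?\<alpha> (fst y) * B (snd y) * cutoff c R y" for y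
    have hc: "h \<in> C1c UNIV"
      unfolding h_def by (rule C1c_mult_right[OF C1h cutoff_C1c])
    have X: "(\<lambda>y. h y *\<^sub>R ?e) \<in> C1c UNIV" by (rule C1c_scaleR_left[OF hc C1_const])
    have div: "divergence (\<lambda>y. h y *\<^sub>R ?e) y = ?\<alpha> (fst y) * ?\<beta> (snd y)" if y: "y \<in> HB s" for y
    proof -
      have yb: "norm (y - c) < R" using y by (simp add: HB_eq dist_norm norm_minus_commute)
      have 1: "(cutoff c R has_derivative (\<lambda>_. 0)) (at y)"
        using C1_has_derivative[OF C1c_C1[OF cutoff_C1c]] cutoff_derivative_zero[OF yb] by metis
      have 2: "((\<lambda>y. ?\<alpha> (fst y)) has_derivative (\<lambda>h. frechet_derivative ?\<alpha> (at (fst y)) (fst h))) (at y)"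
        using diff_chain_at[OF bounded_linear_imp_has_derivative[OF bounded_linear_fst] C1_has_derivative[OF C1_box_approx]]
        by (simp add: o_def)
      have 3: "((\<lambda>y. B (snd y)) has_derivative (\<lambda>h. ?\<beta> (snd y) * snd h)) (at y)"
        using diff_chain_at[OF bounded_linear_imp_has_derivative[OF bounded_linear_snd] B(1)[of "snd y", unfolded has_field_derivative_def]]
        by (simp add: o_def)
      have 0: "frechet_derivative ?\<alpha> (at (fst y)) 0 = 0"
        by (rule linear_0[OF has_derivative_linear[OF C1_has_derivative[OF C1_box_approx]]])
      have "frechet_derivative h (at y) ?e = ?\<alpha> (fst y) * ?\<beta> (snd y)"
        unfolding h_def
        by (subst frechet_derivative_at[OF has_derivative_mult[OF has_derivative_mult[OF 2 3] 1], symmetric])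
          (simp add: 0 cutoff_eq_1 less_imp_le[OF yb])
      then show ?thesis
        by (subst divergence_scaleR[OF C1c_C1[OF hc] C1_const])
          (simp add: grad_inner[OF C1c_C1[OF hc]] divergence_def)
    qed
    have "GG s v G (\<lambda>y. h y *\<^sub>R ?e) = 0"
      by (rule admD(3)[OF adm s X]) (simp add: h_def B(2) zero_prod_def)
    moreover have "(indicator (HB s) y *\<^sub>R v y) \<bullet> divergence (\<lambda>y. h y *\<^sub>R ?e) y = ?\<alpha> (fst y) * ?\<beta> (snd y) * ?v y" for y
      using div[of y] by (auto simp: indicator_def)
    moreover have "(indicator (HB s) y *\<^sub>R G y) \<bullet> (h y *\<^sub>R ?e) = normal_part s G y * (?\<alpha> (fst y) * B (snd y))" for y
      by (auto simp: indicator_def normal_part_def h_def inner_prod_def HB_eq cutoff_eq_1 dist_norm norm_minus_commute)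
    ultimately have 1: "(LINT y|lborel. ?\<alpha> (fst y) * ?\<beta> (snd y) * ?v y) =
        - (LINT y|lborel. normal_part s G y * (?\<alpha> (fst y) * B (snd y)))"
      by (simp only: GG_def)
    have 2: "(LINT y|lborel. ?\<alpha> (fst y) * ?\<beta> (snd y) * ?I y) =
        s * (LINT y|lborel. normal_part s G y * (?\<alpha> (fst y) * B (snd y)))"
      by (rule integral_inward_integral[OF admD(2)[OF adm] s _ _ \<beta>c _ B])
        (auto simp: box_approx_bounds abs_of_nonneg)
    have bd: "integrable lborel (\<lambda>y. ?\<alpha> (fst y) * ?\<beta> (snd y) * f y)" if f: "integrable lborel f" for f :: "'a \<times> real \<Rightarrow> real"
    proof (rule Bochner_Integration.integrable_bound[OF f])
      have [measurable]: "f \<in> borel_measurable borel" using borel_measurable_integrable[OF f] by simp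
      show "(\<lambda>y. ?\<alpha> (fst y) * ?\<beta> (snd y) * f y) \<in> borel_measurable lborel" by measurable
      show "AE y in lborel. norm (?\<alpha> (fst y) * ?\<beta> (snd y) * f y) \<le> norm (f y)"
        by (intro AE_I2) (auto simp: abs_mult box_approx_bounds abs_of_nonneg intro!: mult_left_le_one_le mult_le_one)
    qed
    have "(LINT y|lborel. ?\<alpha> (fst y) * ?\<beta> (snd y) * (?v y + s * ?I y)) =
       (LINT y|lborel. ?\<alpha> (fst y) * ?\<beta> (snd y) * ?v y + s * (?\<alpha> (fst y) * ?\<beta> (snd y) * ?I y))"
      by (rule Bochner_Integration.integral_cong) (auto simp: algebra_simps)
    also have "\<dots> = (LINT y|lborel. ?\<alpha> (fst y) * ?\<beta> (snd y) * ?v y) + s * (LINT y|lborel. ?\<alpha> (fst y) * ?\<beta> (snd y) * ?I y)"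
      using bd[OF iv] bd[OF iI] by (simp only: Bochner_Integration.integral_add integrable_mult_right integral_mult_right_zero)
    also have "\<dots> = 0" unfolding 1 2 using s by auto
    finally show "(LINT y|lborel. ?\<alpha> (fst y) * ?\<beta> (snd y) * (?v y + s * ?I y)) = 0" .
  qed
  then show ?thesis
    by eventually_elim (auto simp: indicator_def split: if_splits)
qed

section \<open>Poincare inequality, closedness and projection\<close>

lemma indicator_HB_norm_le: 
  assumes "s \<in> {1, -1}"
  shows "norm (indicator (HB s) y *\<^sub>R g y) \<le> norm (indicator D y *\<^sub>R g y)"
  using HB_subset_D[OF assms] by (auto simp: indicator_def)

text \<open>On each half ball the function is an inward integral, whence the constant 4 R^2; each
  half is compared with the gradient on all of \<open>D\<close>, which doubles it.\<close>

lemma Poincare: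
  assumes adm: "adm v G"
  shows "(LINT y|lborel. (norm (indicator D y *\<^sub>R v y))\<^sup>2) \<le> 8 * R\<^sup>2 * (LINT y|lborel. (norm (indicator D y *\<^sub>R G y))\<^sup>2)"
proof -
  note v = admD(1)[OF adm] and G = admD(2)[OF adm]
  have half: "(LINT y|lborel. (norm (indicator (HB s) y *\<^sub>R v y))\<^sup>2) \<le> 4 * R\<^sup>2 * (LINT y|lborel. (norm (indicator D y *\<^sub>R G y))\<^sup>2)"
    if s: "s \<in> {1, -1}" for s
  proof -
    let ?I = "\<lambda>y. indicator (HB s) y * inward_integral s G y"
    note sn = normal_part_sq[OF G s]
    note [measurable] = sq_integrable_measurable[OF L2_on_HB[OF v s]] sq_integrable_measurable[OF inward_integral_sq[OF G s]]
    have "(LINT y|lborel. (norm (indicator (HB s) y *\<^sub>R v y))\<^sup>2) = (LINT y|lborel. (?I y)\<^sup>2)"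
    proof (rule integral_cong_AE)
      show "AE y in lborel. (norm (indicator (HB s) y *\<^sub>R v y))\<^sup>2 = (?I y)\<^sup>2"
        using adm_eq_inward_integral[OF adm s] by eventually_elim (use s in \<open>auto simp: indicator_def\<close>)
    qed measurable
    also have "\<dots> \<le> 4 * R\<^sup>2 * (LINT y|lborel. (normal_part s G y)\<^sup>2)"
    proof (rule integral_le_if_nn_integral_le(2))
      have i: "integrable lborel (\<lambda>y. (normal_part s G y)\<^sup>2)" using sq_integrableD[OF sn] by simp
      show "(\<integral>\<^sup>+ y. ennreal ((?I y)\<^sup>2) \<partial>lborel) \<le> ennreal (4 * R\<^sup>2 * (LINT y|lborel. (normal_part s G y)\<^sup>2))"
      proof -
        have "(\<integral>\<^sup>+ y. ennreal ((normal_part s G y)\<^sup>2) \<partial>lborel) = ennreal (LINT y|lborel. (normal_part s G y)\<^sup>2)"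
          by (rule nn_integral_eq_integral[OF i]) auto
        then show ?thesis using inward_integral_bound[OF G s] by (simp add: ennreal_mult)
      qed
    qed auto
    also have "\<dots> \<le> 4 * R\<^sup>2 * (LINT y|lborel. (norm (indicator D y *\<^sub>R G y))\<^sup>2)"
    proof (intro mult_left_mono integral_mono_AE)
      show "integrable lborel (\<lambda>y. (normal_part s G y)\<^sup>2)" using sq_integrableD[OF sn] by simp
      show "integrable lborel (\<lambda>y. (norm (indicator D y *\<^sub>R G y))\<^sup>2)"
        using sq_integrableD[OF G[unfolded L2_on_iff]] by simp
      show "AE y in lborel. (normal_part s G y)\<^sup>2 \<le> (norm (indicator D y *\<^sub>R G y))\<^sup>2"
      proof (rule AE_I2)
        fix y
        have "\<bar>normal_part s G y\<bar> \<le> norm (indicator (HB s) y *\<^sub>R G y)"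
          using norm_snd_le[of "snd (G y)" "fst (G y)"] by (simp add: normal_part_def abs_mult mult_left_mono)
        also have "\<dots> \<le> norm (indicator D y *\<^sub>R G y)" by (rule indicator_HB_norm_le[OF s])
        finally show "(normal_part s G y)\<^sup>2 \<le> (norm (indicator D y *\<^sub>R G y))\<^sup>2"
          using power_mono[of "\<bar>normal_part s G y\<bar>" _ 2] by simp
      qed
    qed auto
    finally show ?thesis .
  qed
  have "(norm (indicator D y *\<^sub>R v y))\<^sup>2 = (norm (indicator (HB 1) y *\<^sub>R v y))\<^sup>2 + (norm (indicator (HB (-1)) y *\<^sub>R v y))\<^sup>2" for y
    using HB_disjoint D_eq by (auto simp: indicator_def)
  then have "(LINT y|lborel. (norm (indicator D y *\<^sub>R v y))\<^sup>2) =
     (LINT y|lborel. (norm (indicator (HB 1) y *\<^sub>R v y))\<^sup>2) + (LINT y|lborel. (norm (indicator (HB (-1)) y *\<^sub>R v y))\<^sup>2)"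
    using sq_integrableD[OF L2_on_HB[OF v, of 1]] sq_integrableD[OF L2_on_HB[OF v, of "-1"]]
    by (simp only: Bochner_Integration.integral_add insert_iff simp_thms)
  then show ?thesis using half[of 1] half[of "-1"] by simp
qed

lemma GG_tendsto:
  assumes v: "\<And>n. v n \<in> L2_on lborel D" "v' \<in> L2_on lborel D" and G: "\<And>n. G n \<in> L2_on lborel D" "G' \<in> L2_on lborel D"
    and limv: "(\<lambda>n. LINT y|lborel. (norm (indicator D y *\<^sub>R v n y - indicator D y *\<^sub>R v' y))\<^sup>2) \<longlonglongrightarrow> 0"
    and limG: "(\<lambda>n. LINT y|lborel. (norm (indicator D y *\<^sub>R G n y - indicator D y *\<^sub>R G' y))\<^sup>2) \<longlonglongrightarrow> 0"
    and s: "s \<in> {1, -1}" and X: "X \<in> C1c UNIV"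
  shows "(\<lambda>n. GG s (v n) (G n) X) \<longlonglongrightarrow> GG s v' G' X"
proof -
  have half: "(\<lambda>n. LINT y|lborel. (norm (indicator (HB s) y *\<^sub>R f n y - indicator (HB s) y *\<^sub>R g y))\<^sup>2) \<longlonglongrightarrow> 0"
    if f: "\<And>n. f n \<in> L2_on lborel D" "g \<in> L2_on lborel D"
      and lim: "(\<lambda>n. LINT y|lborel. (norm (indicator D y *\<^sub>R f n y - indicator D y *\<^sub>R g y))\<^sup>2) \<longlonglongrightarrow> 0"
    for f and g :: "'a \<times> real \<Rightarrow> 'b::euclidean_space"
  proof (rule Lim_null_comparison[OF always_eventually lim], rule allI)
    fix n
    have "(LINT y|lborel. (norm (indicator (HB s) y *\<^sub>R f n y - indicator (HB s) y *\<^sub>R g y))\<^sup>2) \<le>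
        (LINT y|lborel. (norm (indicator D y *\<^sub>R f n y - indicator D y *\<^sub>R g y))\<^sup>2)"
    proof (rule integral_mono_AE)
      show "integrable lborel (\<lambda>y. (norm (indicator (HB s) y *\<^sub>R f n y - indicator (HB s) y *\<^sub>R g y))\<^sup>2)"
        by (rule sq_integrableD[OF sq_integrable_diff[OF L2_on_HB[OF f(1) s] L2_on_HB[OF f(2) s]]])
      show "integrable lborel (\<lambda>y. (norm (indicator D y *\<^sub>R f n y - indicator D y *\<^sub>R g y))\<^sup>2)"
        by (rule sq_integrableD[OF sq_integrable_diff[OF f(1)[unfolded L2_on_iff] f(2)[unfolded L2_on_iff]]])
      show "AE y in lborel. (norm (indicator (HB s) y *\<^sub>R f n y - indicator (HB s) y *\<^sub>R g y))\<^sup>2 \<le>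
        (norm (indicator D y *\<^sub>R f n y - indicator D y *\<^sub>R g y))\<^sup>2"
        using indicator_HB_norm_le[OF s, of _ "\<lambda>y. f n y - g y"]
        by (intro AE_I2 power_mono) (auto simp: scaleR_diff_right)
    qed
    then show "norm (LINT y|lborel. (norm (indicator (HB s) y *\<^sub>R f n y - indicator (HB s) y *\<^sub>R g y))\<^sup>2) \<le>
        (LINT y|lborel. (norm (indicator D y *\<^sub>R f n y - indicator D y *\<^sub>R g y))\<^sup>2)" by simp
  qed
  show ?thesis
    unfolding GG_def
    by (intro tendsto_add tendsto_integral_inner L2_on_HB v G s half limv limG
        C1c_divergence_sq_integrable[OF X] C1c_sq_integrable[OF X])
qed

lemma integral_norm_square_restrict_le:
  fixes f g :: "'a \<times> real \<Rightarrow> 'b::euclidean_space"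
  assumes "sq_integrable lborel f" "sq_integrable lborel g"
  shows "(LINT y|lborel. (norm (indicator D y *\<^sub>R f y - indicator D y *\<^sub>R g y))\<^sup>2) \<le> (LINT y|lborel. (norm (f y - g y))\<^sup>2)"
proof (rule integral_mono_AE')
  show "integrable lborel (\<lambda>y. (norm (f y - g y))\<^sup>2)"
    by (rule sq_integrableD[OF sq_integrable_diff[OF assms]])
qed (auto simp: indicator_def)

lemma sq_integrable_restrict:
  fixes f :: "'a \<times> real \<Rightarrow> 'b::euclidean_space"
  assumes "sq_integrable lborel f" 
  shows "f \<in> L2_on lborel D" "sq_integrable lborel (\<lambda>y. indicator D y *\<^sub>R f y)"
proof -
  note [measurable] = sq_integrable_measurable[OF assms]
  show "sq_integrable lborel (\<lambda>y. indicator D y *\<^sub>R f y)"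
    by (rule sq_integrable_bound[OF assms]) (measurable, auto simp: indicator_def)
  then show "f \<in> L2_on lborel D" by (simp add: L2_on_iff)
qed

text \<open>Convergence of the gradients makes the functions a Cauchy sequence by the Poincare
  inequality. The defining identity is continuous in both arguments, so the two limits form an
  admissible pair.\<close>

lemma adm_closed:
  assumes adm: "\<And>n. adm (v n) (F n)" and F: "\<And>n. sq_integrable lborel (F n)" and G: "sq_integrable lborel G"
    and lim: "(\<lambda>n. LINT y|lborel. (norm (F n y - G y))\<^sup>2) \<longlonglongrightarrow> 0"
  obtains v' where "adm v' G"
proof -
  let ?v = "\<lambda>n y. indicator D y *\<^sub>R v n y"
  have sv: "sq_integrable lborel (?v n)" for n
    using admD(1)[OF adm] by (simp only: L2_on_iff)
  have diff: "(LINT y|lborel. (norm (?v m y - ?v n y))\<^sup>2) \<le>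
      8 * R\<^sup>2 * (2 * (LINT y|lborel. (norm (F m y - G y))\<^sup>2) + 2 * (LINT y|lborel. (norm (F n y - G y))\<^sup>2))" for m n
  proof -
    have a: "adm (\<lambda>y. v m y + - 1 * v n y) (\<lambda>y. F m y + - 1 *\<^sub>R F n y)"
      by (rule adm_add[OF adm adm])
    have "(LINT y|lborel. (norm (?v m y - ?v n y))\<^sup>2) \<le> 8 * R\<^sup>2 * (LINT y|lborel. (norm (indicator D y *\<^sub>R F m y - indicator D y *\<^sub>R F n y))\<^sup>2)"
      using Poincare[OF a] by (simp add: scaleR_diff_right right_diff_distrib)
    also have "\<dots> \<le> 8 * R\<^sup>2 * (LINT y|lborel. (norm (F m y - F n y))\<^sup>2)"
      by (intro mult_left_mono integral_norm_square_restrict_le F) auto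
    also have "(LINT y|lborel. (norm (F m y - F n y))\<^sup>2) \<le>
        (LINT y|lborel. 2 * (norm (F m y - G y))\<^sup>2 + 2 * (norm (F n y - G y))\<^sup>2)"
    proof (rule integral_mono_AE)
      show "integrable lborel (\<lambda>y. (norm (F m y - F n y))\<^sup>2)"
        by (rule sq_integrableD[OF sq_integrable_diff[OF F F]])
      show "integrable lborel (\<lambda>y. 2 * (norm (F m y - G y))\<^sup>2 + 2 * (norm (F n y - G y))\<^sup>2)"
        using sq_integrableD[OF sq_integrable_diff[OF F G]] by simp
      show "AE y in lborel. (norm (F m y - F n y))\<^sup>2 \<le> 2 * (norm (F m y - G y))\<^sup>2 + 2 * (norm (F n y - G y))\<^sup>2"
        using norm_add_square_le[of "F m y - G y" "G y - F n y" for y] by (intro AE_I2) (simp add: norm_minus_commute)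
    qed
    also have "\<dots> = 2 * (LINT y|lborel. (norm (F m y - G y))\<^sup>2) + 2 * (LINT y|lborel. (norm (F n y - G y))\<^sup>2)"
      using sq_integrableD[OF sq_integrable_diff[OF F G]] by simp
    finally show ?thesis by (simp add: mult_left_mono)
  qed
  obtain v' where v': "sq_integrable lborel v'" "(\<lambda>n. LINT y|lborel. (norm (?v n y - v' y))\<^sup>2) \<longlonglongrightarrow> 0"
  proof (rule L2_complete[OF sv])
    fix e :: real assume e: "0 < e"
    have R2: "0 < R\<^sup>2" using radius by simp
    \<comment> \<open>Two gradient errors below e / (32 R^2), each doubled and then multiplied by
      the Poincare constant 8 R^2, sum to less than e.\<close>
    with e have "0 < e / (32 * R\<^sup>2)" by simp
    from LIMSEQ_D[OF lim this] obtain N where N: "\<And>n. n \<ge> N \<Longrightarrow> (LINT y|lborel. (norm (F n y - G y))\<^sup>2) < e / (32 * R\<^sup>2)"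
      by auto
    have "(LINT y|lborel. (norm (?v m y - ?v n y))\<^sup>2) < e" if "m \<ge> N" "n \<ge> N" for m n
    proof -
      have "2 * (LINT y|lborel. (norm (F m y - G y))\<^sup>2) + 2 * (LINT y|lborel. (norm (F n y - G y))\<^sup>2) < e / (8 * R\<^sup>2)"
        using N[OF that(1)] N[OF that(2)] by simp
      then have "8 * R\<^sup>2 * (2 * (LINT y|lborel. (norm (F m y - G y))\<^sup>2) + 2 * (LINT y|lborel. (norm (F n y - G y))\<^sup>2)) < 8 * R\<^sup>2 * (e / (8 * R\<^sup>2))"
        using R2 by (intro mult_strict_left_mono) auto
      also have "\<dots> = e" using R2 by simp
      finally show ?thesis using diff[of m n] by simp
    qed
    then show "\<exists>N. \<forall>m\<ge>N. \<forall>n\<ge>N. (LINT y|lborel. (norm (?v m y - ?v n y))\<^sup>2) < e" by blast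
  qed blast
  have idem: "indicator D y *\<^sub>R (indicator D y *\<^sub>R f) = indicator D y *\<^sub>R f" for y and f :: "'b::real_vector"
    by (simp add: indicator_def)
  have limv: "(\<lambda>n. LINT y|lborel. (norm (indicator D y *\<^sub>R v n y - indicator D y *\<^sub>R v' y))\<^sup>2) \<longlonglongrightarrow> 0"
    by (rule Lim_null_comparison[OF always_eventually v'(2)], rule allI)
      (use integral_norm_square_restrict_le[OF sv v'(1)] in \<open>simp only: idem, simp\<close>)
  have limG: "(\<lambda>n. LINT y|lborel. (norm (indicator D y *\<^sub>R F n y - indicator D y *\<^sub>R G y))\<^sup>2) \<longlonglongrightarrow> 0"
    by (rule Lim_null_comparison[OF always_eventually lim], rule allI)
      (use integral_norm_square_restrict_le[OF F G] in simp)
  have "adm v' G"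
    unfolding adm_def
  proof (intro conjI ballI impI)
    show L: "v' \<in> L2_on lborel D" "G \<in> L2_on lborel D"
      using sq_integrable_restrict v'(1) G by auto
    fix s and X :: "'a \<times> real \<Rightarrow> 'a \<times> real" assume s: "s \<in> {1, - 1 :: real}" and X: "X \<in> C1c UNIV" and X0: "\<forall>y\<in>crack. X y = 0"
    have "(\<lambda>n. GG s (v n) (F n) X) \<longlonglongrightarrow> GG s v' G X"
      by (rule GG_tendsto[OF admD(1)[OF adm] L(1) admD(2)[OF adm] L(2) limv limG s X])
    moreover have "GG s (v n) (F n) X = 0" for n
      by (rule admD(3)[OF adm s X]) (use X0 in \<open>simp add: crack_def\<close>)
    ultimately show "GG s v' G X = 0" by (simp add: LIMSEQ_const_iff)
  qed
  then show ?thesis by (rule that)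
qed

text \<open>Admissibility constrains a pair on \<open>D\<close> only. Extension by zero puts the
  gradient into L2 of the whole space, where the projection takes place.\<close>

lemma adm_indicator:
  assumes "adm v G" shows "adm (\<lambda>y. indicator D y * v y) (\<lambda>y. indicator D y *\<^sub>R G y)"
proof -
  have e: "indicator (HB s) y *\<^sub>R (indicator D y *\<^sub>R f) = indicator (HB s) y *\<^sub>R f" if "s \<in> {1, -1}" for s y and f :: "'b::real_vector"
    using HB_subset_D[OF that] by (auto simp: indicator_def)
  have "GG s (\<lambda>y. indicator D y *\<^sub>R v y) (\<lambda>y. indicator D y *\<^sub>R G y) X = GG s v G X" if "s \<in> {1, -1}" for s X
    unfolding GG_def e[OF that] ..
  moreover have L2: "(\<lambda>y. indicator D y *\<^sub>R f y) \<in> L2_on lborel D" if "f \<in> L2_on lborel D" for f :: "'a \<times> real \<Rightarrow> 'b::euclidean_space"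
    using sq_integrable_restrict(1) that unfolding L2_on_iff by blast
  ultimately show ?thesis
    using assms L2[OF admD(1)[OF assms]] L2[OF admD(2)[OF assms]] by (simp add: adm_def)
qed

text \<open>Riesz representation in the form used here: the functional is given as the inner product
  with \<open>B\<close>, and the projection of \<open>B\<close> onto the gradient space represents
  it by a gradient.\<close>

lemma ex_projection:
  assumes B: "sq_integrable lborel B"
  obtains v G where "adm v G" "\<And>z H. adm z H \<Longrightarrow> (LINT y:D|lborel. G y \<bullet> H y) = (LINT y:D|lborel. B y \<bullet> H y)"
proof -
  let ?S = "{G. sq_integrable lborel G \<and> (\<exists>v. adm v G)}"
  obtain G where G: "G \<in> ?S" "\<And>H. H \<in> ?S \<Longrightarrow> (LINT y|lborel. (G y - B y) \<bullet> H y) = 0"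
  proof (rule L2_projection[of ?S lborel B])
    show "?S \<noteq> {}" using adm_zero by (auto simp: sq_integrable_def intro!: exI[of _ "\<lambda>_. 0"])
    show "(\<lambda>y. G y + H y) \<in> ?S" if GH: "G \<in> ?S" "H \<in> ?S" for G H
    proof -
      obtain v z where "adm v G" "adm z H" using GH by blast
      from adm_add[OF this, of 1] show ?thesis using GH by (auto intro: sq_integrable_add)
    qed
    show "(\<lambda>y. t *\<^sub>R G y) \<in> ?S" if GS: "G \<in> ?S" for G t
    proof -
      obtain v where "adm v G" using GS by blast
      from adm_add[OF adm_zero this, of t] show ?thesis using GS by (auto intro: sq_integrable_scaleR)
    qed
    show "\<exists>G'\<in>?S. (\<lambda>n. LINT y|lborel. (norm (F n y - G' y))\<^sup>2) \<longlonglongrightarrow> 0"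
      if F: "\<And>n. F n \<in> ?S" and G: "sq_integrable lborel G"
        and lim: "(\<lambda>n. LINT y|lborel. (norm (F n y - G y))\<^sup>2) \<longlonglongrightarrow> 0" for F and G :: "'a \<times> real \<Rightarrow> 'a \<times> real"
    proof -
      obtain v where "\<And>n. adm (v n) (F n)" using F by (simp, metis)
      from adm_closed[OF this _ G lim] F obtain v' where "adm v' G" by blast
      with G lim show ?thesis by blast
    qed
  qed (use B in auto)
  obtain v where v: "adm v G" using G(1) by blast
  show ?thesis
  proof (rule that[OF v])
    fix z H assume zH: "adm z H"
    have H: "sq_integrable lborel (\<lambda>y. indicator D y *\<^sub>R H y)"
      using admD(2)[OF zH] by (simp only: L2_on_iff)
    have "(LINT y|lborel. (G y - B y) \<bullet> (indicator D y *\<^sub>R H y)) = 0"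
      by (rule G(2)) (use H adm_indicator[OF zH] in blast)
    moreover have "integrable lborel (\<lambda>y. G y \<bullet> (indicator D y *\<^sub>R H y))" "integrable lborel (\<lambda>y. B y \<bullet> (indicator D y *\<^sub>R H y))"
      by (rule sq_integrable_inner[OF _ H], use G(1) B in blast)+
    ultimately show "(LINT y:D|lborel. G y \<bullet> H y) = (LINT y:D|lborel. B y \<bullet> H y)"
      by (simp add: set_lebesgue_integral_def inner_diff_left right_diff_distrib)
  qed
qed

end

section \<open>The second variation as a dual norm\<close>

context cracked_ball begin

lemma crack_trace_adm:
  assumes "adm z H" "s \<in> {1, -1}"
  shows "crack_trace c R s z \<in> L2_on lborel (\<Gamma> c R)"
    "AE x' in lborel. x' \<in> \<Gamma> c R \<longrightarrow> crack_trace c R s z x' = tr s H x'"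
  using crack_trace_AE[OF adm_has_crack_trace[OF assms] assms(2)] by (auto simp: has_crack_trace_def)

lemma integral_crack_trace:
  assumes adm: "adm z H" and s: "s \<in> {1, -1}" and d: "d \<in> L2_on lborel (\<Gamma> c R)"
    "AE x' in lborel. x' \<in> \<Gamma> c R \<longrightarrow> d x' = k * g x'" and g: "continuous_on UNIV g"
  shows "(LINT x':\<Gamma> c R|lborel. d x' * crack_trace c R s z x') = k * (LINT x'|lborel. tr s H x' * g x')"
proof -
  have [measurable]: "g \<in> borel_measurable borel" by (rule borel_measurable_continuous_onI[OF g])
  have [measurable]: "tr s H \<in> borel_measurable borel"
    using sq_integrable_measurable[OF tr_sq[OF admD(2)[OF adm] s]] by simp
  have "(LINT x':\<Gamma> c R|lborel. d x' * crack_trace c R s z x') = (LINT x'|lborel. k * (tr s H x' * g x'))"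
    unfolding set_lebesgue_integral_def
  proof (rule integral_cong_AE)
    show "(\<lambda>x'. indicator (\<Gamma> c R) x' *\<^sub>R (d x' * crack_trace c R s z x')) \<in> borel_measurable lborel"
      using borel_measurable_integrable[OF L2_on_mult_integrable[OF d(1) crack_trace_adm(1)[OF adm s], unfolded set_integrable_def]] .
    show "AE x' in lborel. indicator (\<Gamma> c R) x' *\<^sub>R (d x' * crack_trace c R s z x') = k * (tr s H x' * g x')"
      using d(2) crack_trace_adm(2)[OF adm s]
      by eventually_elim (auto simp: indicator_def tr_zero)
  qed measurable
  then show ?thesis by simp
qed

lemma integral_weak_gradients:
  assumes "adm v G" "adm z H" "A \<in> sets borel" "A \<subseteq> D"
  shows "(LINT y:A|lborel. weak_gradient D v y \<bullet> weak_gradient D z y) = (LINT y:A|lborel. G y \<bullet> H y)"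
proof -
  have m: "(\<lambda>y. indicator A y *\<^sub>R (F y \<bullet> K y)) \<in> borel_measurable lborel"
    if "F \<in> L2_on lborel D" "K \<in> L2_on lborel D" for F K :: "'a \<times> real \<Rightarrow> 'a \<times> real"
  proof -
    note [measurable] = assms(3) sq_integrable_measurable[OF that(1)[unfolded L2_on_iff]] sq_integrable_measurable[OF that(2)[unfolded L2_on_iff]]
    have "(\<lambda>y. indicator A y *\<^sub>R (F y \<bullet> K y)) = (\<lambda>y. indicator A y *\<^sub>R ((indicator D y *\<^sub>R F y) \<bullet> (indicator D y *\<^sub>R K y)))"
      using assms(4) by (auto simp: indicator_def fun_eq_iff)
    then show ?thesis by (simp only:) measurable
  qed
  show ?thesis
    unfolding set_lebesgue_integral_def
  proof (rule integral_cong_AE)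
    show "AE y in lborel. indicator A y *\<^sub>R (weak_gradient D v y \<bullet> weak_gradient D z y) = indicator A y *\<^sub>R (G y \<bullet> H y)"
      using adm_L120(3)[OF assms(1)] adm_L120(3)[OF assms(2)]
      by eventually_elim (use assms(4) in \<open>auto simp: indicator_def\<close>)
    show "(\<lambda>y. indicator A y *\<^sub>R (weak_gradient D v y \<bullet> weak_gradient D z y)) \<in> borel_measurable lborel"
      by (rule m[OF admD(2)[OF L120_adm[OF adm_L120(1)[OF assms(1)]]] admD(2)[OF L120_adm[OF adm_L120(1)[OF assms(2)]]]])
    show "(\<lambda>y. indicator A y *\<^sub>R (G y \<bullet> H y)) \<in> borel_measurable lborel"
      by (rule m[OF admD(2)[OF assms(1)] admD(2)[OF assms(2)]])
  qed
qed

lemma integral_D: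
  assumes "G \<in> L2_on lborel D" "H \<in> L2_on lborel D"
  shows "(LINT y:D|lborel. G y \<bullet> H y) = (LINT y:HB 1|lborel. G y \<bullet> H y) + (LINT y:HB (-1)|lborel. G y \<bullet> H y)"
proof -
  have "integrable lborel (\<lambda>y. indicator (HB s) y * (G y \<bullet> H y))" if "s \<in> {1, -1}" for s
  proof -
    have "(\<lambda>y. indicator (HB s) y * (G y \<bullet> H y)) = (\<lambda>y. (indicator (HB s) y *\<^sub>R G y) \<bullet> (indicator (HB s) y *\<^sub>R H y))"
      by (auto simp: indicator_def)
    then show ?thesis using sq_integrable_inner[OF L2_on_HB[OF assms(1) that] L2_on_HB[OF assms(2) that]] by simp
  qed
  from this[of 1] this[of "-1"] show ?thesis
    by (simp add: set_lebesgue_integral_def indicator_D distrib_right)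
qed

lemma tr_restrict:
  assumes "s \<in> {1, -1}" "s' \<in> {1, -1}"
  shows "tr s' (\<lambda>y. indicator (HB s) y *\<^sub>R H y) = (if s' = s then tr s H else (\<lambda>_. 0))"
proof -
  have "normal_part s' (\<lambda>y. indicator (HB s) y *\<^sub>R H y) y = (if s' = s then normal_part s H y else 0)" for y
    using HB_disjoint assms by (auto simp: normal_part_def indicator_def)
  then show ?thesis by (auto simp: tr_def fun_eq_iff)
qed

text \<open>\<open>E\<close> is the Dirichlet integral of \<open>v_phi\<close>. The two data s g
  have opposite signs, and so do the two boundary terms of the equation; hence the one-sided
  pairings are added.\<close>

lemma second_variation_dual:
  assumes g: "continuous_on UNIV g"
    and d: "\<And>s. s \<in> {1, -1} \<Longrightarrow> neumann_datum u c R s \<phi> \<in> L2_on lborel (\<Gamma> c R)"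
    "\<And>s. s \<in> {1, -1} \<Longrightarrow> AE x' in lborel. x' \<in> \<Gamma> c R \<longrightarrow> neumann_datum u c R s \<phi> x' = s * g x'"
  obtains E where
    "second_variation u c R \<phi> = (LINT x':\<Gamma> c R|lborel. (norm (weak_gradient (\<Gamma> c R) \<phi> x'))\<^sup>2) - 2 * E"
    "0 \<le> E" "\<And>z H. adm z H \<Longrightarrow> ((LINT x'|lborel. tr 1 H x' * g x') + (LINT x'|lborel. tr (-1) H x' * g x'))\<^sup>2
      \<le> E * (LINT y:D|lborel. (norm (H y))\<^sup>2)"
proof -
  let ?d = "\<lambda>s. neumann_datum u c R s \<phi>"
  define T where "T s H = (LINT x'|lborel. tr s H x' * g x')" for s H
  have dT: "(LINT x':\<Gamma> c R|lborel. ?d s x' * crack_trace c R s z x') = s * T s H" if "adm z H" "s \<in> {1, -1}" for z H s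
    unfolding T_def by (rule integral_crack_trace[OF that d(1)[OF that(2)] d(2)[OF that(2)] g])
  have pair: "(LINT x':\<Gamma> c R|lborel. ?d 1 x' * crack_trace c R 1 z x' - ?d (-1) x' * crack_trace c R (-1) z x') = T 1 H + T (-1) H"
    if "adm z H" for z H
  proof -
    have "set_integrable lborel (\<Gamma> c R) (\<lambda>x'. ?d s x' * crack_trace c R s z x')" if "s \<in> {1, -1}" for s
      by (rule L2_on_mult_integrable[OF d(1)[OF that] crack_trace_adm(1)[OF \<open>adm z H\<close> that]])
    from this[of 1] this[of "-1"] show ?thesis
      using dT[OF that, of 1] dT[OF that, of "-1"] by (simp add: set_integral_diff)
  qed
  have "\<exists>v. is_v_phi u c R \<phi> v"
  proof -
    have gb: "g \<in> L2_on lborel (\<Gamma> c R)"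
      by (rule continuous_bounded_L2_on[OF g Gamma_bounded Gamma_open])
    \<comment> \<open>The field s g e_N on side s: \<open>integral_tr_mult\<close> carries the
      factor - s, so the inner product of \<open>B\<close> with a gradient is minus the sum of the
      two trace pairings.\<close>
    define B where "B y = indicator (HB 1) y *\<^sub>R (0 :: 'a, g (fst y)) - indicator (HB (-1)) y *\<^sub>R (0, g (fst y))" for y
    have c0: "continuous_on UNIV (\<lambda>y :: 'a \<times> real. (0 :: 'a, g (fst y)))"
      by (intro continuous_intros continuous_on_compose2[OF g]) auto
    have "sq_integrable lborel B"
      unfolding B_def[abs_def] using continuous_bounded_L2_on[OF c0 HB_bounded HB_open]
      by (intro sq_integrable_diff) (simp_all only: L2_on_iff)
    from ex_projection[OF this] obtain v G where vG: "adm v G"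
      "\<And>z H. adm z H \<Longrightarrow> (LINT y:D|lborel. G y \<bullet> H y) = (LINT y:D|lborel. B y \<bullet> H y)" by blast
    have BT: "(LINT y:D|lborel. B y \<bullet> H y) = - (T 1 H + T (-1) H)" if "adm z H" for z H
    proof -
      have "indicator D y *\<^sub>R (B y \<bullet> H y) = normal_part 1 H y * g (fst y) - normal_part (-1) H y * g (fst y)" for y
        using HB_disjoint D_eq by (auto simp: B_def indicator_def normal_part_def inner_prod_def)
      then show ?thesis
        using integral_tr_mult[OF admD(2)[OF that] _ g, of 1] integral_tr_mult[OF admD(2)[OF that] _ g, of "-1"]
        by (simp add: set_lebesgue_integral_def T_def)
    qed
    have "is_v_phi u c R \<phi> v"
      unfolding is_v_phi_def
    proof (intro conjI ballI)
      show "v \<in> L120 c R" by (rule adm_L120(1)[OF vG(1)])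
      fix z assume "z \<in> L120 c R"
      then have z: "adm z (weak_gradient D z)" by (rule L120_adm)
      show "(LINT y:D|lborel. weak_gradient D v y \<bullet> weak_gradient D z y) +
        (LINT x':\<Gamma> c R|lborel. ?d 1 x' * crack_trace c R 1 z x' - ?d (-1) x' * crack_trace c R (-1) z x') = 0"
        unfolding pair[OF z] integral_weak_gradients[OF vG(1) z D_borel order_refl] vG(2)[OF z] BT[OF z] by simp
    qed
    then show ?thesis by (intro exI)
  qed
  then have vphi: "is_v_phi u c R \<phi> (v_phi u c R \<phi>)"
    unfolding v_phi_def by (rule someI_ex)
  let ?v = "v_phi u c R \<phi>"
  define G where "G = weak_gradient D ?v"
  have v: "adm ?v G" unfolding G_def by (rule L120_adm) (use vphi in \<open>simp add: is_v_phi_def\<close>)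
  have eq: "(LINT y:D|lborel. G y \<bullet> H y) = - (T 1 H + T (-1) H)" if zH: "adm z H" for z H
  proof -
    have "(LINT y:D|lborel. weak_gradient D ?v y \<bullet> weak_gradient D z y) +
        (LINT x':\<Gamma> c R|lborel. ?d 1 x' * crack_trace c R 1 z x' - ?d (-1) x' * crack_trace c R (-1) z x') = 0"
      using vphi adm_L120(1)[OF zH] by (simp add: is_v_phi_def)
    then show ?thesis
      unfolding pair[OF zH] integral_weak_gradients[OF v zH D_borel order_refl] by simp
  qed
  \<comment> \<open>Testing with H cut to side s leaves a single trace term. The resulting one-sided
    identity says that the Neumann datum is a normal derivative on that side.\<close>
  have half: "(LINT y:HB s|lborel. G y \<bullet> H y) = - T s H" if zH: "adm z H" and s: "s \<in> {1, -1}" for z H s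
  proof -
    have "(LINT y:D|lborel. G y \<bullet> (indicator (HB s) y *\<^sub>R H y)) = (LINT y:HB s|lborel. G y \<bullet> H y)"
      unfolding set_lebesgue_integral_def
      by (rule Bochner_Integration.integral_cong) (use HB_subset_D[OF s] in \<open>auto simp: indicator_def\<close>)
    then show ?thesis
      using eq[OF adm_restrict[OF zH s]] tr_restrict[OF s] s by (auto simp: T_def)
  qed
  have nd: "has_normal_derivative c R s ?v (?d s)" if s: "s \<in> {1, -1}" for s
    unfolding has_normal_derivative_def
  proof (intro conjI ballI d(1)[OF s])
    fix z assume "z \<in> L120 c R"
    then have z: "adm z (weak_gradient D z)" by (rule L120_adm)
    show "(LINT y:HB s|lborel. weak_gradient D ?v y \<bullet> weak_gradient D z y) =
        - s * (LINT x':\<Gamma> c R|lborel. ?d s x' * crack_trace c R s z x')"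
      unfolding dT[OF z s] integral_weak_gradients[OF v z HB_borel HB_subset_D[OF s]] half[OF z s] using s by auto
  qed
  let ?h = "\<lambda>s. normal_derivative c R s ?v"
  have h: "has_normal_derivative c R s ?v (?h s)" if "s \<in> {1, -1}" for s
    unfolding normal_derivative_def by (rule someI[of "has_normal_derivative c R s ?v", OF nd[OF that]])
  \<comment> \<open>The defining identity of the chosen normal derivative, tested with
    \<open>?v\<close> itself, gives the Dirichlet integral on side s.\<close>
  have hv: "(LINT y:HB s|lborel. G y \<bullet> G y) = - s * (LINT x':\<Gamma> c R|lborel. crack_trace c R s ?v x' * ?h s x')"
    "set_integrable lborel (\<Gamma> c R) (\<lambda>x'. crack_trace c R s ?v x' * ?h s x')" if s: "s \<in> {1, -1}" for s
  proof -
    show "(LINT y:HB s|lborel. G y \<bullet> G y) = - s * (LINT x':\<Gamma> c R|lborel. crack_trace c R s ?v x' * ?h s x')"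
      using h[OF s] adm_L120(1)[OF v] by (simp add: has_normal_derivative_def G_def mult.commute)
    show "set_integrable lborel (\<Gamma> c R) (\<lambda>x'. crack_trace c R s ?v x' * ?h s x')"
      using h[OF s] crack_trace_adm(1)[OF v s] by (intro L2_on_mult_integrable) (auto simp: has_normal_derivative_def)
  qed
  define E where "E = (LINT y:D|lborel. G y \<bullet> G y)"
  have "(LINT x':\<Gamma> c R|lborel. crack_trace c R 1 ?v x' * ?h 1 x' - crack_trace c R (-1) ?v x' * ?h (-1) x') = - E"
    using hv[of 1] hv[of "-1"] integral_D[OF admD(2)[OF v] admD(2)[OF v]]
    by (simp add: set_integral_diff E_def)
  then have 1: "second_variation u c R \<phi> = (LINT x':\<Gamma> c R|lborel. (norm (weak_gradient (\<Gamma> c R) \<phi> x'))\<^sup>2) - 2 * E"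
    by (simp add: second_variation_def Let_def)
  have 2: "(T 1 H + T (-1) H)\<^sup>2 \<le> E * (LINT y:D|lborel. (norm (H y))\<^sup>2)" if zH: "adm z H" for z H
  proof -
    have set: "(LINT y:D|lborel. F y \<bullet> K y) = (LINT y|lborel. (indicator D y *\<^sub>R F y) \<bullet> (indicator D y *\<^sub>R K y))"
      for F K :: "'a \<times> real \<Rightarrow> 'a \<times> real"
      unfolding set_lebesgue_integral_def
      by (rule Bochner_Integration.integral_cong) (auto simp: indicator_def)
    have "(LINT y:D|lborel. G y \<bullet> H y)\<^sup>2 \<le> (LINT y:D|lborel. G y \<bullet> G y) * (LINT y:D|lborel. H y \<bullet> H y)"
      unfolding set
      using Cauchy_Schwarz_sq_integrable[OF admD(2)[OF v, unfolded L2_on_iff] admD(2)[OF zH, unfolded L2_on_iff]]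
      by (simp only: power2_norm_eq_inner)
    then show ?thesis
      unfolding eq[OF zH] E_def power2_minus by (simp only: power2_norm_eq_inner)
  qed
  have "0 \<le> E"
    unfolding E_def set_lebesgue_integral_def by (rule integral_nonneg_AE) (auto simp: indicator_def)
  then show ?thesis
    by (rule that[OF 1]) (use 2 in \<open>simp add: T_def\<close>)
qed

end

section \<open>The data of the Mumford--Shah pair\<close>

text \<open>The trace chosen by \<open>crack_trace\<close> is known only almost everywhere; its weak
  gradient can still be computed from an affine representative.\<close>

lemma has_weak_gradient_cong_AE:
  assumes G: "has_weak_gradient \<Omega> v G" and v': "v' \<in> L2_on lborel \<Omega>" and v: "v \<in> L2_on lborel \<Omega>"
    and AE: "AE y in lborel. y \<in> \<Omega> \<longrightarrow> v' y = v y"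
  shows "has_weak_gradient \<Omega> v' G"
proof -
  have "(LINT y:\<Omega>|lborel. v' y * divergence X y) = (LINT y:\<Omega>|lborel. v y * divergence X y)" if X: "X \<in> C1c \<Omega>" for X
    unfolding set_lebesgue_integral_def
  proof (rule integral_cong_AE)
    have m: "(\<lambda>y. indicator \<Omega> y *\<^sub>R (f y * divergence X y)) \<in> borel_measurable lborel" if "f \<in> L2_on lborel \<Omega>" for f
      using borel_measurable_integrable[OF L2_on_inner_set_integrable[OF that C1c_divergence_sq_integrable[OF X], unfolded set_integrable_def]]
      by simp
    show "(\<lambda>y. indicator \<Omega> y *\<^sub>R (v' y * divergence X y)) \<in> borel_measurable lborel"
      "(\<lambda>y. indicator \<Omega> y *\<^sub>R (v y * divergence X y)) \<in> borel_measurable lborel"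
      using m v v' by auto
    show "AE y in lborel. indicator \<Omega> y *\<^sub>R (v' y * divergence X y) = indicator \<Omega> y *\<^sub>R (v y * divergence X y)"
      using AE by eventually_elim (auto simp: indicator_def)
  qed
  then show ?thesis using G by (simp add: has_weak_gradient_def)
qed

lemma C1c_H10:
  fixes \<phi> :: "'e::euclidean_space \<Rightarrow> real"
  assumes \<Omega>: "open \<Omega>" "bounded \<Omega>" and \<phi>: "\<phi> \<in> C1c \<Omega>"
  shows "\<phi> \<in> H10 \<Omega>"
    "(LINT y:\<Omega>|lborel. (norm (weak_gradient \<Omega> \<phi> y))\<^sup>2) = (LINT y|lborel. (norm (grad \<phi> y))\<^sup>2)"
proof -
  note w = C1_has_weak_gradient[OF \<Omega> C1c_C1[OF \<phi>]]
  note wg = weak_gradient_AE[OF \<Omega> w]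
  have "\<phi> \<in> H1 \<Omega>"
    using w continuous_bounded_L2_on[OF C1_continuous[OF C1c_C1[OF \<phi>]] \<Omega>(2,1)] by (auto simp: H1_def)
  moreover have "(LINT y:\<Omega>|lborel. (\<phi> y - \<phi> y)\<^sup>2 + (norm (grad \<phi> y - weak_gradient \<Omega> \<phi> y))\<^sup>2) = 0"
    unfolding set_lebesgue_integral_def
    by (rule integral_eq_zero_AE) (use wg(2) in \<open>auto elim!: eventually_mono simp: indicator_def\<close>)
  ultimately show "\<phi> \<in> H10 \<Omega>"
    unfolding H10_def using \<phi> by (auto intro!: exI[of _ "\<lambda>_ :: nat. \<phi>"])
  have L2: "weak_gradient \<Omega> \<phi> \<in> L2_on lborel \<Omega>" using wg(1) by (simp add: has_weak_gradient_def)
  show "(LINT y:\<Omega>|lborel. (norm (weak_gradient \<Omega> \<phi> y))\<^sup>2) = (LINT y|lborel. (norm (grad \<phi> y))\<^sup>2)"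
    unfolding set_lebesgue_integral_def
  proof (rule integral_cong_AE)
    show "(\<lambda>y. indicator \<Omega> y *\<^sub>R (norm (weak_gradient \<Omega> \<phi> y))\<^sup>2) \<in> borel_measurable lborel"
      using sq_integrableD[OF L2[unfolded L2_on_iff]] unfolding indicator_scaleR_norm_square by simp
    show "(\<lambda>y. (norm (grad \<phi> y))\<^sup>2) \<in> borel_measurable lborel"
      using sq_integrableD[OF C1c_grad_sq_integrable[OF \<phi>]] by simp
    show "AE y in lborel. indicator \<Omega> y *\<^sub>R (norm (weak_gradient \<Omega> \<phi> y))\<^sup>2 = (norm (grad \<phi> y))\<^sup>2"
      using wg(2) by eventually_elim (auto simp: indicator_def C1c_grad_zero[OF \<phi>])
  qed
qed

text \<open>\<open>W\<close> stands for the chosen weak gradient of the trace of \<open>u\<close>,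
  almost everywhere a constant vector \<open>b\<close>. The divergence of \<phi> b follows by
  integrating \<phi> by parts against the test field \<psi> b.\<close>

lemma has_weak_divergence_scaled_constant:
  fixes \<phi> :: "'e::euclidean_space \<Rightarrow> real"
  assumes \<Omega>: "open \<Omega>" "bounded \<Omega>" and \<phi>: "C1 \<phi>" and W: "W \<in> L2_on lborel \<Omega>"
    and AE: "AE y in lborel. y \<in> \<Omega> \<longrightarrow> W y = b"
  shows "has_weak_divergence \<Omega> (\<lambda>y. \<phi> y *\<^sub>R W y) (\<lambda>y. grad \<phi> y \<bullet> b)"
  unfolding has_weak_divergence_def
proof (intro conjI ballI)
  show "(\<lambda>y. grad \<phi> y \<bullet> b) \<in> L2_on lborel \<Omega>"
    by (rule continuous_bounded_L2_on[OF _ \<Omega>(2,1)]) (intro continuous_intros grad_continuous[OF \<phi>])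
  fix \<psi> :: "'e \<Rightarrow> real" assume \<psi>: "\<psi> \<in> C1c \<Omega>"
  have X: "(\<lambda>y. \<psi> y *\<^sub>R b) \<in> C1c \<Omega>" by (rule C1c_scaleR_left[OF \<psi> C1_const])
  have \<psi>\<phi>: "sq_integrable lborel (\<lambda>y. \<phi> y *\<^sub>R grad \<psi> y)"
  proof -
    obtain K where K: "compact K" "\<And>y. y \<notin> K \<Longrightarrow> grad \<psi> y = 0"
      by (rule C1cE[OF \<psi>]) (auto simp: grad_def)
    show ?thesis
      by (rule sq_integrable_compact_support[OF _ K(1)])
        (auto simp: K(2) intro!: continuous_intros C1_continuous[OF \<phi>] grad_continuous[OF C1c_C1[OF \<psi>]])
  qed
  have "(LINT y:\<Omega>|lborel. (\<phi> y *\<^sub>R W y) \<bullet> grad \<psi> y) = (LINT y|lborel. \<phi> y * divergence (\<lambda>y. \<psi> y *\<^sub>R b) y)"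
    unfolding set_lebesgue_integral_def
  proof (rule integral_cong_AE)
    have e: "(\<lambda>y. indicator \<Omega> y *\<^sub>R ((\<phi> y *\<^sub>R W y) \<bullet> grad \<psi> y)) = (\<lambda>y. (indicator \<Omega> y *\<^sub>R W y) \<bullet> (\<phi> y *\<^sub>R grad \<psi> y))"
      by (auto simp: mult_ac)
    show "(\<lambda>y. indicator \<Omega> y *\<^sub>R ((\<phi> y *\<^sub>R W y) \<bullet> grad \<psi> y)) \<in> borel_measurable lborel"
      unfolding e by (rule borel_measurable_integrable[OF sq_integrable_inner[OF W[unfolded L2_on_iff] \<psi>\<phi>]])
    have "(\<lambda>y. \<phi> y * divergence (\<lambda>y. \<psi> y *\<^sub>R b) y) \<in> borel_measurable borel"
      by (intro borel_measurable_continuous_onI continuous_intros C1_continuous[OF \<phi>] divergence_continuous[OF C1c_C1[OF X]])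
    then show "(\<lambda>y. \<phi> y * divergence (\<lambda>y. \<psi> y *\<^sub>R b) y) \<in> borel_measurable lborel" by simp
    have div: "divergence (\<lambda>y. \<psi> y *\<^sub>R b) y = b \<bullet> grad \<psi> y" for y
      by (subst divergence_scaleR[OF C1c_C1[OF \<psi>] C1_const]) (simp add: divergence_def inner_commute)
    show "AE y in lborel. indicator \<Omega> y *\<^sub>R ((\<phi> y *\<^sub>R W y) \<bullet> grad \<psi> y) = \<phi> y * divergence (\<lambda>y. \<psi> y *\<^sub>R b) y"
      using AE by eventually_elim (auto simp: indicator_def div C1c_grad_zero[OF \<psi>])
  qed
  also have "\<dots> = - (LINT y|lborel. grad \<phi> y \<bullet> (\<psi> y *\<^sub>R b))"
  proof -
    obtain K where K: "compact K" "\<And>y. y \<notin> K \<Longrightarrow> \<psi> y *\<^sub>R b = 0" "\<And>y. y \<notin> K \<Longrightarrow> divergence (\<lambda>y. \<psi> y *\<^sub>R b) y = 0"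
      by (rule C1cE[OF X]) (auto simp: divergence_def)
    have "integrable lborel (\<lambda>y. \<phi> y * divergence (\<lambda>y. \<psi> y *\<^sub>R b) y)"
      by (rule integrable_compact_support[OF _ K(1)])
        (auto simp: K(3) intro!: continuous_intros C1_continuous[OF \<phi>] divergence_continuous[OF C1c_C1[OF X]])
    moreover have "integrable lborel (\<lambda>y. grad \<phi> y \<bullet> (\<psi> y *\<^sub>R b))"
    proof (rule integrable_compact_support[OF _ K(1)])
      show "continuous_on UNIV (\<lambda>y. grad \<phi> y \<bullet> (\<psi> y *\<^sub>R b))"
        by (intro continuous_intros C1_continuous[OF C1c_C1[OF \<psi>]] grad_continuous[OF \<phi>])
      show "grad \<phi> y \<bullet> (\<psi> y *\<^sub>R b) = 0" if "y \<notin> K" for y using K(2)[OF that] by (simp only: inner_zero_right)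
    qed
    ultimately show ?thesis
      using integration_by_parts_whole_space[OF \<phi> C1c_mono[OF X subset_UNIV]] by (simp add: Bochner_Integration.integral_add)
  qed
  also have "(LINT y|lborel. grad \<phi> y \<bullet> (\<psi> y *\<^sub>R b)) = (LINT y:\<Omega>|lborel. (grad \<phi> y \<bullet> b) * \<psi> y)"
    unfolding set_lebesgue_integral_def
    by (rule Bochner_Integration.integral_cong) (auto simp: indicator_def C1c_zero[OF \<psi>])
  finally show "(LINT y:\<Omega>|lborel. (\<phi> y *\<^sub>R W y) \<bullet> grad \<psi> y) = - (LINT y:\<Omega>|lborel. (grad \<phi> y \<bullet> b) * \<psi> y)" .
qed

context cracked_ball begin

text \<open>The vanishing condition off the ball may come from f or from X: a test function
  supported in the ball is paired with arbitrary fields, the affine \<open>u\<close> with fields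
  supported in the ball. In both cases the spherical boundary term drops out. The pair only has to
  agree with f on one side, so f may extend a piecewise function across the crack.\<close>

lemma GG_C1:
  assumes f: "C1 f" and s: "s \<in> {1, -1}" and X: "X \<in> C1c UNIV"
    and 0: "\<And>y. y \<notin> ball c R \<Longrightarrow> f y * divergence X y + grad f y \<bullet> X y = 0"
    and v: "\<And>y. y \<in> HB s \<Longrightarrow> v y = f y \<and> G y = grad f y"
  shows "GG s v G X = - s * (LINT x'|lborel. f (x', 0) * snd (X (x', 0)))"
proof -
  have L: "f \<in> L2_on lborel D" "grad f \<in> L2_on lborel D"
    by (intro continuous_bounded_L2_on[OF _ D_bounded D_open] C1_continuous f grad_continuous)+
  have "GG s v G X = GG s f (grad f) X"
    unfolding GG_def
    by (intro arg_cong2[of _ _ _ _ "(+)"] Bochner_Integration.integral_cong) (auto simp: indicator_def v)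
  also have "\<dots> = (LINT y:HB s|lborel. f y * divergence X y + grad f y \<bullet> X y)"
    by (rule GG_eq[OF L s X, symmetric])
  also have "\<dots> = (LINT y|lborel. indicator (half_space s) y * (f y * divergence X y + grad f y \<bullet> X y))"
    unfolding set_lebesgue_integral_def
  proof (rule Bochner_Integration.integral_cong[OF refl])
    fix y show "indicator (HB s) y *\<^sub>R (f y * divergence X y + grad f y \<bullet> X y) =
        indicator (half_space s) y * (f y * divergence X y + grad f y \<bullet> X y)"
      using 0[of y] by (cases "y \<in> ball c R") (simp_all add: HB_eq indicator_def)
  qed
  also have "\<dots> = - s * (LINT x'|lborel. f (x', 0) * snd (X (x', 0)))"
    by (rule integration_by_parts_half_space[OF f X s])
  finally show ?thesis .
qed

text \<open>A function that is \<open>C1\<close> across the crack has its restriction as trace from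
  both sides; uniqueness of crack traces identifies it with \<open>tr\<close>.\<close>

lemma C1c_adm:
  assumes z: "z \<in> C1c (ball c R)"
  shows "adm z (grad z)" "s \<in> {1, -1} \<Longrightarrow> AE x' in lborel. tr s (grad z) x' = z (x', 0)"
proof -
  note C1z = C1c_C1[OF z]
  have GG: "GG s z (grad z) X = - s * (LINT x'|lborel. z (x', 0) * snd (X (x', 0)))"
    if "s \<in> {1, -1}" "X \<in> C1c UNIV" for s X
    by (rule GG_C1[OF C1z that]) (simp_all add: C1c_zero[OF z] C1c_grad_zero[OF z])
  show adm: "adm z (grad z)"
    unfolding adm_def
    by (intro conjI ballI impI continuous_bounded_L2_on[OF _ D_bounded D_open] C1_continuous C1z grad_continuous)
      (simp add: GG crack_def)
  assume s: "s \<in> {1, -1}"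
  have "has_crack_trace c R s z (\<lambda>x'. z (x', 0))"
    unfolding has_crack_trace_def
  proof (intro conjI ballI)
    show "(\<lambda>x'. z (x', 0)) \<in> L2_on lborel (\<Gamma> c R)"
      by (intro continuous_bounded_L2_on[OF _ Gamma_bounded Gamma_open] continuous_on_compose2[OF C1_continuous[OF C1z]] continuous_intros) auto
    fix X :: "'a \<times> real \<Rightarrow> 'a \<times> real" assume "X \<in> C1c (ball c R)"
    then have X: "X \<in> C1c UNIV" by (rule C1c_mono) simp
    have "(LINT x'|lborel. z (x', 0) * snd (X (x', 0))) = (LINT x':\<Gamma> c R|lborel. z (x', 0) * snd (X (x', 0)))"
      unfolding set_lebesgue_integral_def
      by (rule Bochner_Integration.integral_cong) (auto simp: indicator_def \<Gamma>_def crack_def C1c_zero[OF z])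
    then show "gauss_green_integral c R s z X = - s * (LINT x':\<Gamma> c R|lborel. z (x', 0) * snd (X (x', 0)))"
      using gauss_green_integral_eq[OF admD(1)[OF adm] adm_L120(2)[OF adm] s X] GG[OF s X] by simp
  qed
  from crack_trace_AE(2)[OF this s] crack_trace_adm(2)[OF adm s]
  show "AE x' in lborel. tr s (grad z) x' = z (x', 0)"
  proof eventually_elim
    case (elim x')
    then show ?case
      using tr_zero[of x' s "grad z"] C1c_zero[OF z, of "(x', 0)"] by (cases "x' \<in> \<Gamma> c R") (auto simp: \<Gamma>_def crack_def)
  qed
qed

text \<open>On side s the function \<open>u\<close> coincides with the global affine function s (a .
  x' + k). Its trace thus has the constant gradient s a, and the divergence of \<phi> s a is s (a .
  grad \<phi>).\<close>

lemma neumann_datum_affine: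
  fixes a :: 'a and k :: real
  assumes \<phi>: "\<phi> \<in> C1c (\<Gamma> c R)"
    and u: "u = (\<lambda>(x', x\<^sub>N). if 0 \<le> x\<^sub>N then a \<bullet> x' + k else - (a \<bullet> x' + k))"
    and s: "s \<in> {1, -1}"
  shows "neumann_datum u c R s \<phi> \<in> L2_on lborel (\<Gamma> c R)"
    "AE x' in lborel. x' \<in> \<Gamma> c R \<longrightarrow> neumann_datum u c R s \<phi> x' = s * (grad \<phi> x' \<bullet> a)"
proof -
  define f where "f s y = s * (a \<bullet> fst y + k)" for s and y :: "'a \<times> real"
  have df: "(f s has_derivative (\<lambda>h. (s *\<^sub>R a, 0) \<bullet> h)) (at y)" for s y
    unfolding f_def[abs_def] by (auto intro!: derivative_eq_intros simp: inner_prod_def)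
  have C1f: "C1 (f s)" for s
    by (rule C1I[OF df]) auto
  have grad_f: "grad (f s) y = (s *\<^sub>R a, 0)" for s y by (rule grad_eqI[OF df])
  \<comment> \<open>The value on the crack is a default; both half balls avoid it.\<close>
  define G where "G y = (if 0 \<le> snd y then (a, 0 :: real) else (- a, 0))" for y :: "'a \<times> real"
  have on_HB: "u y = f s y \<and> G y = grad (f s) y" if "s \<in> {1, -1}" "y \<in> HB s" for s y
    using that by (auto simp: half_ball_def u f_def grad_f G_def split: prod.splits)
  have L2: "F \<in> L2_on lborel D"
    if F: "\<And>s y. s \<in> {1, -1} \<Longrightarrow> y \<in> HB s \<Longrightarrow> F y = F' s y" and c: "\<And>s. continuous_on UNIV (F' s)"
    for F and F' :: "real \<Rightarrow> 'a \<times> real \<Rightarrow> 'b::euclidean_space"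
  proof (rule L2_on_D)
    fix s :: real assume s: "s \<in> {1, -1}"
    have "(\<lambda>y. indicator (HB s) y *\<^sub>R F y) = (\<lambda>y. indicator (HB s) y *\<^sub>R F' s y)"
      using F[OF s] by (intro ext) (metis indicator_simps(2) scaleR_zero_left)
    then show "sq_integrable lborel (\<lambda>y. indicator (HB s) y *\<^sub>R F y)"
      using continuous_bounded_L2_on[OF c HB_bounded HB_open] by (simp only: L2_on_iff)
  qed
  have uL: "u \<in> L2_on lborel D" by (rule L2[of u f]) (use on_HB C1_continuous[OF C1f] in auto)
  have GL: "G \<in> L2_on lborel D" by (rule L2[of G "\<lambda>s. grad (f s)"]) (use on_HB grad_continuous[OF C1f] in auto)
  have GG: "GG s u G X = - s * (LINT x'|lborel. f s (x', 0) * snd (X (x', 0)))"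
    if "s \<in> {1, -1}" and X: "X \<in> C1c (ball c R)" for s X
    by (rule GG_C1[OF C1f that(1) C1c_mono[OF X subset_UNIV] _ on_HB[OF that(1)]])
      (simp_all add: C1c_zero[OF X] C1c_divergence_zero[OF X])
  have w: "has_weak_gradient D u G"
    by (rule has_weak_gradient_D[OF uL GL]) (simp add: GG)
  let ?f = "\<lambda>x'. f s (x', 0)"
  have C1f0: "C1 ?f"
    by (rule C1_compose_right[OF _ C1f]) (intro bounded_linear_Pair bounded_linear_ident bounded_linear_zero)
  have grad_f0: "grad ?f x' = s *\<^sub>R a" for x'
    by (rule grad_eqI) (auto simp: f_def[abs_def] intro!: derivative_eq_intros)
  have fL: "?f \<in> L2_on lborel (\<Gamma> c R)"
    by (rule continuous_bounded_L2_on[OF C1_continuous[OF C1f0] Gamma_bounded Gamma_open])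
  have tr: "has_crack_trace c R s u ?f"
    unfolding has_crack_trace_def
  proof (intro conjI ballI fL)
    fix X :: "'a \<times> real \<Rightarrow> 'a \<times> real" assume X: "X \<in> C1c (ball c R)"
    have "(LINT x'|lborel. ?f x' * snd (X (x', 0))) = (LINT x':\<Gamma> c R|lborel. ?f x' * snd (X (x', 0)))"
      unfolding set_lebesgue_integral_def
      by (rule Bochner_Integration.integral_cong) (auto simp: indicator_def \<Gamma>_def crack_def C1c_zero[OF X])
    then show "gauss_green_integral c R s u X = - s * (LINT x':\<Gamma> c R|lborel. ?f x' * snd (X (x', 0)))"
      using gauss_green_integral_eq[OF uL w s C1c_mono[OF X subset_UNIV]] GG[OF s X] by simp
  qed
  let ?t = "crack_trace c R s u"
  have tL: "?t \<in> L2_on lborel (\<Gamma> c R)"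
    using crack_trace_AE(1)[OF tr s] by (simp add: has_crack_trace_def)
  have "has_weak_gradient (\<Gamma> c R) ?t (grad ?f)"
    by (rule has_weak_gradient_cong_AE[OF C1_has_weak_gradient[OF Gamma_open Gamma_bounded C1f0] tL fL crack_trace_AE(2)[OF tr s]])
  note wg = weak_gradient_AE[OF Gamma_open Gamma_bounded this]
  let ?W = "weak_gradient (\<Gamma> c R) ?t"
  have "has_weak_divergence (\<Gamma> c R) (\<lambda>x'. \<phi> x' *\<^sub>R ?W x') (\<lambda>x'. grad \<phi> x' \<bullet> (s *\<^sub>R a))"
    by (rule has_weak_divergence_scaled_constant[OF Gamma_open Gamma_bounded C1c_C1[OF \<phi>]])
      (use wg in \<open>simp_all add: has_weak_gradient_def grad_f0\<close>)
  note wd = weak_divergence_AE[OF Gamma_open Gamma_bounded this]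
  show "neumann_datum u c R s \<phi> \<in> L2_on lborel (\<Gamma> c R)"
    using wd(1) by (simp add: neumann_datum_def has_weak_divergence_def)
  show "AE x' in lborel. x' \<in> \<Gamma> c R \<longrightarrow> neumann_datum u c R s \<phi> x' = s * (grad \<phi> x' \<bullet> a)"
    using wd(2) by (simp add: neumann_datum_def)
qed

text \<open>The test function does not jump across the crack, so both sides contribute the same
  pairing; this is the factor 2.\<close>

lemma second_variation_upper_bound:
  fixes a :: 'a and k :: real
  assumes \<phi>: "\<phi> \<in> C1c (\<Gamma> c R)" and z: "z \<in> C1c (ball c R)"
    and u: "u = (\<lambda>(x', x\<^sub>N). if 0 \<le> x\<^sub>N then a \<bullet> x' + k else - (a \<bullet> x' + k))"
  obtains E where
    "second_variation u c R \<phi> = (LINT x'|lborel. (norm (grad \<phi> x'))\<^sup>2) - 2 * E" "0 \<le> E"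
    "(2 * (LINT x'|lborel. z (x', 0) * (grad \<phi> x' \<bullet> a)))\<^sup>2 \<le> E * (LINT y|lborel. (norm (grad z y))\<^sup>2)"
proof -
  define g where "g x' = grad \<phi> x' \<bullet> a" for x'
  have g: "continuous_on UNIV g"
    unfolding g_def[abs_def] by (intro continuous_intros grad_continuous C1c_C1[OF \<phi>])
  obtain E where E: "second_variation u c R \<phi> = (LINT x':\<Gamma> c R|lborel. (norm (weak_gradient (\<Gamma> c R) \<phi> x'))\<^sup>2) - 2 * E" "0 \<le> E"
    "\<And>z H. adm z H \<Longrightarrow> ((LINT x'|lborel. tr 1 H x' * g x') + (LINT x'|lborel. tr (-1) H x' * g x'))\<^sup>2
      \<le> E * (LINT y:D|lborel. (norm (H y))\<^sup>2)"
    by (rule second_variation_dual[OF g, of u \<phi>])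
      (use neumann_datum_affine[OF \<phi> u] in \<open>auto simp: g_def\<close>)
  have t: "(LINT x'|lborel. tr s (grad z) x' * g x') = (LINT x'|lborel. z (x', 0) * g x')" if s: "s \<in> {1, -1}" for s
  proof (rule integral_cong_AE)
    have [measurable]: "g \<in> borel_measurable borel" by (rule borel_measurable_continuous_onI[OF g])
    have [measurable]: "tr s (grad z) \<in> borel_measurable borel"
      using sq_integrable_measurable[OF tr_sq[OF admD(2)[OF C1c_adm(1)[OF z]] s]] by simp
    have [measurable]: "(\<lambda>x'. z (x', 0)) \<in> borel_measurable borel"
      by (intro borel_measurable_continuous_onI continuous_on_compose2[OF C1_continuous[OF C1c_C1[OF z]]] continuous_intros) auto
    show "(\<lambda>x'. tr s (grad z) x' * g x') \<in> borel_measurable lborel" "(\<lambda>x'. z (x', 0) * g x') \<in> borel_measurable lborel"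
      by measurable
    show "AE x' in lborel. tr s (grad z) x' * g x' = z (x', 0) * g x'"
      using C1c_adm(2)[OF z s] by eventually_elim simp
  qed
  let ?Z = "LINT y|lborel. (norm (grad z y))\<^sup>2" and ?ZD = "LINT y:D|lborel. (norm (grad z y))\<^sup>2"
  have iZ: "integrable lborel (\<lambda>y. (norm (grad z y))\<^sup>2)"
    by (rule sq_integrableD[OF C1c_grad_sq_integrable[OF z]])
  have ZD: "0 \<le> ?ZD" "?ZD \<le> ?Z"
    unfolding set_lebesgue_integral_def using iZ
    by (auto intro!: integral_mono_AE' integral_nonneg_AE simp: indicator_def)
  show ?thesis
  proof (rule that[of E])
    show "second_variation u c R \<phi> = (LINT x'|lborel. (norm (grad \<phi> x'))\<^sup>2) - 2 * E"
      using E(1) C1c_H10(2)[OF Gamma_open Gamma_bounded \<phi>] by simp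
    have "(2 * (LINT x'|lborel. z (x', 0) * g x'))\<^sup>2 \<le> E * ?ZD"
      using E(3)[OF C1c_adm(1)[OF z]] t[of 1] t[of "-1"] by simp
    also have "\<dots> \<le> E * ?Z" by (rule mult_left_mono[OF ZD(2) E(2)])
    finally show "(2 * (LINT x'|lborel. z (x', 0) * (grad \<phi> x' \<bullet> a)))\<^sup>2 \<le> E * ?Z" by (simp only: g_def)
  qed (rule E(2))
qed

end

section \<open>Rescaled test functions\<close>

lemma lborel_integral_rescale:
  fixes f :: "'e::euclidean_space \<Rightarrow> real"
  assumes k: "0 < k" and f: "f \<in> borel_measurable borel"
  shows "(LINT x|lborel. f (k *\<^sub>R (x - c))) = (1 / k) ^ DIM('e) * (LINT x|lborel. f x)"
proof -
  let ?T = "\<lambda>x. - (k *\<^sub>R c) + k *\<^sub>R x"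
  note [measurable] = f
  have "(LINT x|lborel. f x) = (LINT x|density (distr lborel borel ?T) (\<lambda>_. ennreal (\<bar>k\<bar> ^ DIM('e))). f x)"
    using lborel_affine[of k "- (k *\<^sub>R c)"] k by (simp add: ennreal_power)
  also have "\<dots> = \<bar>k\<bar> ^ DIM('e) * (LINT x|lborel. f (?T x))"
    by (subst integral_density) (auto simp: integral_distr)
  also have "(\<lambda>x. f (?T x)) = (\<lambda>x. f (k *\<^sub>R (x - c)))"
    by (simp add: algebra_simps)
  finally show ?thesis using k by (simp add: field_simps power_one_over)
qed

lemma C1_rescale:
  fixes f :: "'e::euclidean_space \<Rightarrow> real"
  assumes f: "C1 f"
  shows "C1 (\<lambda>y. f (k *\<^sub>R (y - c)))" "grad (\<lambda>y. f (k *\<^sub>R (y - c))) y = k *\<^sub>R grad f (k *\<^sub>R (y - c))"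
proof -
  have "((\<lambda>y. k *\<^sub>R (y - c)) has_derivative (\<lambda>h. k *\<^sub>R h)) (at y)" for y
    by (auto intro!: derivative_eq_intros)
  from diff_chain_at[OF this C1_has_derivative[OF f]]
  have d: "((\<lambda>y. f (k *\<^sub>R (y - c))) has_derivative (\<lambda>h. (k *\<^sub>R grad f (k *\<^sub>R (y - c))) \<bullet> h)) (at y)" for y
    by (simp add: o_def grad_inner[OF f, symmetric])
  have "continuous_on UNIV (\<lambda>y. grad f (k *\<^sub>R (y - c)))"
    by (rule continuous_on_compose2[OF grad_continuous[OF f]]) (auto intro!: continuous_intros)
  then show "C1 (\<lambda>y. f (k *\<^sub>R (y - c)))"
    by (intro C1I[OF d] continuous_intros)
  show "grad (\<lambda>y. f (k *\<^sub>R (y - c))) y = k *\<^sub>R grad f (k *\<^sub>R (y - c))"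
    by (rule grad_eqI[OF d])
qed

text \<open>The strict inequality r < R leaves room between the closed ball carrying the support and
  the open ball.\<close>

lemma C1c_rescale:
  fixes f :: "'e::euclidean_space \<Rightarrow> real"
  assumes f: "C1 f" "\<And>x. 1 < norm x \<Longrightarrow> f x = 0" and r: "0 < r" "r < R"
  shows "(\<lambda>y. f ((1 / r) *\<^sub>R (y - c))) \<in> C1c (ball c R)"
proof (rule C1cI[OF C1_rescale(1)[OF f(1)], of "cball c r"])
  fix y assume "y \<notin> cball c r"
  then have "1 < norm ((1 / r) *\<^sub>R (y - c))"
    using r by (simp add: dist_norm norm_minus_commute)
  then show "f ((1 / r) *\<^sub>R (y - c)) = 0" by (rule f(2))
qed (use r in auto)

definition ball_bump :: "'e::euclidean_space \<Rightarrow> real" where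
  "ball_bump x = (max 0 (1 - (norm x)\<^sup>2))\<^sup>2"

lemma C1_ball_bump: "C1 ball_bump"
  unfolding ball_bump_def[abs_def]
  using C1_norm_square[of 0] by (intro C1_pos_square C1_diff C1_const) simp

lemma ball_bump_zero: "1 < norm x \<Longrightarrow> ball_bump x = 0"
  using one_less_power[of "norm x" 2] by (simp add: ball_bump_def)

lemma grad_ball_bump: "grad ball_bump x = (- 4 * max 0 (1 - (norm x)\<^sup>2)) *\<^sub>R x"
proof (rule grad_eqI)
  have "((\<lambda>x. 1 - (norm x)\<^sup>2) has_derivative (\<lambda>h. - 2 * (x \<bullet> h))) (at x)"
    unfolding power2_norm_eq_inner by (auto intro!: derivative_eq_intros simp: inner_commute)
  from diff_chain_at[OF this pos_square_derivative[unfolded has_field_derivative_def]]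
  show "(ball_bump has_derivative (\<lambda>h. ((- 4 * max 0 (1 - (norm x)\<^sup>2)) *\<^sub>R x) \<bullet> h)) (at x)"
    by (simp add: ball_bump_def[abs_def] o_def mult_ac)
qed

text \<open>The factor a . x' is chosen because a . grad \<open>ball_bump\<close> is a nonpositive
  multiple of it: on the crack the pairing becomes minus a square times a nonnegative
  weight.\<close>

definition odd_bump :: "'a::euclidean_space \<Rightarrow> 'a \<times> real \<Rightarrow> real" where
  "odd_bump a y = (a \<bullet> fst y) * ball_bump y"

lemma C1_odd_bump: "C1 (odd_bump a)"
  unfolding odd_bump_def[abs_def]
  by (intro C1_mult C1_ball_bump C1_bounded_linear bounded_linear_compose[OF bounded_linear_inner_right bounded_linear_fst])

lemma odd_bump_zero: "1 < norm y \<Longrightarrow> odd_bump a y = 0"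
  by (simp add: odd_bump_def ball_bump_zero)

lemma AE_zero_open_empty:
  fixes S :: "'e::euclidean_space set"
  assumes "open S" "AE x in lborel. x \<notin> S" shows "S = {}"
proof (rule ccontr)
  assume "S \<noteq> {}"
  have "S \<in> null_sets lborel"
    using assms by (simp add: AE_iff_null_sets)
  then have "negligible S"
    by (simp add: negligible_iff_null_sets null_sets_completionI)
  with open_not_negligible[OF assms(1) \<open>S \<noteq> {}\<close>] show False ..
qed

lemma odd_bump_pairing_nonzero:
  fixes a :: "'a::euclidean_space"
  assumes a: "a \<noteq> 0"
  shows "(LINT x'|lborel. odd_bump a (x', 0) * (grad ball_bump x' \<bullet> a)) \<noteq> 0"
proof
  define f where "f x' = 4 * (max 0 (1 - (norm x')\<^sup>2)) ^ 3 * (a \<bullet> x')\<^sup>2" for x' :: 'a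
  have e: "odd_bump a (x', 0) * (grad ball_bump x' \<bullet> a) = - f x'" for x'
    by (simp add: odd_bump_def ball_bump_def grad_ball_bump f_def inner_commute power2_eq_square power3_eq_cube mult_ac)
  have nonneg: "0 \<le> f x'" for x' by (simp add: f_def)
  have c: "continuous_on UNIV f" unfolding f_def[abs_def] by (intro continuous_intros)
  have i: "integrable lborel f"
  proof (rule integrable_compact_support[OF c, of "cball 0 1"])
    fix y :: 'a assume "y \<notin> cball 0 1"
    then show "f y = 0" using one_less_power[of "norm y" 2] by (simp add: f_def)
  qed simp
  assume "(LINT x'|lborel. odd_bump a (x', 0) * (grad ball_bump x' \<bullet> a)) = 0"
  then have "(LINT x'|lborel. f x') = 0" by (simp add: e)
  then have "AE x' in lborel. f x' = 0"
    using integral_nonneg_eq_0_iff_AE[OF i] nonneg by simp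
  then have "AE x' in lborel. x' \<notin> {x'. 0 < f x'}" by eventually_elim simp
  moreover have "open {x'. 0 < f x'}" by (intro open_Collect_less continuous_intros c)
  ultimately have "{x'. 0 < f x'} = {}" by (intro AE_zero_open_empty)
  \<comment> \<open>A point of norm 1/2 in direction \<open>a\<close>: it is interior to the unit
    ball and a . x' is nonzero there.\<close>
  moreover have "0 < f ((1 / (2 * norm a)) *\<^sub>R a)"
    using a by (simp add: f_def power_divide)
  ultimately show False by blast
qed

text \<open>With n = DIM('a) and the competitors rescaled to radius r, the Dirichlet integral of
  \<phi> is r^(n-2) I, that of z is r^(n-1) Z, and the pairing is r^(n-1) P. Hence E \<ge> 4 P^2
  r^(n-1) / Z, and the form is at most r^(n-2) (I - 8 P^2 r / Z). It is negative for r > I Z / (8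
  P^2), which for r = R/2 is the stated bound on R.\<close>

lemma (in cracked_ball) second_variation_negative:
  fixes a :: 'a and k :: real
  defines "I \<equiv> (LINT x'|lborel. (norm (grad ball_bump (x' :: 'a)))\<^sup>2)"
    and "Z \<equiv> (LINT y|lborel. (norm (grad (odd_bump a) y))\<^sup>2)"
    and "P \<equiv> (LINT x'|lborel. odd_bump a (x', 0) * (grad ball_bump x' \<bullet> a))"
  assumes a: "a \<noteq> 0" and R: "I * Z / (4 * P\<^sup>2) < R"
    and u: "u = (\<lambda>(x', x\<^sub>N). if 0 \<le> x\<^sub>N then a \<bullet> x' + k else - (a \<bullet> x' + k))"
  shows "\<exists>\<phi>\<in>H10 (\<Gamma> c R). second_variation u c R \<phi> < 0"
proof -
  let ?n = "DIM('a)"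
  define r where "r = R / 2"
  have r: "0 < r" "r < R" using radius by (auto simp: r_def)
  define \<phi> where "\<phi> x' = ball_bump ((1 / r) *\<^sub>R (x' - fst c))" for x' :: 'a
  define z where "z y = odd_bump a ((1 / r) *\<^sub>R (y - c))" for y
  have \<phi>: "\<phi> \<in> C1c (\<Gamma> c R)"
    unfolding \<phi>_def[abs_def] Gamma_eq by (rule C1c_rescale[OF C1_ball_bump ball_bump_zero r])
  have z: "z \<in> C1c (ball c R)"
    unfolding z_def[abs_def] by (rule C1c_rescale[OF C1_odd_bump odd_bump_zero r])
  have grad_\<phi>: "grad \<phi> x' = (1 / r) *\<^sub>R grad ball_bump ((1 / r) *\<^sub>R (x' - fst c))" for x'
    unfolding \<phi>_def[abs_def] by (rule C1_rescale(2)[OF C1_ball_bump])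
  have grad_z: "grad z y = (1 / r) *\<^sub>R grad (odd_bump a) ((1 / r) *\<^sub>R (y - c))" for y
    unfolding z_def[abs_def] by (rule C1_rescale(2)[OF C1_odd_bump])
  obtain E where E: "second_variation u c R \<phi> = (LINT x'|lborel. (norm (grad \<phi> x'))\<^sup>2) - 2 * E" "0 \<le> E"
    "(2 * (LINT x'|lborel. z (x', 0) * (grad \<phi> x' \<bullet> a)))\<^sup>2 \<le> E * (LINT y|lborel. (norm (grad z y))\<^sup>2)"
    by (rule second_variation_upper_bound[OF \<phi> z u])
  have r1: "0 < 1 / r" using r by simp
  have I': "(LINT x'|lborel. (norm (grad \<phi> x'))\<^sup>2) = r ^ ?n * I / r\<^sup>2"
  proof -
    have "(\<lambda>x :: 'a. (norm (grad ball_bump x))\<^sup>2 / r\<^sup>2) \<in> borel_measurable borel"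
      by (intro borel_measurable_continuous_onI continuous_intros grad_continuous C1_ball_bump) (use r in auto)
    from lborel_integral_rescale[OF r1 this, of "fst c"] show ?thesis
      using r by (simp add: grad_\<phi> I_def power_divide)
  qed
  have Z': "(LINT y|lborel. (norm (grad z y))\<^sup>2) = r ^ Suc ?n * Z / r\<^sup>2"
  proof -
    have "(\<lambda>y. (norm (grad (odd_bump a) y))\<^sup>2 / r\<^sup>2) \<in> borel_measurable borel"
      by (intro borel_measurable_continuous_onI continuous_intros grad_continuous C1_odd_bump) (use r in auto)
    from lborel_integral_rescale[OF r1 this, of c] show ?thesis
      using r by (simp add: grad_z Z_def power_divide)
  qed
  have P': "(LINT x'|lborel. z (x', 0) * (grad \<phi> x' \<bullet> a)) = r ^ ?n * P / r"
  proof -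
    have "(\<lambda>x'. odd_bump a (x', 0) * (grad ball_bump x' \<bullet> a) / r) \<in> borel_measurable borel"
      by (intro borel_measurable_continuous_onI continuous_intros grad_continuous C1_ball_bump
          continuous_on_compose2[OF C1_continuous[OF C1_odd_bump]]) (use r in auto)
    moreover have "(1 / r) *\<^sub>R ((x', 0) - c) = ((1 / r) *\<^sub>R (x' - fst c), 0)" for x'
      using centre by (cases c) simp
    ultimately show ?thesis
      using lborel_integral_rescale[OF r1, of "\<lambda>x'. odd_bump a (x', 0) * (grad ball_bump x' \<bullet> a) / r" "fst c"] r
      by (simp add: z_def grad_\<phi> P_def)
  qed
  have P: "P \<noteq> 0" unfolding P_def by (rule odd_bump_pairing_nonzero[OF a])
  have rn: "0 < r ^ ?n" using r by simp
  \<comment> \<open>The lower bound for E, cross-multiplied by Z; the common factor r^n / r^2 is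
    divided out.\<close>
  have "4 * P\<^sup>2 * r ^ ?n \<le> E * r * Z"
  proof -
    have "4 * P\<^sup>2 * r ^ ?n * (r ^ ?n / r\<^sup>2) = (2 * (r ^ ?n * P / r))\<^sup>2"
      by (simp add: power_mult_distrib power_divide power2_eq_square)
    also have "\<dots> \<le> E * (r ^ Suc ?n * Z / r\<^sup>2)"
      using E(3) unfolding P' Z' .
    also have "\<dots> = E * r * Z * (r ^ ?n / r\<^sup>2)" by simp
    finally show ?thesis
      by (rule mult_right_le_imp_le) (use rn r in simp)
  qed
  moreover have "I * Z < 8 * P\<^sup>2 * r"
    using R P by (simp add: r_def field_simps)
  ultimately have *: "I * Z * r ^ ?n < 2 * E * r\<^sup>2 * Z"
  proof -
    have "I * Z * r ^ ?n < 8 * P\<^sup>2 * r * r ^ ?n"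
      using \<open>I * Z < 8 * P\<^sup>2 * r\<close> rn by (rule mult_strict_right_mono)
    also have "\<dots> = 2 * r * (4 * P\<^sup>2 * r ^ ?n)" by simp
    also have "\<dots> \<le> 2 * r * (E * r * Z)"
      using \<open>4 * P\<^sup>2 * r ^ ?n \<le> E * r * Z\<close> r by (intro mult_left_mono) auto
    finally show ?thesis by (simp add: power2_eq_square mult_ac)
  qed
  \<comment> \<open>Cancelling a nonnegative factor from a strict inequality is legitimate, so the
    sign of Z settles the matter.\<close>
  have "0 \<le> Z" unfolding Z_def by simp
  then have "I * r ^ ?n < 2 * E * r\<^sup>2"
  proof (rule mult_left_less_imp_less[rotated])
    show "Z * (I * r ^ ?n) < Z * (2 * E * r\<^sup>2)" using * by (simp add: mult_ac)
  qed
  then have "second_variation u c R \<phi> < 0"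
    using r unfolding E(1) I' by (simp add: field_simps)
  then show ?thesis
    using C1c_H10(1)[OF Gamma_open Gamma_bounded \<phi>] by blast
qed

theorem proposition6p5:
  fixes w :: "'a::euclidean_space \<Rightarrow> real" and u :: "'a \<times> real \<Rightarrow> real"
  assumes affine: "linear (\<lambda>x'. w x' - w 0)"
    and nonconstant: "\<not> w constant_on UNIV"
    and u: "u = (\<lambda>(x', x\<^sub>N). if 0 \<le> x\<^sub>N then w x' else - w x')"
  shows "\<exists>R\<^sub>0>0. \<forall>x\<in>crack. \<forall>R>R\<^sub>0. \<exists>\<phi>\<in>H10 (\<Gamma> x R). second_variation u x R \<phi> < 0"
proof -
  \<comment> \<open>The gradient of \<open>w\<close>, read off from its values on the basis
    vectors.\<close>
  define a where "a = (\<Sum>b\<in>Basis. (w b - w 0) *\<^sub>R b)"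
  have w: "w x' = a \<bullet> x' + w 0" for x'
  proof -
    have "w x' - w 0 = (\<Sum>b\<in>Basis. (x' \<bullet> b) *\<^sub>R (w b - w 0))"
      using linear_sum[OF affine, of "\<lambda>b. (x' \<bullet> b) *\<^sub>R b" Basis] linear_scale[OF affine]
      by (simp add: euclidean_representation)
    also have "\<dots> = a \<bullet> x'"
      by (simp add: a_def inner_sum_left) (simp add: inner_commute mult.commute)
    finally show ?thesis by simp
  qed
  have a: "a \<noteq> 0"
  proof
    assume "a = 0"
    then have "w x' = w 0" for x' using w[of x'] by simp
    then show False using nonconstant by (auto simp: constant_on_def)
  qed
  have u': "u = (\<lambda>(x', x\<^sub>N). if 0 \<le> x\<^sub>N then a \<bullet> x' + w 0 else - (a \<bullet> x' + w 0))"
    by (simp only: u w[symmetric])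
  \<comment> \<open>The threshold of \<open>second_variation_negative\<close> depends on
    \<open>a\<close> alone, not on the centre, so it is uniform over the crack. The absolute value
    and the added 1 make it positive.\<close>
  define R\<^sub>0 where "R\<^sub>0 = \<bar>(LINT x'|lborel. (norm (grad ball_bump (x' :: 'a)))\<^sup>2) *
    (LINT y|lborel. (norm (grad (odd_bump a) y))\<^sup>2) /
    (4 * (LINT x'|lborel. odd_bump a (x', 0) * (grad ball_bump x' \<bullet> a))\<^sup>2)\<bar> + 1"
  show ?thesis
  proof (intro exI conjI ballI allI impI)
    show pos: "0 < R\<^sub>0" unfolding R\<^sub>0_def by (rule add_nonneg_pos) auto
    fix x :: "'a \<times> real" and R assume "x \<in> crack" and R: "R\<^sub>0 < R"
    then interpret cracked_ball x R
      using pos by unfold_locales (auto simp: crack_def)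
    show "\<exists>\<phi>\<in>H10 (\<Gamma> x R). second_variation u x R \<phi> < 0"
      by (rule second_variation_negative[OF a _ u']) (use R in \<open>simp add: R\<^sub>0_def\<close>)
  qed
qed

end
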